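(* Let $n\ge 1$, and let $f,g:\mathbb{R}^n\to[0,1]$ be measurable functions. For every $0<\rho<1$, $$\mathbb{E}_\rho\, J(f(X),g(Y);\rho)\le J(\mathbb{E} f,\mathbb{E} g;\rho).$$ If $-1<\rho<0$, then the reverse inequality holds: $\mathbb{E}_\rho\, J(f(X),g(Y);\rho)\ge J(\mathbb{E} f,\mathbb{E} g;\rho)$.
   Context: $\gamma_n$ is the standard Gaussian measure on $\mathbb{R}^n$. For $-1<\rho<1$, $\Pr_\rho$ (with expectation $\mathbb{E}_\rho$) is the law of a pair $(X,Y)$ of jointly Gaussian vectors in $\mathbb{R}^n$, each standard Gaussian, with $\mathbb{E} X_iY_j=\delta_{ij}\rho$. $\mathbb{E} f=\int f\,d\gamma_n$. $\Phi(x)=\int_{-\infty}^x\frac{1}{\sqrt{2\pi}}e^{-y^2/2}dy$, with $\Phi^{-1}(0)=-\infty$ and $\Phi^{-1}(1)=+\infty$. For $x,y\in[0,1]$, $J(x,y;\rho)=\Pr_\rho(X_1\le\Phi^{-1}(x),\,Y_1\le\Phi^{-1}(y))$. *)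

theory Defs
  imports "HOL-Probability.Probability"
begin

section \<open>Definitions\<close>

definition std_gaussian :: "'a::euclidean_space measure" where
  "std_gaussian = density lborel (\<lambda>x. ennreal (exp (- (norm x)\<^sup>2 / 2) / sqrt (2 * pi) ^ DIM('a)))"

text \<open>Degenerate (constant) laws are included: \<open>\<sigma> = 0\<close> is allowed.\<close>

definition normal_law :: "real measure \<Rightarrow> bool" where
  "normal_law \<nu> \<longleftrightarrow> (\<exists>m \<sigma>. \<nu> = distr std_normal_distribution borel (\<lambda>z. m + \<sigma> * z))"

definition jointly_gaussian ::
  "'w measure \<Rightarrow> ('w \<Rightarrow> real^'n) \<Rightarrow> ('w \<Rightarrow> real^'n) \<Rightarrow> bool" where
  "jointly_gaussian M X Y \<longleftrightarrow>
     (\<forall>a b. normal_law (distr M borel (\<lambda>\<omega>. a \<bullet> X \<omega> + b \<bullet> Y \<omega>)))"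

definition correlated_gaussians ::
  "real \<Rightarrow> 'w measure \<Rightarrow> ('w \<Rightarrow> real^'n) \<Rightarrow> ('w \<Rightarrow> real^'n) \<Rightarrow> bool" where
  "correlated_gaussians \<rho> M X Y \<longleftrightarrow>
     prob_space M \<and> X \<in> borel_measurable M \<and> Y \<in> borel_measurable M \<and>
     jointly_gaussian M X Y \<and>
     distr M borel X = std_gaussian \<and> distr M borel Y = std_gaussian \<and>
     (\<forall>i j. (\<integral>\<omega>. X \<omega> $ i * Y \<omega> $ j \<partial>M) = (if i = j then \<rho> else 0))"

text \<open>The law of such a pair. It exists and is unique for \<open>-1 < \<rho> < 1\<close>: see
  \<open>gauss_pair_eq\<close>, \<open>correlated_gaussians_gauss_pair\<close> and \<open>distr_correlated_gaussians\<close> below.\<close>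

definition gauss_pair :: "real \<Rightarrow> ((real^'n) \<times> (real^'n)) measure" where
  "gauss_pair \<rho> = (THE \<mu>. sets \<mu> = sets borel \<and> correlated_gaussians \<rho> \<mu> fst snd)"

text \<open>The standard normal distribution function, and its inverse with the conventions
  that 0 and 1 are sent to minus and plus infinity; only arguments in [0,1] matter.\<close>

definition Phi :: "real \<Rightarrow> real" where
  "Phi x = (LBINT y:{..x}. std_normal_density y)"

definition Phi_inv :: "real \<Rightarrow> ereal" where
  "Phi_inv x = (if x \<le> 0 then -\<infinity> else if 1 \<le> x then \<infinity> else ereal (inv Phi x))"

text \<open>Only one pair of coordinates enters, so the one-dimensional law is used; lemma
  \<open>gauss_J_component\<close> below shows that every coordinate in every dimension gives
  the same value.\<close>

definition gauss_J :: "real \<Rightarrow> real \<Rightarrow> real \<Rightarrow> real" where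
  "gauss_J x y \<rho> = measure (gauss_pair \<rho> :: ((real^1) \<times> (real^1)) measure)
     {p. ereal (fst p $ 1) \<le> Phi_inv x \<and> ereal (snd p $ 1) \<le> Phi_inv y}"

section \<open>A law on a Euclidean space is determined by its characteristic function\<close>

definition char_fun :: "'a::euclidean_space measure \<Rightarrow> 'a \<Rightarrow> complex" where
  "char_fun M t = (CLINT x|M. iexp (t \<bullet> x))"

lemma char_fun_hybrid:
  fixes M N :: "'a::euclidean_space measure"
  assumes "prob_space M" "prob_space N" and M[measurable_cong]: "sets M = sets borel"
    and N[measurable_cong]: "sets N = sets borel"
    and eq: "\<And>t. char_fun M t = char_fun N t"
    and A[measurable]: "\<And>b. A b \<in> sets borel"
    and "finite S" "S \<subseteq> Basis"
  shows "(CLINT x|M. (\<Prod>b\<in>S. of_real (indicator (A b) (x \<bullet> b))) * iexp (t \<bullet> x))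
       = (CLINT x|N. (\<Prod>b\<in>S. of_real (indicator (A b) (x \<bullet> b))) * iexp (t \<bullet> x))"
  using assms(7,8)
proof (induction S arbitrary: t rule: finite_induct)
  case empty
  then show ?case using eq by (simp add: char_fun_def)
next
  case (insert d S)
  interpret M: prob_space M by fact
  interpret N: prob_space N by fact
  define h where "h = (\<lambda>x. \<Prod>b\<in>S. indicator (A b) (x \<bullet> b) :: real)"
  have h[measurable]: "h \<in> borel_measurable borel" unfolding h_def by measurable
  have h1: "\<bar>h x\<bar> \<le> 1" for x
    unfolding h_def abs_prod by (rule prod_le_1) (auto simp: indicator_def)
  have IH: "(CLINT x|M. of_real (h x) * iexp (t \<bullet> x)) = (CLINT x|N. of_real (h x) * iexp (t \<bullet> x))" for t
    using insert.IH[of t] insert.prems by (simp add: h_def)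
  have weighted: "(LINT x|M. indicator (A d) (x \<bullet> d) * w x) = (LINT x|N. indicator (A d) (x \<bullet> d) * w x)"
    if w[measurable]: "w \<in> borel_measurable borel" and w1: "\<And>x. \<bar>w x\<bar> \<le> 1"
      and weq: "\<And>s. (CLINT x|M. of_real (w x) * iexp (s * (x \<bullet> d))) = (CLINT x|N. of_real (w x) * iexp (s * (x \<bullet> d)))"
      and one: "\<And>s. (CLINT x|M. iexp (s * (x \<bullet> d))) = (CLINT x|N. iexp (s * (x \<bullet> d)))"
      for w :: "'a \<Rightarrow> real"
  proof -
    have gen: "(LINT x|M. indicator (A d) (x \<bullet> d) * v x) = (LINT x|N. indicator (A d) (x \<bullet> d) * v x)"
      if v[measurable]: "v \<in> borel_measurable borel" and v1: "\<And>x. 1 \<le> v x" "\<And>x. v x \<le> 3"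
        and veq: "\<And>s. (CLINT x|M. of_real (v x) * iexp (s * (x \<bullet> d))) = (CLINT x|N. of_real (v x) * iexp (s * (x \<bullet> d)))"
      for v :: "'a \<Rightarrow> real"
    proof -
      define c where "c = (LINT x|M. v x)"
      have iM: "integrable M v" by (rule M.integrable_const_bound[where B=3]) (use v1 in \<open>auto intro!: AE_I2 simp: abs_le_iff\<close>, (smt (verit))+)
      have iN: "integrable N v" by (rule N.integrable_const_bound[where B=3]) (use v1 in \<open>auto intro!: AE_I2 simp: abs_le_iff\<close>, (smt (verit))+)
      have cN: "c = (LINT x|N. v x)"
        using veq[of 0] by (simp add: c_def)
      have "c \<ge> (LINT x|M. 1)" unfolding c_def by (rule integral_mono) (use v1 iM in auto)
      hence c: "c \<ge> 1" by (simp add: M.prob_space)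
      have v0: "0 \<le> v x / c" for x using v1(1)[of x] c by auto
      define M' where "M' = distr (density M (\<lambda>x. ennreal (v x / c))) borel (\<lambda>x. x \<bullet> d)"
      define N' where "N' = distr (density N (\<lambda>x. ennreal (v x / c))) borel (\<lambda>x. x \<bullet> d)"
      have "prob_space (density M (\<lambda>x. ennreal (v x / c)))"
        by (rule prob_spaceI, subst emeasure_density) 
          (use v0 c iM in \<open>auto simp: nn_integral_eq_integral c_def[symmetric]\<close>)
      then interpret M': real_distribution M'
        unfolding M'_def real_distribution_def real_distribution_axioms_def
        by (auto intro!: prob_space.prob_space_distr)
      have "prob_space (density N (\<lambda>x. ennreal (v x / c)))"
        by (rule prob_spaceI, subst emeasure_density) 
          (use v0 c iN in \<open>auto simp: nn_integral_eq_integral cN[symmetric]\<close>)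
      then interpret N': real_distribution N'
        unfolding N'_def real_distribution_def real_distribution_axioms_def
        by (auto intro!: prob_space.prob_space_distr)
      have "char M' s = char N' s" for s
      proof -
        have "char M' s = (CLINT x|M. of_real (v x) * iexp (s * (x \<bullet> d))) / c"
          unfolding char_def M'_def by (subst integral_distr, simp, simp, subst integral_density) (use v0 in \<open>auto simp: scaleR_conv_of_real\<close>)
        also have "\<dots> = (CLINT x|N. of_real (v x) * iexp (s * (x \<bullet> d))) / c" by (simp only: veq)
        also have "\<dots> = char N' s"
          unfolding char_def N'_def by (subst integral_distr, simp, simp, subst integral_density) (use v0 in \<open>auto simp: scaleR_conv_of_real\<close>)
        finally show ?thesis .
      qed
      hence "M' = N'" 
        by (intro Levy_uniqueness M'.real_distribution_axioms N'.real_distribution_axioms) auto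
      hence "(LINT y|M'. indicator (A d) y :: real) = (LINT y|N'. indicator (A d) y)" by simp
      moreover have "(LINT y|M'. indicator (A d) y :: real) = (LINT x|M. indicator (A d) (x \<bullet> d) * v x) / c"
        unfolding M'_def by (subst integral_distr, simp, simp, subst integral_density) (use v0 in \<open>auto simp: mult_ac\<close>)
      moreover have "(LINT y|N'. indicator (A d) y :: real) = (LINT x|N. indicator (A d) (x \<bullet> d) * v x) / c"
        unfolding N'_def by (subst integral_distr, simp, simp, subst integral_density) (use v0 in \<open>auto simp: mult_ac\<close>)
      ultimately show ?thesis using c by simp
    qed
    have e: "\<bar>w x\<bar> \<le> 1" "norm (complex_of_real (w x)) \<le> 1" for x using w1 by auto
    have "(LINT x|M. indicator (A d) (x \<bullet> d) * (2 + w x)) = (LINT x|N. indicator (A d) (x \<bullet> d) * (2 + w x))"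
    proof (rule gen)
      fix s
      have "(CLINT x|P. of_real (2 + w x) * iexp (s * (x \<bullet> d))) = 
        2 * (CLINT x|P. iexp (s * (x \<bullet> d))) + (CLINT x|P. of_real (w x) * iexp (s * (x \<bullet> d)))"
        if "prob_space P" and [measurable_cong]: "sets P = sets borel" for P
      proof -
        interpret P: prob_space P by fact
        have "integrable P (\<lambda>x. complex_of_real (w x) * iexp (s * (x \<bullet> d)))"
          by (rule P.integrable_const_bound[where B=1]) (auto simp: norm_mult w1)
        moreover have "integrable P (\<lambda>x. iexp (s * (x \<bullet> d)))"
          by (rule P.integrable_const_bound[where B=1]) auto
        ultimately show ?thesis by (simp add: distrib_right)
      qed
      from this[OF M.prob_space_axioms M] this[OF N.prob_space_axioms N]
      show "(CLINT x|M. of_real (2 + w x) * iexp (s * (x \<bullet> d))) = (CLINT x|N. of_real (2 + w x) * iexp (s * (x \<bullet> d)))"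
        using one weq by simp
    qed (use w1 in \<open>auto simp: abs_le_iff\<close>, (smt (verit))+)
    moreover have "(LINT x|M. indicator (A d) (x \<bullet> d) * 2) = (LINT x|N. indicator (A d) (x \<bullet> d) * (2::real))"
      by (rule gen) (use one in auto)
    moreover have "(LINT x|P. indicator (A d) (x \<bullet> d) * (2 + w x)) = 
        (LINT x|P. indicator (A d) (x \<bullet> d) * 2) + (LINT x|P. indicator (A d) (x \<bullet> d) * w x)"
        if "prob_space P" and [measurable_cong]: "sets P = sets borel" for P
    proof -
      interpret P: prob_space P by fact
      have "integrable P (\<lambda>x. indicator (A d) (x \<bullet> d) * w x)"
        by (rule P.integrable_const_bound[where B=1]) (auto simp: indicator_def w1)
      moreover have "integrable P (\<lambda>x. indicator (A d) (x \<bullet> d) * (2::real))"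
        by (rule P.integrable_const_bound[where B=2]) (auto simp: indicator_def)
      ultimately show ?thesis by (simp add: distrib_left)
    qed
    ultimately show ?thesis using M N M.prob_space_axioms N.prob_space_axioms by simp
  qed
  have one: "(CLINT x|M. iexp (s * (x \<bullet> d))) = (CLINT x|N. iexp (s * (x \<bullet> d)))" for s
    using eq[of "s *\<^sub>R d"] by (simp add: char_fun_def inner_commute)
  define C where "C = (\<lambda>x. h x * cos (t \<bullet> x))"
  define D where "D = (\<lambda>x. h x * sin (t \<bullet> x))"
  have [measurable]: "C \<in> borel_measurable borel" "D \<in> borel_measurable borel"
    unfolding C_def D_def by measurable
  have C1: "\<bar>C x\<bar> \<le> 1" and D1: "\<bar>D x\<bar> \<le> 1" for x
    unfolding C_def D_def abs_mult using h1[of x] by (auto intro!: mult_le_one)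
  have split: "of_real (C x) * iexp (s * (x \<bullet> d)) = (of_real (h x) * iexp ((t + s *\<^sub>R d) \<bullet> x) + of_real (h x) * iexp ((- t + s *\<^sub>R d) \<bullet> x)) / 2"
    "of_real (D x) * iexp (s * (x \<bullet> d)) = (of_real (h x) * iexp ((t + s *\<^sub>R d) \<bullet> x) - of_real (h x) * iexp ((- t + s *\<^sub>R d) \<bullet> x)) / (2 * \<i>)" for s x
  proof -
    have e: "iexp ((t + s *\<^sub>R d) \<bullet> x) = iexp (t \<bullet> x) * iexp (s * (x \<bullet> d))"
      "iexp ((- t + s *\<^sub>R d) \<bullet> x) = exp (- (\<i> * of_real (t \<bullet> x))) * iexp (s * (x \<bullet> d))"
      by (simp_all add: inner_add_left inner_diff_left inner_commute[of d] exp_add[symmetric] distrib_left right_diff_distrib)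
    have c: "of_real (cos (t \<bullet> x)) = (iexp (t \<bullet> x) + exp (- (\<i> * of_real (t \<bullet> x)))) / 2"
      "of_real (sin (t \<bullet> x)) = (iexp (t \<bullet> x) - exp (- (\<i> * of_real (t \<bullet> x)))) / (2 * \<i>)"
      unfolding cos_of_real[symmetric] sin_of_real[symmetric] cos_exp_eq sin_exp_eq by simp_all
    show "of_real (C x) * iexp (s * (x \<bullet> d)) = (of_real (h x) * iexp ((t + s *\<^sub>R d) \<bullet> x) + of_real (h x) * iexp ((- t + s *\<^sub>R d) \<bullet> x)) / 2"
      "of_real (D x) * iexp (s * (x \<bullet> d)) = (of_real (h x) * iexp ((t + s *\<^sub>R d) \<bullet> x) - of_real (h x) * iexp ((- t + s *\<^sub>R d) \<bullet> x)) / (2 * \<i>)"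
      unfolding e C_def D_def of_real_mult[of "h x"] c by (simp_all only: ring_distribs add_divide_distrib diff_divide_distrib times_divide_eq_left times_divide_eq_right mult_ac)
  qed
  have inth: "integrable P (\<lambda>x. complex_of_real (h x) * iexp (s \<bullet> x))"
     if "prob_space P" and [measurable_cong]: "sets P = sets borel" for P s
  proof -
    interpret P: prob_space P by fact
    show ?thesis by (rule P.integrable_const_bound[where B=1]) (auto simp: norm_mult h1)
  qed
  note intM = inth[OF M.prob_space_axioms M] and intN = inth[OF N.prob_space_axioms N]
  have wC: "(CLINT x|M. of_real (C x) * iexp (s * (x \<bullet> d))) = (CLINT x|N. of_real (C x) * iexp (s * (x \<bullet> d)))" for s
    unfolding split using intM intN IH by (simp del: of_real_mult of_real_add)
  have wD: "(CLINT x|M. of_real (D x) * iexp (s * (x \<bullet> d))) = (CLINT x|N. of_real (D x) * iexp (s * (x \<bullet> d)))" for s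
    unfolding split using intM intN IH by (simp del: of_real_mult of_real_add)
  have fin: "(CLINT x|P. (\<Prod>b\<in>insert d S. of_real (indicator (A b) (x \<bullet> b))) * iexp (t \<bullet> x)) =
     of_real (LINT x|P. indicator (A d) (x \<bullet> d) * C x) + \<i> * of_real (LINT x|P. indicator (A d) (x \<bullet> d) * D x)"
     if "prob_space P" and [measurable_cong]: "sets P = sets borel" for P
  proof -
    interpret P: prob_space P by fact
    have "integrable P (\<lambda>x. indicator (A d) (x \<bullet> d) * C x)"
        by (rule P.integrable_const_bound[where B=1]) (auto simp: indicator_def C1)
    hence 1: "integrable P (\<lambda>x. complex_of_real (indicator (A d) (x \<bullet> d) * C x))" by (rule integrable_of_real)
    have "integrable P (\<lambda>x. indicator (A d) (x \<bullet> d) * D x)"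
        by (rule P.integrable_const_bound[where B=1]) (auto simp: indicator_def D1)
    hence 2: "integrable P (\<lambda>x. \<i> * complex_of_real (indicator (A d) (x \<bullet> d) * D x))" by (intro integrable_mult_right integrable_of_real) auto
    have "(CLINT x|P. (\<Prod>b\<in>insert d S. of_real (indicator (A b) (x \<bullet> b))) * iexp (t \<bullet> x)) =
      (CLINT x|P. complex_of_real (indicator (A d) (x \<bullet> d) * C x) + \<i> * complex_of_real (indicator (A d) (x \<bullet> d) * D x))"
    proof (rule Bochner_Integration.integral_cong[OF refl])
      fix x
      have 1: "(\<Prod>b\<in>insert d S. complex_of_real (indicator (A b) (x \<bullet> b))) = of_real (indicator (A d) (x \<bullet> d)) * of_real (h x)"
        using insert.hyps by (simp add: h_def of_real_prod del: of_real_indicator)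
      have 2: "iexp (t \<bullet> x) = of_real (cos (t \<bullet> x)) + \<i> * of_real (sin (t \<bullet> x))"
        by (simp only: exp_Euler cos_of_real sin_of_real)
      show "(\<Prod>b\<in>insert d S. complex_of_real (indicator (A b) (x \<bullet> b))) * iexp (t \<bullet> x) =
        complex_of_real (indicator (A d) (x \<bullet> d) * C x) + \<i> * complex_of_real (indicator (A d) (x \<bullet> d) * D x)"
        unfolding 1 2 C_def D_def of_real_mult by (simp only: ring_distribs mult_ac)
    qed
    also have "\<dots> = of_real (LINT x|P. indicator (A d) (x \<bullet> d) * C x) + \<i> * of_real (LINT x|P. indicator (A d) (x \<bullet> d) * D x)"
      by (subst Bochner_Integration.integral_add[OF 1 2]) (simp del: of_real_mult)
    finally show ?thesis .
  qed
  show ?case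
    unfolding fin[OF M.prob_space_axioms M] fin[OF N.prob_space_axioms N]
    using weighted[OF _ C1 wC one] weighted[OF _ D1 wD one] by simp
qed

theorem char_fun_unique:
  fixes M N :: "'a::euclidean_space measure"
  assumes "prob_space M" "prob_space N" and M[measurable_cong]: "sets M = sets borel"
    and N[measurable_cong]: "sets N = sets borel"
    and eq: "\<And>t. char_fun M t = char_fun N t"
  shows "M = N"
proof -
  interpret M: prob_space M by fact
  interpret N: prob_space N by fact
  let ?E = "range (\<lambda>(a, b). box a b::'a set)"
  let ?A = "\<lambda>n::nat. box (- (real n *\<^sub>R One)) (real n *\<^sub>R One) :: 'a set"
  show ?thesis
  proof (rule measure_eqI_generator_eq[where E = ?E and \<Omega>=UNIV and A = ?A])
    show "Int_stable ?E"
      by (auto simp: Int_stable_def box_Int_box)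
    show "sets M = sigma_sets UNIV ?E" "sets N = sigma_sets UNIV ?E"
      by (simp_all add: borel_eq_box M N)
    show "range ?A \<subseteq> ?E" "(\<Union>i. ?A i) = UNIV"
      unfolding UN_box_eq_UNIV by auto
    show "emeasure M (?A i) \<noteq> \<infinity>" for i by auto
    fix X assume "X \<in> ?E"
    then obtain a b where X: "X = box a b" by auto
    have ind: "(\<Prod>d\<in>Basis. complex_of_real (indicator {a \<bullet> d<..<b \<bullet> d} (x \<bullet> d))) = complex_of_real (indicator X x)" for x
      by (auto simp: X box_def indicator_def of_real_prod[symmetric] simp del: of_real_prod)
    have "complex_of_real (measure M X) = of_real (measure N X)"
      using char_fun_hybrid[OF assms(1-5), of "\<lambda>d. {a \<bullet> d<..<b \<bullet> d}" Basis 0] 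
      by (simp add: ind del: of_real_indicator)
         (simp add: sets_eq_imp_space_eq[OF M] sets_eq_imp_space_eq[OF N] X)
    thus "emeasure M X = emeasure N X"
      by (simp add: M.emeasure_eq_measure N.emeasure_eq_measure)
  qed simp
qed


section \<open>The law \<open>gauss_pair\<close> is well defined\<close>

lemma sets_std_gaussian [simp, measurable_cong]: "sets std_gaussian = sets borel"
  and space_std_gaussian [simp]: "space std_gaussian = UNIV"
  by (simp_all add: std_gaussian_def)

lemma std_gaussian_density_prod:
  fixes x :: "'a::euclidean_space"
  shows "exp (- (norm x)\<^sup>2 / 2) / sqrt (2 * pi) ^ DIM('a) = (\<Prod>b\<in>Basis. std_normal_density (x \<bullet> b))"
proof -
  have "(norm x)\<^sup>2 = (\<Sum>b\<in>Basis. (x \<bullet> b)\<^sup>2)"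
    unfolding power2_norm_eq_inner by (subst euclidean_inner) (simp add: power2_eq_square)
  thus ?thesis
    by (simp add: std_normal_density_def prod.distrib exp_sum[symmetric] sum_negf sum_divide_distrib power_one_over field_simps prod_dividef)
qed

lemma std_gaussian_eq: "std_gaussian = density lborel (\<lambda>x::'a::euclidean_space. ennreal (\<Prod>b\<in>Basis. std_normal_density (x \<bullet> b)))"
  unfolding std_gaussian_def std_gaussian_density_prod ..

lemma prob_space_std_gaussian: "prob_space (std_gaussian :: 'a::euclidean_space measure)"
proof
  have "(\<integral>\<^sup>+x. ennreal (\<Prod>b\<in>Basis. std_normal_density ((x::'a) \<bullet> b)) \<partial>lborel) = 
    (\<integral>\<^sup>+x. (\<Prod>b\<in>Basis. ennreal (std_normal_density ((x::'a) \<bullet> b))) \<partial>lborel)"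
    by (simp add: prod_ennreal)
  also have "\<dots> = 1"
    by (subst nn_integral_lborel_prod) (auto simp: nn_integral_eq_integral)
  finally show "emeasure (std_gaussian :: 'a measure) (space std_gaussian) = 1"
    by (simp add: std_gaussian_eq emeasure_density)
qed

lemma char_fun_std_gaussian: "char_fun std_gaussian (t::'a::euclidean_space) = exp (- (t \<bullet> t) / 2)"
proof -
  interpret product_sigma_finite "\<lambda>_::'a. lborel :: real measure" ..
  have int: "integrable lborel (\<lambda>y. std_normal_density y *\<^sub>R iexp (u * y))" for u :: real
  proof -
    have "integrable std_normal_distribution (\<lambda>y. iexp (u * y))"
      by (intro finite_measure.integrable_const_bound[where B=1] prob_space.finite_measure prob_space_normal_density) auto
    thus ?thesis by (subst (asm) integrable_density) auto
  qed
  have chr: "(CLINT y|lborel. std_normal_density y *\<^sub>R iexp (u * y)) = exp (- (u^2) / 2)" for u :: real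
    using fun_cong[OF char_std_normal_distribution, of u] unfolding char_def 
    by (subst (asm) integral_density) (auto simp: exp_of_real[symmetric])
  have "char_fun std_gaussian t = (CLINT x|lborel. (\<Prod>b\<in>Basis. std_normal_density (x \<bullet> b)) *\<^sub>R iexp (t \<bullet> x))"
    unfolding char_fun_def std_gaussian_eq by (subst integral_density) (auto intro!: prod_nonneg)
  also have "\<dots> = (CLINT x|lborel. (\<Prod>b\<in>Basis. std_normal_density (x \<bullet> b) *\<^sub>R iexp (t \<bullet> b * (x \<bullet> b))))"
  proof (rule Bochner_Integration.integral_cong[OF refl])
    fix x :: 'a
    have "iexp (t \<bullet> x) = (\<Prod>b\<in>Basis. iexp (t \<bullet> b * (x \<bullet> b)))"
      by (subst euclidean_inner) (simp add: exp_sum[symmetric] sum_distrib_left)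
    thus "(\<Prod>b\<in>Basis. std_normal_density (x \<bullet> b)) *\<^sub>R iexp (t \<bullet> x) =
        (\<Prod>b\<in>Basis. std_normal_density (x \<bullet> b) *\<^sub>R iexp (t \<bullet> b * (x \<bullet> b)))"
      by (simp only: scaleR_conv_of_real prod.distrib of_real_prod)
  qed
  also have "\<dots> = (\<integral>f. (\<Prod>b\<in>Basis. std_normal_density (f b) *\<^sub>R iexp (t \<bullet> b * f b)) \<partial>(\<Pi>\<^sub>M b\<in>(Basis::'a set). lborel))"
    by (subst lborel_eq, subst integral_distr) (auto intro!: Bochner_Integration.integral_cong prod.cong)
  also have "\<dots> = (\<Prod>b\<in>Basis. exp (- ((t \<bullet> b)^2) / 2))"
    by (subst product_integral_prod) (use int chr in auto)
  also have "\<dots> = exp (- (t \<bullet> t) / 2)"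
    by (subst (2) euclidean_inner) 
       (simp add: exp_sum[symmetric] exp_of_real[symmetric] sum_negf sum_divide_distrib power2_eq_square)
  finally show ?thesis .
qed

lemma char_normal:
  "char (distr std_normal_distribution borel (\<lambda>z. m + \<sigma> * z)) u = iexp (u * m) * exp (- (u * \<sigma>)\<^sup>2 / 2)"
proof -
  have "char (distr std_normal_distribution borel (\<lambda>z. m + \<sigma> * z)) u = 
      (CLINT z|std_normal_distribution. iexp (u * m) * iexp (u * \<sigma> * z))"
    unfolding char_def by (subst integral_distr) (auto simp: exp_add[symmetric] algebra_simps)
  also have "\<dots> = iexp (u * m) * char std_normal_distribution (u * \<sigma>)"
    unfolding char_def by (subst integral_mult_right_zero) (rule refl)
  finally show ?thesis by (simp add: char_std_normal_distribution exp_of_real[symmetric])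
qed

lemma real_distribution_distr:
  "prob_space M \<Longrightarrow> f \<in> borel_measurable M \<Longrightarrow> real_distribution (distr M borel f)"
  unfolding real_distribution_def real_distribution_axioms_def by (auto intro!: prob_space.prob_space_distr)

lemma real_distribution_normal: "real_distribution (distr std_normal_distribution borel (\<lambda>z. m + \<sigma> * z))"
  by (intro real_distribution_distr prob_space_normal_density) auto

lemma distr_inner_normal:
  assumes "prob_space P" and P[measurable_cong]: "sets P = sets (borel :: 'a::euclidean_space measure)"
    and char: "\<And>u. char_fun P (u *\<^sub>R t) = exp (- (u * \<sigma>)\<^sup>2 / 2)"
  shows "distr P borel (\<lambda>x. t \<bullet> x) = distr std_normal_distribution borel (\<lambda>z. 0 + \<sigma> * z)"
proof (rule Levy_uniqueness)
  show "real_distribution (distr P borel (\<lambda>x. t \<bullet> x))"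
    using assms by (intro real_distribution_distr) auto
  show "char (distr P borel (\<lambda>x. t \<bullet> x)) = char (distr std_normal_distribution borel (\<lambda>z. 0 + \<sigma> * z))"
  proof
    fix u
    have "char (distr P borel (\<lambda>x. t \<bullet> x)) u = char_fun P (u *\<^sub>R t)"
      unfolding char_def char_fun_def by (subst integral_distr) auto
    thus "char (distr P borel (\<lambda>x. t \<bullet> x)) u = char (distr std_normal_distribution borel (\<lambda>z. 0 + \<sigma> * z)) u"
      unfolding char_normal by (simp add: char)
  qed
qed (rule real_distribution_normal)

lemma normal_moments:
  assumes [measurable]: "L \<in> borel_measurable M" 
    and L: "distr M borel L = distr std_normal_distribution borel (\<lambda>z. m + \<sigma> * z)"
  shows "integrable M L" "integrable M (\<lambda>\<omega>. (L \<omega>)\<^sup>2)"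
    and "integral\<^sup>L M L = m" "(\<integral>\<omega>. (L \<omega>)\<^sup>2 \<partial>M) = m\<^sup>2 + \<sigma>\<^sup>2"
proof -
  interpret N: prob_space std_normal_distribution by (rule prob_space_normal_density) simp
  have i: "integrable std_normal_distribution (\<lambda>z. z)" "integrable std_normal_distribution (\<lambda>z. z\<^sup>2)"
    using integrable_std_normal_distribution_moment[of 1] integrable_std_normal_distribution_moment[of 2] by simp_all
  have e: "integral\<^sup>L std_normal_distribution (\<lambda>z. z) = 0" "integral\<^sup>L std_normal_distribution (\<lambda>z. z\<^sup>2) = 1"
    using integral_std_normal_distribution_moment_odd[of 1] std_normal_distribution_even_moments(1)[of 1] by (simp_all add: fact_numeral)
  have sq: "(m + \<sigma> * z)\<^sup>2 = m\<^sup>2 + (2 * m * \<sigma>) * z + \<sigma>\<^sup>2 * z\<^sup>2" for z by (simp add: power2_eq_square algebra_simps)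
  have i': "integrable std_normal_distribution (\<lambda>z. m + \<sigma> * z)" "integrable std_normal_distribution (\<lambda>z. (m + \<sigma> * z)\<^sup>2)"
    unfolding sq by (intro Bochner_Integration.integrable_add integrable_mult_right N.integrable_const i)+
  have tr: "integrable M (\<lambda>\<omega>. f (L \<omega>)) \<longleftrightarrow> integrable std_normal_distribution (\<lambda>z. f (m + \<sigma> * z))"
    if [measurable]: "f \<in> borel_measurable borel" for f :: "real \<Rightarrow> real"
    using integrable_distr_eq[of L M borel f] integrable_distr_eq[of "\<lambda>z. m + \<sigma> * z" std_normal_distribution borel f] L by simp
  have tri: "(\<integral>\<omega>. f (L \<omega>) \<partial>M) = (\<integral>z. f (m + \<sigma> * z) \<partial>std_normal_distribution)"
    if [measurable]: "f \<in> borel_measurable borel" for f :: "real \<Rightarrow> real"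
    using integral_distr[of L M borel f] integral_distr[of "\<lambda>z. m + \<sigma> * z" std_normal_distribution borel f] L by simp
  show "integrable M L" using tr[of "\<lambda>z. z"] i' by simp
  show "integrable M (\<lambda>\<omega>. (L \<omega>)\<^sup>2)" using tr[of "\<lambda>z. z\<^sup>2"] i' by simp
  have c: "(\<integral>z. c \<partial>std_normal_distribution) = c" for c :: real
    using N.prob_space by simp
  have "(\<integral>z. m + \<sigma> * z \<partial>std_normal_distribution) = (\<integral>z. m \<partial>std_normal_distribution) + (\<integral>z. \<sigma> * z \<partial>std_normal_distribution)"
    by (intro Bochner_Integration.integral_add integrable_mult_right N.integrable_const i)
  thus "integral\<^sup>L M L = m" using tri[of "\<lambda>z. z"] c e by simp
  have "(\<integral>z. m\<^sup>2 + (2 * m * \<sigma>) * z + \<sigma>\<^sup>2 * z\<^sup>2 \<partial>std_normal_distribution) = 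
     (\<integral>z. m\<^sup>2 \<partial>std_normal_distribution) + (\<integral>z. (2 * m * \<sigma>) * z \<partial>std_normal_distribution) + (\<integral>z. \<sigma>\<^sup>2 * z\<^sup>2 \<partial>std_normal_distribution)"
    by (intro Bochner_Integration.integral_add[THEN trans] arg_cong2[where f="(+)"] refl Bochner_Integration.integrable_add integrable_mult_right N.integrable_const i)
  also have "\<dots> = m\<^sup>2 + \<sigma>\<^sup>2"
    unfolding c integral_mult_right_zero e by simp
  finally show "(\<integral>\<omega>. (L \<omega>)\<^sup>2 \<partial>M) = m\<^sup>2 + \<sigma>\<^sup>2" using tri[of "\<lambda>z. z\<^sup>2"] by (simp add: sq)
qed

lemma std_gaussian_inner:
  "distr std_gaussian borel (\<lambda>x. t \<bullet> x) = distr std_normal_distribution borel (\<lambda>z. 0 + norm (t :: 'a::euclidean_space) * z)"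
  by (rule distr_inner_normal)
     (simp_all add: prob_space_std_gaussian char_fun_std_gaussian power_mult_distrib power2_norm_eq_inner, simp add: power2_eq_square)

lemma char_fun_correlated_gaussians:
  assumes "correlated_gaussians \<rho> M X Y"
  shows "char_fun (distr M borel (\<lambda>\<omega>. (X \<omega>, Y \<omega>))) (a, b) = exp (- (a \<bullet> a + 2 * \<rho> * (a \<bullet> b) + b \<bullet> b) / 2)"
proof -
  from assms have M: "prob_space M" and [measurable]: "X \<in> borel_measurable M" "Y \<in> borel_measurable M"
    and jg: "normal_law (distr M borel (\<lambda>\<omega>. a \<bullet> X \<omega> + b \<bullet> Y \<omega>))"
    and X: "distr M borel X = std_gaussian" and Y: "distr M borel Y = std_gaussian"
    and cov: "\<And>i j. (\<integral>\<omega>. X \<omega> $ i * Y \<omega> $ j \<partial>M) = (if i = j then \<rho> else 0)"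
    by (auto simp: correlated_gaussians_def jointly_gaussian_def)
  have lin: "distr M borel (\<lambda>\<omega>. c \<bullet> Z \<omega>) = distr std_normal_distribution borel (\<lambda>z. 0 + norm c * z)"
    if "distr M borel Z = std_gaussian" and [measurable]: "Z \<in> borel_measurable M" for c :: "real^'b" and Z
    unfolding std_gaussian_inner[symmetric] that(1)[symmetric] by (subst distr_distr) (auto simp: comp_def)
  have mX: "integrable M (\<lambda>\<omega>. c \<bullet> X \<omega>)" "integrable M (\<lambda>\<omega>. (c \<bullet> X \<omega>)\<^sup>2)"
      "(\<integral>\<omega>. c \<bullet> X \<omega> \<partial>M) = 0" "(\<integral>\<omega>. (c \<bullet> X \<omega>)\<^sup>2 \<partial>M) = c \<bullet> c" for c
    using normal_moments[OF _ lin[OF X], of c] by (simp_all add: power2_norm_eq_inner)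
  have mY: "integrable M (\<lambda>\<omega>. c \<bullet> Y \<omega>)" "integrable M (\<lambda>\<omega>. (c \<bullet> Y \<omega>)\<^sup>2)"
      "(\<integral>\<omega>. c \<bullet> Y \<omega> \<partial>M) = 0" "(\<integral>\<omega>. (c \<bullet> Y \<omega>)\<^sup>2 \<partial>M) = c \<bullet> c" for c
    using normal_moments[OF _ lin[OF Y], of c] by (simp_all add: power2_norm_eq_inner)
  obtain m \<sigma> where L: "distr M borel (\<lambda>\<omega>. a \<bullet> X \<omega> + b \<bullet> Y \<omega>) = distr std_normal_distribution borel (\<lambda>z. m + \<sigma> * z)"
    using jg by (auto simp: normal_law_def)
  have mL: "(\<integral>\<omega>. a \<bullet> X \<omega> + b \<bullet> Y \<omega> \<partial>M) = m" "(\<integral>\<omega>. (a \<bullet> X \<omega> + b \<bullet> Y \<omega>)\<^sup>2 \<partial>M) = m\<^sup>2 + \<sigma>\<^sup>2"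
    by (rule normal_moments[OF _ L]; measurable)+
  have prod_int: "integrable M (\<lambda>\<omega>. U \<omega> * V \<omega>)" if "integrable M (\<lambda>\<omega>. (U \<omega>)\<^sup>2)" "integrable M (\<lambda>\<omega>. (V \<omega>)\<^sup>2)"
     and [measurable]: "U \<in> borel_measurable M" "V \<in> borel_measurable M" for U V :: "_ \<Rightarrow> real"
  proof (rule Bochner_Integration.integrable_bound)
    show "integrable M (\<lambda>\<omega>. (U \<omega>)\<^sup>2 + (V \<omega>)\<^sup>2)" using that by simp
    show "AE \<omega> in M. norm (U \<omega> * V \<omega>) \<le> norm ((U \<omega>)\<^sup>2 + (V \<omega>)\<^sup>2)"
    proof (rule AE_I2)
      fix \<omega>
      have "2 * (\<bar>U \<omega>\<bar> * \<bar>V \<omega>\<bar>) \<le> (U \<omega>)\<^sup>2 + (V \<omega>)\<^sup>2"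
        using sum_squares_bound[of "\<bar>U \<omega>\<bar>" "\<bar>V \<omega>\<bar>"] by (simp add: mult_ac)
      thus "norm (U \<omega> * V \<omega>) \<le> norm ((U \<omega>)\<^sup>2 + (V \<omega>)\<^sup>2)"
        using mult_nonneg_nonneg[OF abs_ge_zero[of "U \<omega>"] abs_ge_zero[of "V \<omega>"]] unfolding real_norm_def abs_mult by linarith
    qed
  qed auto
  have comp: "x $ i = axis i 1 \<bullet> x" for x :: "real^'b" and i by (simp add: inner_axis inner_commute)
  have iij: "integrable M (\<lambda>\<omega>. X \<omega> $ i * Y \<omega> $ j)" for i j
    unfolding comp by (intro prod_int mX(2) mY(2)) auto
  have XY: "(\<integral>\<omega>. (a \<bullet> X \<omega>) * (b \<bullet> Y \<omega>) \<partial>M) = \<rho> * (a \<bullet> b)"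
  proof -
    have "(\<integral>\<omega>. (a \<bullet> X \<omega>) * (b \<bullet> Y \<omega>) \<partial>M) = (\<integral>\<omega>. (\<Sum>i\<in>UNIV. \<Sum>j\<in>UNIV. (a $ i * b $ j) * (X \<omega> $ i * Y \<omega> $ j)) \<partial>M)"
      by (rule Bochner_Integration.integral_cong[OF refl]) (simp add: inner_vec_def sum_product mult_ac)
    also have "\<dots> = (\<Sum>i\<in>UNIV. \<Sum>j\<in>UNIV. (a $ i * b $ j) * (if i = j then \<rho> else 0))"
      using iij by (simp add: cov)
    also have "\<dots> = \<rho> * (a \<bullet> b)"
      by (simp add: inner_vec_def sum_distrib_left if_distrib sum.delta mult_ac cong: if_cong)
    finally show ?thesis .
  qed
  have m0: "m = 0" using mL(1) by (simp add: mX mY)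
  have "m\<^sup>2 + \<sigma>\<^sup>2 = (\<integral>\<omega>. (a \<bullet> X \<omega> + b \<bullet> Y \<omega>)\<^sup>2 \<partial>M)" using mL(2) by simp
  also have "\<dots> = (\<integral>\<omega>. (a \<bullet> X \<omega>)\<^sup>2 + 2 * ((a \<bullet> X \<omega>) * (b \<bullet> Y \<omega>)) + (b \<bullet> Y \<omega>)\<^sup>2 \<partial>M)"
    by (rule Bochner_Integration.integral_cong[OF refl]) (simp add: power2_eq_square algebra_simps)
  also have "\<dots> = a \<bullet> a + 2 * \<rho> * (a \<bullet> b) + b \<bullet> b"
    using prod_int[OF mX(2)[of a] mY(2)[of b]] by (simp add: mX mY XY)
  finally have \<sigma>: "\<sigma>\<^sup>2 = a \<bullet> a + 2 * \<rho> * (a \<bullet> b) + b \<bullet> b" using m0 by simp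
  have "char_fun (distr M borel (\<lambda>\<omega>. (X \<omega>, Y \<omega>))) (a, b) = char (distr M borel (\<lambda>\<omega>. a \<bullet> X \<omega> + b \<bullet> Y \<omega>)) 1"
    unfolding char_fun_def char_def
    by (subst integral_distr, simp, simp, subst integral_distr) auto
  also have "\<dots> = exp (- (a \<bullet> a + 2 * \<rho> * (a \<bullet> b) + b \<bullet> b) / 2)"
    unfolding L char_normal by (simp add: m0 \<sigma>)
  finally show ?thesis .
qed

definition noise_pair :: "real \<Rightarrow> ((real^'n) \<times> (real^'n)) measure" where
  "noise_pair \<rho> = distr (std_gaussian \<Otimes>\<^sub>M std_gaussian) borel
     (\<lambda>(x, z). (x, \<rho> *\<^sub>R x + sqrt (1 - \<rho>\<^sup>2) *\<^sub>R z))"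

lemma correlated_gaussians_unique:
  fixes X Y :: "'w \<Rightarrow> real^'n" and U V :: "'v \<Rightarrow> real^'n"
  assumes "correlated_gaussians \<rho> M X Y" "correlated_gaussians \<rho> N U V"
  shows "distr M borel (\<lambda>\<omega>. (X \<omega>, Y \<omega>)) = distr N borel (\<lambda>\<omega>. (U \<omega>, V \<omega>))"
proof (rule char_fun_unique)
  show "prob_space (distr M borel (\<lambda>\<omega>. (X \<omega>, Y \<omega>)))" "prob_space (distr N borel (\<lambda>\<omega>. (U \<omega>, V \<omega>)))"
    using assms unfolding correlated_gaussians_def by (auto intro!: prob_space.prob_space_distr)
  fix t :: "(real^'n) \<times> (real^'n)"
  show "char_fun (distr M borel (\<lambda>\<omega>. (X \<omega>, Y \<omega>))) t = char_fun (distr N borel (\<lambda>\<omega>. (U \<omega>, V \<omega>))) t"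
    using assms by (cases t) (simp add: char_fun_correlated_gaussians)
qed auto

context
  fixes \<rho> :: real assumes \<rho>: "-1 < \<rho>" "\<rho> < 1"
begin

lemma correlated_gaussians_noise_pair:
  "correlated_gaussians \<rho> (noise_pair \<rho> :: ((real^'n) \<times> (real^'n)) measure) fst snd"
proof -
  let ?G = "std_gaussian :: (real^'n) measure" and ?P = "noise_pair \<rho> :: ((real^'n) \<times> (real^'n)) measure"
  interpret G: prob_space ?G by (rule prob_space_std_gaussian)
  interpret GG: pair_prob_space ?G ?G ..
  have [measurable]: "(\<lambda>(x, z). (x, \<rho> *\<^sub>R x + sqrt (1 - \<rho>\<^sup>2) *\<^sub>R z)) \<in> ?G \<Otimes>\<^sub>M ?G \<rightarrow>\<^sub>M (borel :: ((real^'n) \<times> (real^'n)) measure)"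
    unfolding case_prod_beta by measurable
  have P: "prob_space ?P" unfolding noise_pair_def by (rule GG.prob_space_distr) simp
  have sP[measurable_cong, simp]: "sets ?P = sets borel" by (simp add: noise_pair_def)
  have [measurable]: "fst \<in> borel_measurable ?P" "snd \<in> borel_measurable ?P"
    unfolding measurable_cong_sets[OF sP refl] by (simp_all add: borel_prod[symmetric])
  have \<rho>2: "\<rho>\<^sup>2 \<le> 1" using \<rho> by (simp add: abs_square_le_1)
  have chr: "char_fun ?P (a, b) = exp (- (a \<bullet> a + 2 * \<rho> * (a \<bullet> b) + b \<bullet> b) / 2)" for a b :: "real^'n"
  proof -
    have "char_fun ?P (a, b) = (CLINT p|?G \<Otimes>\<^sub>M ?G. iexp ((a + \<rho> *\<^sub>R b) \<bullet> fst p) * iexp ((sqrt (1 - \<rho>\<^sup>2) *\<^sub>R b) \<bullet> snd p))"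
      unfolding char_fun_def noise_pair_def
      by (subst integral_distr) (auto intro!: Bochner_Integration.integral_cong simp: exp_add[symmetric] inner_add_left inner_add_right algebra_simps)
    also have "\<dots> = (CLINT x|?G. CLINT z|?G. iexp ((a + \<rho> *\<^sub>R b) \<bullet> x) * iexp ((sqrt (1 - \<rho>\<^sup>2) *\<^sub>R b) \<bullet> z))"
      by (subst GG.integral_fst'[symmetric])
         (auto intro!: GG.P.integrable_const_bound[where B=1] simp: norm_mult)
    also have "\<dots> = char_fun ?G (a + \<rho> *\<^sub>R b) * char_fun ?G (sqrt (1 - \<rho>\<^sup>2) *\<^sub>R b)"
      unfolding char_fun_def by (simp only: integral_mult_right_zero integral_mult_left_zero)
    also have "\<dots> = exp (of_real (- ((a + \<rho> *\<^sub>R b) \<bullet> (a + \<rho> *\<^sub>R b)) / 2 + - ((sqrt (1 - \<rho>\<^sup>2) *\<^sub>R b) \<bullet> (sqrt (1 - \<rho>\<^sup>2) *\<^sub>R b)) / 2))"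
      unfolding char_fun_std_gaussian exp_of_real of_real_mult[symmetric] exp_add[symmetric] by (simp only: exp_add)
    also have "- ((a + \<rho> *\<^sub>R b) \<bullet> (a + \<rho> *\<^sub>R b)) / 2 + - ((sqrt (1 - \<rho>\<^sup>2) *\<^sub>R b) \<bullet> (sqrt (1 - \<rho>\<^sup>2) *\<^sub>R b)) / 2
      = - (a \<bullet> a + 2 * \<rho> * (a \<bullet> b) + b \<bullet> b) / 2"
    proof -
      have "(sqrt (1 - \<rho>\<^sup>2) *\<^sub>R b) \<bullet> (sqrt (1 - \<rho>\<^sup>2) *\<^sub>R b) = (1 - \<rho>\<^sup>2) * (b \<bullet> b)"
        using \<rho>2 by (simp add: mult.assoc[symmetric])
      thus ?thesis by (simp only:) (simp add: inner_add_left inner_add_right inner_commute[of b a] power2_eq_square field_simps)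
    qed
    finally show ?thesis unfolding exp_of_real .
  qed
  define \<sigma> where "\<sigma> = (\<lambda>a b::real^'n. sqrt (a \<bullet> a + 2 * \<rho> * (a \<bullet> b) + b \<bullet> b))"
  have nonneg: "0 \<le> a \<bullet> a + 2 * \<rho> * (a \<bullet> b) + b \<bullet> b" for a b :: "real^'n"
  proof -
    have "0 \<le> (a + \<rho> *\<^sub>R b) \<bullet> (a + \<rho> *\<^sub>R b) + (1 - \<rho>\<^sup>2) * (b \<bullet> b)" using \<rho>2 by (intro add_nonneg_nonneg) auto
    also have "\<dots> = a \<bullet> a + 2 * \<rho> * (a \<bullet> b) + b \<bullet> b"
      by (simp add: inner_add_left inner_add_right inner_commute[of b a] power2_eq_square field_simps)
    finally show ?thesis .
  qed
  have \<sigma>2: "(\<sigma> a b)\<^sup>2 = a \<bullet> a + 2 * \<rho> * (a \<bullet> b) + b \<bullet> b" for a b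
    using nonneg by (simp add: \<sigma>_def)
  have lin: "distr ?P borel (\<lambda>p. a \<bullet> fst p + b \<bullet> snd p) = distr std_normal_distribution borel (\<lambda>z. 0 + \<sigma> a b * z)" for a b
  proof -
    have "distr ?P borel (\<lambda>p. (a, b) \<bullet> p) = distr std_normal_distribution borel (\<lambda>z. 0 + \<sigma> a b * z)"
    proof (rule distr_inner_normal[OF P sP])
      fix u
      show "char_fun ?P (u *\<^sub>R (a, b)) = exp (- (u * \<sigma> a b)\<^sup>2 / 2)"
        by (simp add: chr power_mult_distrib \<sigma>2) (simp add: power2_eq_square algebra_simps)
    qed
    thus ?thesis by (simp add: inner_prod_def)
  qed
  have marg: "distr ?P borel fst = ?G" "distr ?P borel snd = ?G"
  proof -
    show "distr ?P borel fst = ?G"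
    proof (rule char_fun_unique)
      fix t :: "real^'n"
      have "char_fun (distr ?P borel fst) t = char_fun ?P (t, 0)"
        unfolding char_fun_def by (subst integral_distr) (simp_all add: inner_prod_def)
      thus "char_fun (distr ?P borel fst) t = char_fun ?G t" by (simp add: chr char_fun_std_gaussian)
    qed (use P in \<open>auto intro!: prob_space.prob_space_distr prob_space_std_gaussian\<close>)
    show "distr ?P borel snd = ?G"
    proof (rule char_fun_unique)
      fix t :: "real^'n"
      have "char_fun (distr ?P borel snd) t = char_fun ?P (0, t)"
        unfolding char_fun_def by (subst integral_distr) (simp_all add: inner_prod_def)
      thus "char_fun (distr ?P borel snd) t = char_fun ?G t" by (simp add: chr char_fun_std_gaussian)
    qed (use P in \<open>auto intro!: prob_space.prob_space_distr prob_space_std_gaussian\<close>)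
  qed
  have cov: "(\<integral>p. fst p $ i * snd p $ j \<partial>?P) = (if i = j then \<rho> else 0)" for i j
  proof -
    have comp: "x $ i = axis i 1 \<bullet> x" for x :: "real^'n" and i by (simp add: inner_axis inner_commute)
    let ?a = "axis i 1 :: real^'n" and ?b = "axis j 1 :: real^'n"
    note m = normal_moments[OF _ lin[of ?a ?b]] and m1 = normal_moments[OF _ lin[of ?a 0]] and m2 = normal_moments[OF _ lin[of 0 ?b]]
    have "(\<integral>p. fst p $ i * snd p $ j \<partial>?P) = 
      (\<integral>p. ((?a \<bullet> fst p + ?b \<bullet> snd p)\<^sup>2 - (?a \<bullet> fst p + 0 \<bullet> snd p)\<^sup>2 - (0 \<bullet> fst p + ?b \<bullet> snd p)\<^sup>2) / 2 \<partial>?P)"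
      by (rule Bochner_Integration.integral_cong[OF refl]) (simp add: comp power2_eq_square algebra_simps)
    also have "\<dots> = ((\<sigma> ?a ?b)\<^sup>2 - (\<sigma> ?a 0)\<^sup>2 - (\<sigma> 0 ?b)\<^sup>2) / 2"
      using m(2,4) m1(2,4) m2(2,4) by simp
    also have "\<dots> = \<rho> * (?a \<bullet> ?b)" by (simp add: \<sigma>2)
    finally show ?thesis by (simp add: inner_axis_axis)
  qed
  have "normal_law (distr ?P borel (\<lambda>p. a \<bullet> fst p + b \<bullet> snd p))" for a b
    unfolding normal_law_def using lin by blast
  thus ?thesis
    unfolding correlated_gaussians_def jointly_gaussian_def using P marg cov by simp
qed


theorem gauss_pair_eq: "gauss_pair \<rho> = (noise_pair \<rho> :: ((real^'n) \<times> (real^'n)) measure)"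
  unfolding gauss_pair_def
proof (rule the_equality)
  show "sets (noise_pair \<rho> :: ((real^'n) \<times> (real^'n)) measure) = sets borel \<and> correlated_gaussians \<rho> (noise_pair \<rho> :: ((real^'n) \<times> (real^'n)) measure) fst snd"
    by (simp add: correlated_gaussians_noise_pair) (simp add: noise_pair_def)
  fix \<mu> :: "((real^'n) \<times> (real^'n)) measure"
  assume \<mu>: "sets \<mu> = sets borel \<and> correlated_gaussians \<rho> \<mu> fst snd"
  have "distr \<mu> borel (\<lambda>p. (fst p, snd p)) = distr (noise_pair \<rho>) borel (\<lambda>p. (fst p, snd p))"
    by (rule correlated_gaussians_unique[OF _ correlated_gaussians_noise_pair]) (use \<mu> in simp)
  thus "\<mu> = noise_pair \<rho>"
    using \<mu> by (simp add: distr_id2 noise_pair_def)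
qed

theorem correlated_gaussians_gauss_pair: "correlated_gaussians \<rho> (gauss_pair \<rho>) fst snd"
  unfolding gauss_pair_eq by (rule correlated_gaussians_noise_pair)

theorem distr_correlated_gaussians:
  assumes "correlated_gaussians \<rho> M X Y"
  shows "distr M borel (\<lambda>\<omega>. (X \<omega>, Y \<omega>)) = gauss_pair \<rho>"
  unfolding gauss_pair_eq
  using correlated_gaussians_unique[OF assms correlated_gaussians_noise_pair]
  by (simp add: distr_id2 noise_pair_def)

lemma gauss_J_component:
  "gauss_J x y \<rho> = measure (gauss_pair \<rho> :: ((real^'n) \<times> (real^'n)) measure)
     {p. ereal (fst p $ i) \<le> Phi_inv x \<and> ereal (snd p $ i) \<le> Phi_inv y}"
proof -
  let ?P = "gauss_pair \<rho> :: ((real^'n) \<times> (real^'n)) measure"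
  let ?Q = "gauss_pair \<rho> :: ((real^1) \<times> (real^1)) measure"
  let ?h = "\<lambda>p::(real^'n) \<times> (real^'n). (vec (fst p $ i) :: real^1, vec (snd p $ i) :: real^1)"
  have sP[measurable_cong, simp]: "sets ?P = sets borel" and sQ[measurable_cong, simp]: "sets ?Q = sets borel"
    by (simp_all add: gauss_pair_eq noise_pair_def)
  have pP: "prob_space ?P" and pQ: "prob_space ?Q"
    using correlated_gaussians_gauss_pair unfolding correlated_gaussians_def by auto
  have h[measurable]: "?h \<in> borel_measurable ?P"
    unfolding measurable_cong_sets[OF sP refl]
    by (intro borel_measurable_continuous_onI continuous_intros) (simp add: vec_def, intro continuous_intros)+
  have chP: "char_fun (gauss_pair \<rho>) (a, b) = exp (- (a \<bullet> a + 2 * \<rho> * (a \<bullet> b) + b \<bullet> b) / 2)" for a b :: "real^'m"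
    using char_fun_correlated_gaussians[OF correlated_gaussians_gauss_pair, of a b]
    by (simp add: distr_id2 gauss_pair_eq noise_pair_def)
  have Q: "distr ?P borel ?h = ?Q"
  proof (rule char_fun_unique)
    show "prob_space (distr ?P borel ?h)" using pP by (rule prob_space.prob_space_distr) simp
    fix t :: "(real^1) \<times> (real^1)"
    obtain a b where t: "t = (a, b)" by (cases t)
    have "char_fun (distr ?P borel ?h) t = char_fun ?P (axis i (a $ 1), axis i (b $ 1))"
      unfolding char_fun_def t
      by (subst integral_distr[OF h], measurable) (simp add: inner_axis' inner_vec_def[of a] inner_vec_def[of b] inner_prod_def)
    also have "\<dots> = char_fun ?Q t"
      unfolding chP t by (simp add: inner_axis_axis inner_vec_def[of a] inner_vec_def[of b])
    finally show "char_fun (distr ?P borel ?h) t = char_fun ?Q t" .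
  qed (use pQ in auto)
  let ?A = "{p::(real^1) \<times> (real^1). ereal (fst p $ 1) \<le> Phi_inv x \<and> ereal (snd p $ 1) \<le> Phi_inv y}"
  have cont: "continuous_on UNIV (\<lambda>p::(real^1) \<times> (real^1). ereal (fst p $ 1))"
    "continuous_on UNIV (\<lambda>p::(real^1) \<times> (real^1). ereal (snd p $ 1))"
    by (intro continuous_intros continuous_on_ereal)+
  have "closed ?A"
    by (intro closed_Collect_conj closed_Collect_le cont continuous_on_const)
  hence "?A \<in> sets borel" by simp
  hence "measure (distr ?P borel ?h) ?A = measure ?P (?h -` ?A \<inter> space ?P)"
    by (intro measure_distr h)
  thus ?thesis
    unfolding gauss_J_def Q by (simp add: sets_eq_imp_space_eq[OF sP])
qed

end

end

theory Submission
  imports Defs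
begin

text \<open>The case \<open>\<rho> < 0\<close> reduces to \<open>\<rho> > 0\<close> through \<open>J(x, y; -\<rho>) = x - J(x, 1 - y; \<rho>)\<close>. For \<open>\<rho> > 0\<close> and
  Lipschitz \<open>f\<close>, \<open>g\<close> with values in \<open>[\<epsilon>, 1 - \<epsilon>]\<close>, write \<open>(X, Y)\<close> as a sum of \<open>N\<close> independent Gaussian
  pairs and reveal them one at a time. A second order Taylor expansion of \<open>J\<close> shows that each step changes
  \<open>E J\<close> by at most \<open>o(1 / N)\<close> in the wrong direction: the increments \<open>u\<close>, \<open>v\<close> of the two martingales are
  centred, they satisfy \<open>E u v \<le> \<rho> sqrt (E u\<^sup>2 E v\<^sup>2)\<close> by Gaussian maximal correlation, and
  \<open>J\<^sub>x\<^sub>x J\<^sub>y\<^sub>y = \<rho>\<^sup>2 J\<^sub>x\<^sub>y\<^sup>2\<close> with \<open>J\<^sub>x\<^sub>x \<le> 0\<close>. General \<open>f\<close> and \<open>g\<close> follow by almost everywhere approximation.\<close>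

section \<open>The normal distribution function and its inverse\<close>

text \<open>The obstacle is uniformity. The number of steps is fixed only after the admissible
  error, so one rate must serve all conditional expectations that arise and all starting points.
  \<open>J_xx\<close> and \<open>J_yy\<close> are unbounded on the open unit square; on the compact
  square with sides \<open>{\<epsilon>..1-\<epsilon>}\<close> all second derivatives are uniformly
  continuous, which gives a Taylor remainder uniform in the base point without third derivatives.
  The Lipschitz constant controls the increments: a step of length \<open>r\<close> moves a
  martingale by at most \<open>L * r\<close> times a variable with moments of all orders, so the
  remainder has expectation \<open>o(r^2)\<close>. Gaussian averaging preserves both
  \<open>L\<close> and the strip, hence the rate does not deteriorate along the iteration. Letting
  the error tend to 0 leaves an inequality that no longer mentions \<open>L\<close> or
  \<open>\<epsilon>\<close>. General functions can therefore be reached by plain dominated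
  convergence, for which continuity of \<open>J\<close> on the closed square suffices; it comes from
  strip masses, not from the derivatives.\<close>

lemma has_real_derivative_tail_integral:
  fixes g :: "real \<Rightarrow> real"
  assumes c: "continuous_on UNIV g" and i: "integrable lborel g"
  shows "((\<lambda>a. LBINT z:{..a}. g z) has_real_derivative g x) (at x)"
proof -
  have si: "set_integrable lborel A g" if "A \<in> sets borel" for A
    unfolding set_integrable_def using i that by (intro integrable_mult_indicator) auto
  have "((\<lambda>a. integral {x-1..a} g) has_real_derivative g x) (at x within {x-1..x+1})"
    by (rule integral_has_real_derivative) (auto intro: continuous_on_subset[OF c])
  hence "((\<lambda>a. integral {x-1..a} g) has_real_derivative g x) (at x)"
    by (simp add: at_within_Icc_at)
  \<comment> \<open>The half-line below \<open>x-1\<close> contributes a constant in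
    \<open>a\<close>; what varies is an integral over a compact interval, where the fundamental
    theorem of calculus applies.\<close>
  hence "((\<lambda>a. (LBINT z:{..<x-1}. g z) + integral {x-1..a} g) has_real_derivative g x) (at x)"
    by (auto intro!: derivative_eq_intros)
  thus ?thesis
  proof (rule DERIV_cong_ev[THEN iffD1, rotated -1])
    have "eventually (\<lambda>a. a \<in> {x-1<..}) (nhds x)"
      by (intro eventually_nhds_in_open) auto
    thus "\<forall>\<^sub>F a in nhds x. (LBINT z:{..<x-1}. g z) + integral {x-1..a} g = (LBINT z:{..a}. g z)"
    proof eventually_elim
      case (elim a)
      have "{..a} = {..<x-1} \<union> {x-1..a}" using elim by auto
      moreover have "(LBINT z:{..<x-1} \<union> {x-1..a}. g z) = (LBINT z:{..<x-1}. g z) + (LBINT z:{x-1..a}. g z)"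
        by (intro set_integral_Un si) auto
      moreover have "(LBINT z:{x-1..a}. g z) = integral {x-1..a} g"
        by (intro set_borel_integral_eq_integral si) auto
      ultimately show ?case by simp
    qed
  qed auto
qed

lemma std_normal_density_pos [simp]: "0 < std_normal_density x"
  by (simp add: std_normal_density_def)

lemma continuous_on_std_normal_density [continuous_intros]:
  "continuous_on A f \<Longrightarrow> continuous_on A (\<lambda>x. std_normal_density (f x))"
  unfolding std_normal_density_def by (intro continuous_intros) auto

lemma Phi_eq_cdf: "Phi = cdf std_normal_distribution"
proof
  fix x
  have "measure std_normal_distribution {..x} = (LINT y|std_normal_distribution. indicator {..x} y)"
    by simp
  also have "\<dots> = (LBINT y:{..x}. std_normal_density y)"
    by (subst integral_density) (auto simp: set_lebesgue_integral_def mult.commute)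
  finally show "Phi x = cdf std_normal_distribution x" by (simp add: Phi_def cdf_def2)
qed

lemma DERIV_Phi: "(Phi has_real_derivative std_normal_density x) (at x)"
  unfolding Phi_def[abs_def]
  by (rule has_real_derivative_tail_integral) (auto intro!: continuous_intros)

lemma DERIV_Phi_chain [derivative_intros]:
  "(g has_real_derivative g') (at x within S) \<Longrightarrow>
   ((\<lambda>x. Phi (g x)) has_real_derivative std_normal_density (g x) * g') (at x within S)"
  using DERIV_chain2[OF DERIV_Phi] .

lemma isCont_Phi: "isCont Phi x"
  using DERIV_Phi DERIV_isCont by blast

lemma continuous_on_Phi [continuous_intros]:
  "continuous_on A f \<Longrightarrow> continuous_on A (\<lambda>x. Phi (f x))"
  using continuous_on_compose2[of UNIV Phi] isCont_Phi by (auto simp: continuous_on_eq_continuous_at)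

lemma strict_mono_Phi: "strict_mono Phi"
proof (rule strict_monoI)
  fix x y :: real assume "x < y"
  thus "Phi x < Phi y"
    by (rule DERIV_pos_imp_increasing) (use DERIV_Phi std_normal_density_pos in blast)
qed

lemma Phi_less_iff [simp]: "Phi x < Phi y \<longleftrightarrow> x < y"
  using strict_mono_Phi by (rule strict_mono_less)

lemma Phi_le_iff [simp]: "Phi x \<le> Phi y \<longleftrightarrow> x \<le> y"
  using strict_mono_Phi by (rule strict_mono_less_eq)

lemma Phi_tendsto: "(Phi \<longlongrightarrow> 1) at_top" "(Phi \<longlongrightarrow> 0) at_bot"
proof -
  interpret real_distribution std_normal_distribution by (rule real_dist_normal_dist)
  show "(Phi \<longlongrightarrow> 1) at_top" "(Phi \<longlongrightarrow> 0) at_bot"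
    unfolding Phi_eq_cdf by (rule cdf_lim_at_top_prob, rule cdf_lim_at_bot)
qed

lemma Phi_bounds: "0 < Phi x" "Phi x < 1" 
proof -
  interpret real_distribution std_normal_distribution by (rule real_dist_normal_dist)
  \<comment> \<open>A distribution function has only weak bounds; taken at neighbouring points they
    become strict at \<open>x\<close> by strict monotonicity.\<close>
  have "0 \<le> Phi (x - 1)" "Phi (x + 1) \<le> 1"
    unfolding Phi_eq_cdf by (rule cdf_nonneg, rule cdf_bounded_prob)
  moreover have "Phi (x - 1) < Phi x" "Phi x < Phi (x + 1)" by simp_all
  ultimately show "0 < Phi x" "Phi x < 1" by linarith+
qed

lemma Phi_surj:
  assumes "0 < p" "p < 1"
  shows "\<exists>x. Phi x = p"
proof -
  obtain a where a: "Phi a > p"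
    using eventually_happens[OF order_tendstoD(1)[OF Phi_tendsto(1) assms(2)]] by auto
  obtain b where b: "Phi b < p"
    using eventually_happens[OF order_tendstoD(2)[OF Phi_tendsto(2) assms(1)]] by auto
  have "Phi b < Phi a" using a b by linarith
  hence "b \<le> a" by simp
  thus ?thesis
    using IVT[of Phi b p a] a b isCont_Phi by auto
qed

abbreviation quantile :: "real \<Rightarrow> real" where "quantile \<equiv> inv Phi"

lemma Phi_quantile [simp]: "0 < p \<Longrightarrow> p < 1 \<Longrightarrow> Phi (quantile p) = p"
  using Phi_surj[of p] by (metis f_inv_into_f rangeI)

lemma quantile_Phi [simp]: "quantile (Phi x) = x"
  by (intro inv_f_f strict_mono_imp_inj_on strict_mono_Phi)

lemma isCont_quantile: 
  assumes "0 < p" "p < 1" shows "isCont quantile p"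
proof -
  have "isCont quantile (Phi (quantile p))"
    by (rule isCont_inverse_function[of 1]) (auto simp: isCont_Phi)
  thus ?thesis using assms by simp
qed

lemma DERIV_quantile:
  assumes "0 < p" "p < 1"
  shows "(quantile has_real_derivative 1 / std_normal_density (quantile p)) (at p)"
proof -
  have "(quantile has_real_derivative inverse (std_normal_density (quantile p))) (at p)"
    using assms by (intro DERIV_inverse_function[where f=Phi and a=0 and b=1] DERIV_Phi isCont_quantile)
      (auto simp: less_imp_neq[symmetric])
  thus ?thesis by (simp add: field_simps)
qed

lemma DERIV_quantile_chain [derivative_intros]:
  assumes "(g has_real_derivative g') (at x within S)" "0 < g x" "g x < 1"
  shows "((\<lambda>x. quantile (g x)) has_real_derivative g' / std_normal_density (quantile (g x))) (at x within S)"
  using DERIV_chain2[OF DERIV_quantile assms(1)] assms by simp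

lemma continuous_on_quantile [continuous_intros]:
  assumes "continuous_on A f" "\<And>x. x \<in> A \<Longrightarrow> 0 < f x" "\<And>x. x \<in> A \<Longrightarrow> f x < 1"
  shows "continuous_on A (\<lambda>x. quantile (f x))"
proof (rule continuous_on_compose2[where g=quantile and t="{0<..<1}"])
  show "continuous_on {0<..<1} quantile"
    using isCont_quantile by (auto simp: continuous_on_eq_continuous_at)
qed (use assms in auto)

lemma std_normal_density_minus [simp]: "std_normal_density (- x) = std_normal_density x"
  by (simp add: std_normal_density_def)

text \<open>The density is even, so \<open>Phi (- x) + Phi x\<close> has derivative 0; the constant
  is read off in the limit at infinity.\<close>

lemma Phi_minus: "Phi (- x) = 1 - Phi x"
proof -
  have "((\<lambda>x. Phi (- x) + Phi x) has_real_derivative 0) (at x)" for x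
    by (auto intro!: derivative_eq_intros DERIV_Phi)
  hence const: "Phi (- x) + Phi x = Phi (- y) + Phi y" for x y
    by (intro DERIV_isconst_all) auto
  have "((\<lambda>x. Phi (- x) + Phi x) \<longlongrightarrow> 0 + 1) at_top"
    by (intro tendsto_add Phi_tendsto filterlim_compose[OF Phi_tendsto(2)] filterlim_uminus_at_bot_at_top)
  moreover have "((\<lambda>x. Phi (- x) + Phi x) \<longlongrightarrow> Phi (- x) + Phi x) at_top"
    using tendsto_const[of "Phi (- x) + Phi x" at_top] by (rule Lim_transform_eventually) (use const in auto)
  ultimately have "Phi (- x) + Phi x = 0 + 1"
    by (intro tendsto_unique[of at_top "\<lambda>x. Phi (- x) + Phi x"]) auto
  thus ?thesis by simp
qed

lemma Phi_inv_inside: "0 < p \<Longrightarrow> p < 1 \<Longrightarrow> Phi_inv p = ereal (quantile p)"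
  by (simp add: Phi_inv_def)

text \<open>Inside the unit interval this is the symmetry of \<open>Phi\<close>; elsewhere both
  sides are infinite of the same sign, because \<open>Phi_inv\<close> clamps its argument.\<close>

lemma Phi_inv_one_minus: "Phi_inv (1 - p) = - Phi_inv p"
proof (cases "0 < p \<and> p < 1")
  case True
  hence "quantile (1 - p) = quantile (Phi (- quantile p))" by (simp add: Phi_minus)
  thus ?thesis using True by (simp add: Phi_inv_def)
qed (auto simp: Phi_inv_def)

lemma Phi_inv_mono: "p \<le> p' \<Longrightarrow> Phi_inv p \<le> Phi_inv p'"
proof -
  assume le: "p \<le> p'"
  have "quantile p \<le> quantile p'" if "0 < p" "p' < 1"
    using that le by (subst Phi_le_iff[symmetric]) simp
  thus ?thesis using le by (auto simp: Phi_inv_def)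
qed

lemma std_normal_below_Phi_inv:
  assumes "0 \<le> p" "p \<le> 1"
  shows "measure std_normal_distribution {x. ereal x \<le> Phi_inv p} = p"
proof -
  interpret real_distribution std_normal_distribution by (rule real_dist_normal_dist)
  consider "p = 0" | "p = 1" | "0 < p" "p < 1" using assms by linarith
  thus ?thesis
  proof cases
    case 3
    have "{x. ereal x \<le> Phi_inv p} = {..quantile p}" using 3 by (auto simp: Phi_inv_inside)
    thus ?thesis using 3 Phi_eq_cdf by (metis Phi_quantile cdf_def2)
  qed (use prob_space in \<open>auto simp: Phi_inv_def\<close>)
qed

section \<open>Correlated Gaussian pairs\<close>

context
  fixes \<rho> :: real assumes \<rho>: "-1 < \<rho>" "\<rho> < 1"
begin

lemma sets_gauss_pair: "sets (gauss_pair \<rho> :: ((real^'n) \<times> (real^'n)) measure) = sets borel"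
  by (simp add: gauss_pair_eq[OF \<rho>] noise_pair_def)

lemma prob_space_gauss_pair: "prob_space (gauss_pair \<rho> :: ((real^'n) \<times> (real^'n)) measure)"
  using correlated_gaussians_gauss_pair[OF \<rho>] unfolding correlated_gaussians_def by blast

lemma distr_fst_gauss_pair: "distr (gauss_pair \<rho>) borel fst = (std_gaussian :: (real^'n) measure)"
  and distr_snd_gauss_pair: "distr (gauss_pair \<rho>) borel snd = (std_gaussian :: (real^'n) measure)"
  using correlated_gaussians_gauss_pair[OF \<rho>] unfolding correlated_gaussians_def by blast+

lemma char_fun_gauss_pair:
  fixes a b :: "real^'n"
  shows "char_fun (gauss_pair \<rho>) (a, b) = exp (- (a \<bullet> a + 2 * \<rho> * (a \<bullet> b) + b \<bullet> b) / 2)"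
  using char_fun_correlated_gaussians[OF correlated_gaussians_gauss_pair[OF \<rho>], of a b]
  by (simp add: distr_id2 sets_gauss_pair)

text \<open>The common test for the distributional identities below: linear images of Gaussian pairs
  and vectors have explicit characteristic functions, so only a quadratic form has to be
  compared.\<close>

lemma gauss_pair_eqI:
  fixes M :: "((real^'n) \<times> (real^'n)) measure"
  assumes "prob_space M" "sets M = sets borel"
    and "\<And>a b. char_fun M (a, b) = exp (- (a \<bullet> a + 2 * \<rho> * (a \<bullet> b) + b \<bullet> b) / 2)"
  shows "M = gauss_pair \<rho>"
proof (rule char_fun_unique)
  fix t :: "(real^'n) \<times> (real^'n)"
  show "char_fun M t = char_fun (gauss_pair \<rho>) t"
    by (cases t) (simp only: assms(3) char_fun_gauss_pair)
qed (use assms prob_space_gauss_pair sets_gauss_pair in auto)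

lemma measurable_gauss_pair:
  "f \<in> borel_measurable borel \<Longrightarrow> f \<in> borel_measurable (gauss_pair \<rho> :: ((real^'n) \<times> (real^'n)) measure)"
  using measurable_cong_sets[OF sets_gauss_pair refl] by blast

lemma distr_swap_gauss_pair:
  "distr (gauss_pair \<rho>) borel prod.swap = (gauss_pair \<rho> :: ((real^'n) \<times> (real^'n)) measure)"
proof (rule gauss_pair_eqI)
  have [measurable]: "prod.swap \<in> borel_measurable (gauss_pair \<rho> :: ((real^'n) \<times> (real^'n)) measure)"
    by (intro measurable_gauss_pair borel_measurable_continuous_onI continuous_on_swap)
  show "prob_space (distr (gauss_pair \<rho>) borel prod.swap :: ((real^'n) \<times> (real^'n)) measure)"
    by (intro prob_space.prob_space_distr prob_space_gauss_pair) simp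
  fix a b :: "real^'n"
  have "char_fun (distr (gauss_pair \<rho>) borel prod.swap) (a, b) = char_fun (gauss_pair \<rho>) (b, a)"
    unfolding char_fun_def by (subst integral_distr, simp, simp, simp add: inner_prod_def add.commute)
  thus "char_fun (distr (gauss_pair \<rho>) borel prod.swap) (a, b) = exp (- (a \<bullet> a + 2 * \<rho> * (a \<bullet> b) + b \<bullet> b) / 2)"
    by (simp add: char_fun_gauss_pair inner_commute algebra_simps)
qed simp

text \<open>Characteristic functions of independent summands multiply, and scaling by
  \<open>c\<close> multiplies the exponent by the square of \<open>c\<close>. This stability is what
  allows the pair to be split into many small independent pairs.\<close>

lemma gauss_pair_convolution:
  assumes "c\<^sup>2 + d\<^sup>2 = 1"
  shows "distr (gauss_pair \<rho> \<Otimes>\<^sub>M gauss_pair \<rho>) borel (\<lambda>(p, q). c *\<^sub>R p + d *\<^sub>R q)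
    = (gauss_pair \<rho> :: ((real^'n) \<times> (real^'n)) measure)"
proof (rule gauss_pair_eqI)
  let ?G = "gauss_pair \<rho> :: ((real^'n) \<times> (real^'n)) measure"
  have [measurable_cong]: "sets ?G = sets borel" by (rule sets_gauss_pair)
  interpret G: prob_space ?G by (rule prob_space_gauss_pair)
  interpret GG: pair_prob_space ?G ?G ..
  have m[measurable]: "(\<lambda>(p, q). c *\<^sub>R p + d *\<^sub>R q) \<in> borel_measurable (?G \<Otimes>\<^sub>M ?G)"
    unfolding case_prod_beta by measurable
  show "prob_space (distr (?G \<Otimes>\<^sub>M ?G) borel (\<lambda>(p, q). c *\<^sub>R p + d *\<^sub>R q))"
    by (rule GG.prob_space_distr) simp
  fix a b :: "real^'n"
  have sc: "char_fun ?G (e *\<^sub>R (a, b)) = exp (- e\<^sup>2 * (a \<bullet> a + 2 * \<rho> * (a \<bullet> b) + b \<bullet> b) / 2)" for e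
    using char_fun_gauss_pair[of "e *\<^sub>R a" "e *\<^sub>R b"] by (simp add: power2_eq_square algebra_simps)
  have "char_fun (distr (?G \<Otimes>\<^sub>M ?G) borel (\<lambda>(p, q). c *\<^sub>R p + d *\<^sub>R q)) (a, b)
     = (CLINT r|?G \<Otimes>\<^sub>M ?G. iexp ((c *\<^sub>R (a, b)) \<bullet> fst r) * iexp ((d *\<^sub>R (a, b)) \<bullet> snd r))"
    unfolding char_fun_def
    by (subst integral_distr[OF m]) (auto intro!: Bochner_Integration.integral_cong simp: exp_add[symmetric] inner_add_right algebra_simps)
  also have "\<dots> = (CLINT p|?G. CLINT q|?G. iexp ((c *\<^sub>R (a, b)) \<bullet> p) * iexp ((d *\<^sub>R (a, b)) \<bullet> q))"
    by (subst GG.integral_fst'[symmetric])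
       (auto intro!: GG.P.integrable_const_bound[where B=1] simp: norm_mult)
  also have "\<dots> = char_fun ?G (c *\<^sub>R (a, b)) * char_fun ?G (d *\<^sub>R (a, b))"
    unfolding char_fun_def by (simp only: integral_mult_right_zero integral_mult_left_zero)
  also have "\<dots> = exp (of_real (- c\<^sup>2 * (a \<bullet> a + 2 * \<rho> * (a \<bullet> b) + b \<bullet> b) / 2 + - d\<^sup>2 * (a \<bullet> a + 2 * \<rho> * (a \<bullet> b) + b \<bullet> b) / 2))"
    unfolding sc exp_of_real of_real_mult[symmetric] exp_add[symmetric] by (simp only: exp_add)
  also have "- c\<^sup>2 * (a \<bullet> a + 2 * \<rho> * (a \<bullet> b) + b \<bullet> b) / 2 + - d\<^sup>2 * (a \<bullet> a + 2 * \<rho> * (a \<bullet> b) + b \<bullet> b) / 2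
     = - ((c\<^sup>2 + d\<^sup>2) * (a \<bullet> a + 2 * \<rho> * (a \<bullet> b) + b \<bullet> b)) / 2" by (simp add: field_simps)
  finally show "char_fun (distr (?G \<Otimes>\<^sub>M ?G) borel (\<lambda>(p, q). c *\<^sub>R p + d *\<^sub>R q)) (a, b)
     = exp (- (a \<bullet> a + 2 * \<rho> * (a \<bullet> b) + b \<bullet> b) / 2)"
    unfolding assms exp_of_real by simp
qed simp

lemma distr_vec_nth_std_gaussian:
  "distr std_gaussian borel (\<lambda>x::real^'n. x $ i) = std_normal_distribution"
proof -
  have "(\<lambda>x::real^'n. x $ i) = (\<lambda>x. axis i 1 \<bullet> x)" by (simp add: fun_eq_iff inner_axis inner_commute)
  thus ?thesis using std_gaussian_inner[of "axis i 1 :: real^'n"] by (simp add: distr_id2)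
qed

lemma distr_fst_nth_gauss_pair:
    "distr (gauss_pair \<rho>) borel (\<lambda>p. fst p $ i) = std_normal_distribution" (is ?fst)
  and distr_snd_nth_gauss_pair:
    "distr (gauss_pair \<rho>) borel (\<lambda>p. snd p $ i) = std_normal_distribution" (is ?snd)
  for i :: "'n::finite"
proof -
  have m: "fst \<in> borel_measurable (gauss_pair \<rho> :: ((real^'n) \<times> (real^'n)) measure)" 
     "snd \<in> borel_measurable (gauss_pair \<rho> :: ((real^'n) \<times> (real^'n)) measure)"
    by (intro measurable_gauss_pair borel_measurable_continuous_onI continuous_intros)+
  have n: "(\<lambda>x::real^'n. x $ i) \<in> borel_measurable borel"
    by (intro borel_measurable_continuous_onI continuous_intros)
  show ?fst
    using distr_distr[OF n m(1)] by (simp add: distr_fst_gauss_pair distr_vec_nth_std_gaussian comp_def)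
  show ?snd
    using distr_distr[OF n m(2)] by (simp add: distr_snd_gauss_pair distr_vec_nth_std_gaussian comp_def)
qed

end

text \<open>Negating the second vector keeps its law and flips the sign of every covariance.\<close>

lemma distr_reflect_gauss_pair:
  assumes \<rho>: "-1 < \<rho>" "\<rho> < 1"
  shows "distr (gauss_pair \<rho>) borel (\<lambda>p. (fst p, - snd p)) = (gauss_pair (- \<rho>) :: ((real^'n) \<times> (real^'n)) measure)"
proof (rule gauss_pair_eqI)
  have [measurable]: "(\<lambda>p. (fst p, - snd p)) \<in> borel_measurable (gauss_pair \<rho> :: ((real^'n) \<times> (real^'n)) measure)"
    by (intro measurable_gauss_pair[OF \<rho>] borel_measurable_continuous_onI continuous_intros)
  show "prob_space (distr (gauss_pair \<rho>) borel (\<lambda>p. (fst p, - snd p)) :: ((real^'n) \<times> (real^'n)) measure)"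
    by (intro prob_space.prob_space_distr prob_space_gauss_pair \<rho>) simp
  fix a b :: "real^'n"
  have "char_fun (distr (gauss_pair \<rho>) borel (\<lambda>p. (fst p, - snd p))) (a, b) = char_fun (gauss_pair \<rho>) (a, - b)"
    unfolding char_fun_def by (subst integral_distr, simp, simp, simp add: inner_prod_def)
  thus "char_fun (distr (gauss_pair \<rho>) borel (\<lambda>p. (fst p, - snd p))) (a, b) = exp (- (a \<bullet> a + 2 * - \<rho> * (a \<bullet> b) + b \<bullet> b) / 2)"
    by (simp add: char_fun_gauss_pair[OF \<rho>])
qed (use \<rho> in auto)

text \<open>For positive correlation the pair can be written as
  \<open>sqrt \<rho> *\<^sub>R w + sqrt (1 - \<rho>) *\<^sub>R z1\<close> and
  \<open>sqrt \<rho> *\<^sub>R w + sqrt (1 - \<rho>) *\<^sub>R z2\<close> with \<open>w\<close>,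
  \<open>z1\<close>, \<open>z2\<close> independent. Given the shared \<open>w\<close> the two
  vectors are independent, so the inner expectation factorises.\<close>

lemma integral_gauss_pair_common_factor:
  fixes f g :: "real^'n \<Rightarrow> real"
  assumes \<rho>: "0 < \<rho>" "\<rho> < 1" and [measurable]: "f \<in> borel_measurable borel" "g \<in> borel_measurable borel"
    and bd: "\<And>x. \<bar>f x\<bar> \<le> B" "\<And>x. \<bar>g x\<bar> \<le> B"
  shows "(\<integral>p. f (fst p) * g (snd p) \<partial>gauss_pair \<rho>) =
    (\<integral>w. (\<integral>z. f (sqrt \<rho> *\<^sub>R w + sqrt (1 - \<rho>) *\<^sub>R z) \<partial>std_gaussian) * (\<integral>z. g (sqrt \<rho> *\<^sub>R w + sqrt (1 - \<rho>) *\<^sub>R z) \<partial>std_gaussian) \<partial>std_gaussian)"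
proof -
  let ?G = "std_gaussian :: (real^'n) measure"
  define r s where "r = sqrt \<rho>" and "s = sqrt (1 - \<rho>)"
  have rs: "r\<^sup>2 = \<rho>" "s\<^sup>2 = 1 - \<rho>" using \<rho> by (simp_all add: r_def s_def)
  interpret G: prob_space ?G by (rule prob_space_std_gaussian)
  interpret GG: pair_prob_space ?G ?G ..
  interpret GGG: pair_prob_space ?G "?G \<Otimes>\<^sub>M ?G" ..
  let ?T = "\<lambda>(w, z1, z2). (r *\<^sub>R w + s *\<^sub>R z1, r *\<^sub>R w + s *\<^sub>R z2)"
  have T[measurable]: "?T \<in> ?G \<Otimes>\<^sub>M (?G \<Otimes>\<^sub>M ?G) \<rightarrow>\<^sub>M (borel :: ((real^'n) \<times> (real^'n)) measure)"
    unfolding case_prod_beta by measurable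
  have D: "distr (?G \<Otimes>\<^sub>M (?G \<Otimes>\<^sub>M ?G)) borel ?T = gauss_pair \<rho>"
  proof (rule gauss_pair_eqI)
    show "prob_space (distr (?G \<Otimes>\<^sub>M (?G \<Otimes>\<^sub>M ?G)) borel ?T)"
      by (rule GGG.prob_space_distr) simp
    fix a b :: "real^'n"
    let ?c = "\<lambda>t x. iexp (t \<bullet> x)"
    have "char_fun (distr (?G \<Otimes>\<^sub>M (?G \<Otimes>\<^sub>M ?G)) borel ?T) (a, b) =
      (CLINT q|?G \<Otimes>\<^sub>M (?G \<Otimes>\<^sub>M ?G). ?c (r *\<^sub>R (a + b)) (fst q) * (?c (s *\<^sub>R a) (fst (snd q)) * ?c (s *\<^sub>R b) (snd (snd q))))"
      unfolding char_fun_def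
      by (subst integral_distr[OF T]) (auto intro!: Bochner_Integration.integral_cong simp: exp_add[symmetric] inner_add_left inner_add_right algebra_simps)
    also have "\<dots> = (CLINT w|?G. CLINT q|?G \<Otimes>\<^sub>M ?G. ?c (r *\<^sub>R (a + b)) w * (?c (s *\<^sub>R a) (fst q) * ?c (s *\<^sub>R b) (snd q)))"
      by (subst GGG.integral_fst'[symmetric])
       (auto intro!: GGG.P.integrable_const_bound[where B=1] simp: norm_mult)
    also have "\<dots> = char_fun ?G (r *\<^sub>R (a + b)) * (CLINT q|?G \<Otimes>\<^sub>M ?G. ?c (s *\<^sub>R a) (fst q) * ?c (s *\<^sub>R b) (snd q))"
      unfolding char_fun_def by (simp only: integral_mult_right_zero integral_mult_left_zero)
    also have "(CLINT q|?G \<Otimes>\<^sub>M ?G. ?c (s *\<^sub>R a) (fst q) * ?c (s *\<^sub>R b) (snd q)) = 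
       (CLINT z1|?G. CLINT z2|?G. ?c (s *\<^sub>R a) z1 * ?c (s *\<^sub>R b) z2)"
      by (subst GG.integral_fst'[symmetric])
       (auto intro!: GG.P.integrable_const_bound[where B=1] simp: norm_mult)
    also have "\<dots> = char_fun ?G (s *\<^sub>R a) * char_fun ?G (s *\<^sub>R b)"
      unfolding char_fun_def by (simp only: integral_mult_right_zero integral_mult_left_zero)
    also have "char_fun ?G (r *\<^sub>R (a + b)) * (char_fun ?G (s *\<^sub>R a) * char_fun ?G (s *\<^sub>R b)) = 
       exp (of_real (- (r *\<^sub>R (a + b)) \<bullet> (r *\<^sub>R (a + b)) / 2 + (- (s *\<^sub>R a) \<bullet> (s *\<^sub>R a) / 2 + - (s *\<^sub>R b) \<bullet> (s *\<^sub>R b) / 2)))"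
      unfolding char_fun_std_gaussian exp_of_real of_real_mult[symmetric] exp_add[symmetric] by (simp add: exp_add)
    also have "- (r *\<^sub>R (a + b)) \<bullet> (r *\<^sub>R (a + b)) / 2 + (- (s *\<^sub>R a) \<bullet> (s *\<^sub>R a) / 2 + - (s *\<^sub>R b) \<bullet> (s *\<^sub>R b) / 2) 
       = - ((r\<^sup>2 + s\<^sup>2) * (a \<bullet> a) + 2 * r\<^sup>2 * (a \<bullet> b) + (r\<^sup>2 + s\<^sup>2) * (b \<bullet> b)) / 2"
      by (simp add: inner_add_left inner_diff_left inner_add_right inner_commute[of b a] power2_eq_square field_simps)
    finally show "char_fun (distr (?G \<Otimes>\<^sub>M (?G \<Otimes>\<^sub>M ?G)) borel ?T) (a, b) = exp (- (a \<bullet> a + 2 * \<rho> * (a \<bullet> b) + b \<bullet> b) / 2)"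
      unfolding rs exp_of_real by simp
  qed (use \<rho> in auto)
  have B: "0 \<le> B" using bd(1)[of 0] by linarith
  have bd2: "\<bar>f x * g y\<bar> \<le> B * B" for x y
    unfolding abs_mult by (intro mult_mono bd) (use B in auto)
  have mf: "(\<lambda>p::(real^'n) \<times> (real^'n). f (fst p) * g (snd p)) \<in> borel_measurable borel"
    unfolding borel_prod[symmetric] by measurable
  have "(\<integral>p. f (fst p) * g (snd p) \<partial>gauss_pair \<rho>) =
    (\<integral>q. f (r *\<^sub>R fst q + s *\<^sub>R fst (snd q)) * g (r *\<^sub>R fst q + s *\<^sub>R snd (snd q)) \<partial>(?G \<Otimes>\<^sub>M (?G \<Otimes>\<^sub>M ?G)))"
    unfolding D[symmetric] by (subst integral_distr[OF T mf]) (simp add: case_prod_beta)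
  also have "\<dots> = (\<integral>w. \<integral>q. f (r *\<^sub>R w + s *\<^sub>R fst q) * g (r *\<^sub>R w + s *\<^sub>R snd q) \<partial>(?G \<Otimes>\<^sub>M ?G) \<partial>?G)"
    by (subst GGG.integral_fst'[symmetric])
       (auto intro!: GGG.P.integrable_const_bound[where B="B * B"] bd2)
  also have "\<dots> = (\<integral>w. (\<integral>z1. \<integral>z2. f (r *\<^sub>R w + s *\<^sub>R z1) * g (r *\<^sub>R w + s *\<^sub>R z2) \<partial>?G \<partial>?G) \<partial>?G)"
    by (intro Bochner_Integration.integral_cong refl, subst GG.integral_fst'[symmetric])
       (auto intro!: GG.P.integrable_const_bound[where B="B * B"] bd2)
  finally show ?thesis
    by (simp add: r_def s_def)
qed

section \<open>Regularity of J on the closed unit square and its one-dimensional integral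
  formula\<close>

context
  fixes \<rho> :: real assumes \<rho>: "-1 < \<rho>" "\<rho> < 1"
begin

lemma sets_ereal_Phi_inv [measurable]:
  "{p :: (real^'n) \<times> (real^'n). ereal (fst p $ i) \<le> Phi_inv x} \<in> sets borel"
  "{p :: (real^'n) \<times> (real^'n). ereal (snd p $ i) \<le> Phi_inv x} \<in> sets borel"
  by (intro borel_closed closed_Collect_le continuous_intros continuous_on_ereal)+

lemma gauss_pair_below_Phi_inv:
  assumes "0 \<le> x" "x \<le> 1"
  shows "measure (gauss_pair \<rho>) {p :: (real^'n) \<times> (real^'n). ereal (fst p $ i) \<le> Phi_inv x} = x"
    and "measure (gauss_pair \<rho>) {p :: (real^'n) \<times> (real^'n). ereal (snd p $ i) \<le> Phi_inv x} = x"
proof -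
  let ?G = "gauss_pair \<rho> :: ((real^'n) \<times> (real^'n)) measure"
  have [simp]: "space ?G = UNIV" using sets_eq_imp_space_eq[OF sets_gauss_pair[OF \<rho>]] by simp
  have m: "(\<lambda>p. fst p $ i) \<in> borel_measurable ?G" "(\<lambda>p. snd p $ i) \<in> borel_measurable ?G"
    by (intro measurable_gauss_pair[OF \<rho>] borel_measurable_continuous_onI continuous_intros)+
  have s: "{z. ereal z \<le> Phi_inv x} \<in> sets borel"
    by (intro borel_closed closed_Collect_le continuous_intros continuous_on_ereal)
  show "measure ?G {p. ereal (fst p $ i) \<le> Phi_inv x} = x"
    using measure_distr[OF m(1) s] by (simp add: distr_fst_nth_gauss_pair[OF \<rho>] std_normal_below_Phi_inv[OF assms] vimage_def)
  show "measure ?G {p. ereal (snd p $ i) \<le> Phi_inv x} = x"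
    using measure_distr[OF m(2) s] by (simp add: distr_snd_nth_gauss_pair[OF \<rho>] std_normal_below_Phi_inv[OF assms] vimage_def)
qed

lemma gauss_J_commute: "gauss_J x y \<rho> = gauss_J y x \<rho>"
proof -
  let ?G = "gauss_pair \<rho> :: ((real^1) \<times> (real^1)) measure"
  let ?S = "\<lambda>x y. {p :: (real^1) \<times> (real^1). ereal (fst p $ 1) \<le> Phi_inv x \<and> ereal (snd p $ 1) \<le> Phi_inv y}"
  have [simp]: "space ?G = UNIV" using sets_eq_imp_space_eq[OF sets_gauss_pair[OF \<rho>]] by simp
  have m: "prod.swap \<in> borel_measurable ?G"
    by (intro measurable_gauss_pair[OF \<rho>] borel_measurable_continuous_onI continuous_on_swap)
  have s: "?S x y \<in> sets borel"
    by (simp add: Collect_conj_eq)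
  have "gauss_J x y \<rho> = measure (distr ?G borel prod.swap) (?S x y)"
    unfolding gauss_J_def distr_swap_gauss_pair[OF \<rho>] ..
  also have "\<dots> = gauss_J y x \<rho>"
    unfolding gauss_J_def by (subst measure_distr[OF m s]) (simp add: vimage_def conj_commute)
  finally show ?thesis .
qed

text \<open>Raising \<open>x\<close> to \<open>x'\<close> adds to the quadrant at most a vertical
  strip, whose mass under the first marginal is \<open>x' - x\<close>. This works up to the
  boundary, where the derivative formulas are not at hand.\<close>

lemma gauss_J_diff_fst:
  assumes "x \<in> {0..1}" "x' \<in> {0..1}"
  shows "\<bar>gauss_J x y \<rho> - gauss_J x' y \<rho>\<bar> \<le> \<bar>x - x'\<bar>"
proof -
  let ?G = "gauss_pair \<rho> :: ((real^1) \<times> (real^1)) measure"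
  interpret G: prob_space ?G by (rule prob_space_gauss_pair[OF \<rho>])
  let ?X = "\<lambda>x. {p :: (real^1) \<times> (real^1). ereal (fst p $ 1) \<le> Phi_inv x}"
  let ?Y = "{p :: (real^1) \<times> (real^1). ereal (snd p $ 1) \<le> Phi_inv y}"
  have s[simp]: "?X x \<in> sets ?G" "?Y \<in> sets ?G" for x by (simp_all add: sets_gauss_pair[OF \<rho>])
  have J: "gauss_J x y \<rho> = measure ?G (?X x \<inter> ?Y)" for x
    unfolding gauss_J_def by (simp add: Collect_conj_eq)
  have main: "gauss_J x y \<rho> \<le> gauss_J x' y \<rho> \<and> gauss_J x' y \<rho> - gauss_J x y \<rho> \<le> x' - x"
    if le: "x \<le> x'" and 01: "x \<in> {0..1}" "x' \<in> {0..1}" for x x'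
  proof
    have sub: "?X x \<subseteq> ?X x'" using Phi_inv_mono[OF le] order_trans by blast
    show "gauss_J x y \<rho> \<le> gauss_J x' y \<rho>"
      unfolding J by (intro G.finite_measure_mono) (use sub in auto)
    have "measure ?G (?X x' \<inter> ?Y) \<le> measure ?G ((?X x \<inter> ?Y) \<union> (?X x' - ?X x))"
      using s by (intro G.finite_measure_mono sets.Un sets.Int sets.Diff) auto
    also have "\<dots> \<le> measure ?G (?X x \<inter> ?Y) + measure ?G (?X x' - ?X x)"
      using s by (intro measure_Un_le sets.Un sets.Int sets.Diff)
    also have "measure ?G (?X x' - ?X x) = x' - x"
      using G.finite_measure_Diff[OF s(1) s(1) sub] 01 gauss_pair_below_Phi_inv(1)[where 'n=1] by simp
    finally show "gauss_J x' y \<rho> - gauss_J x y \<rho> \<le> x' - x" unfolding J by simp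
  qed
  show ?thesis
    using main[of x x'] main[of x' x] assms by linarith
qed

lemma gauss_J_diff:
  assumes "x \<in> {0..1}" "x' \<in> {0..1}" "y \<in> {0..1}" "y' \<in> {0..1}"
  shows "\<bar>gauss_J x y \<rho> - gauss_J x' y' \<rho>\<bar> \<le> \<bar>x - x'\<bar> + \<bar>y - y'\<bar>"
  using gauss_J_diff_fst[OF assms(1,2), of y] gauss_J_diff_fst[OF assms(3,4), of x'] 
  unfolding gauss_J_commute[of x' y] gauss_J_commute[of x' y'] by linarith

lemma gauss_J_bounds: "0 \<le> gauss_J x y \<rho>" "gauss_J x y \<rho> \<le> 1"
proof -
  interpret G: prob_space "gauss_pair \<rho> :: ((real^1) \<times> (real^1)) measure" by (rule prob_space_gauss_pair[OF \<rho>])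
  show "0 \<le> gauss_J x y \<rho>" "gauss_J x y \<rho> \<le> 1" unfolding gauss_J_def by auto
qed

lemma continuous_on_gauss_J: "continuous_on ({0..1} \<times> {0..1}) (\<lambda>(x, y). gauss_J x y \<rho>)"
  unfolding continuous_on_iff
proof safe
  fix x y e :: real assume xy: "x \<in> {0..1}" "y \<in> {0..1}" and e: "0 < e"
  note J = gauss_J_diff[OF _ xy(1) _ xy(2)]
  show "\<exists>d>0. \<forall>p\<in>{0..1} \<times> {0..1}. dist p (x, y) < d \<longrightarrow> 
     dist (case p of (x, y) \<Rightarrow> gauss_J x y \<rho>) (gauss_J x y \<rho>) < e"
  proof (intro exI[of _ "e / 2"] conjI ballI impI)
    fix p :: "real \<times> real" assume p: "p \<in> {0..1} \<times> {0..1}" and d: "dist p (x, y) < e / 2"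
    have "dist (fst p) x < e / 2" "dist (snd p) y < e / 2"
      using dist_fst_le[of p "(x, y)"] dist_snd_le[of p "(x, y)"] d by simp_all
    moreover have "\<bar>gauss_J (fst p) (snd p) \<rho> - gauss_J x y \<rho>\<bar> \<le> \<bar>fst p - x\<bar> + \<bar>snd p - y\<bar>"
      using p by (intro J) (simp_all add: mem_Times_iff)
    ultimately show "dist (case p of (x, y) \<Rightarrow> gauss_J x y \<rho>) (gauss_J x y \<rho>) < e"
      by (simp add: case_prod_beta dist_real_def)
  qed (use e in auto)
qed

lemma measurable_gauss_J:
  assumes f[measurable]: "f \<in> borel_measurable M" and g[measurable]: "g \<in> borel_measurable M"
    and "\<And>x. f x \<in> {0..1}" "\<And>x. g x \<in> {0..1}"
  shows "(\<lambda>x. gauss_J (f x) (g x) \<rho>) \<in> borel_measurable M"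
proof -
  \<comment> \<open>Continuity is established only on the closed unit square, so \<open>J\<close> is
    cut off outside it; \<open>f\<close> and \<open>g\<close> take values inside.\<close>
  let ?J = "\<lambda>p. indicator ({0..1} \<times> {0..1}) p *\<^sub>R (case p of (x, y) \<Rightarrow> gauss_J x y \<rho>)"
  have J: "?J \<in> borel_measurable borel"
    by (intro borel_measurable_continuous_on_indicator continuous_on_gauss_J borel_closed closed_Times closed_atLeastAtMost)
  have p: "(\<lambda>x. (f x, g x)) \<in> borel_measurable M"
    by (rule borel_measurable_Pair[OF f g])
  have "(\<lambda>x. ?J (f x, g x)) = (\<lambda>x. gauss_J (f x) (g x) \<rho>)"
    by (rule ext) (use assms(3,4) in simp)
  thus ?thesis using measurable_compose[OF p J] by (simp only:)
qed

text \<open>Given that the first coordinate is \<open>z\<close>, the second is normal with mean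
  \<open>\<rho> * z\<close> and variance \<open>1 - \<rho>\<^sup>2\<close>. In this form
  \<open>a\<close> occurs only as a limit of integration, which makes differentiation
  immediate.\<close>

lemma gauss_pair_quadrant:
  "measure (gauss_pair \<rho> :: ((real^1) \<times> (real^1)) measure) {p. fst p $ 1 \<le> a \<and> snd p $ 1 \<le> b}
   = (LBINT z:{..a}. std_normal_density z * Phi ((b - \<rho> * z) / sqrt (1 - \<rho>\<^sup>2)))"
proof -
  let ?G = "std_gaussian :: (real^1) measure"
  let ?s = "sqrt (1 - \<rho>\<^sup>2)"
  let ?T = "\<lambda>(x, z). (x, \<rho> *\<^sub>R x + ?s *\<^sub>R z) :: (real^1) \<times> (real^1)"
  let ?S = "{p :: (real^1) \<times> (real^1). fst p $ 1 \<le> a \<and> snd p $ 1 \<le> b}"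
  interpret G: prob_space ?G by (rule prob_space_std_gaussian)
  interpret GG: pair_prob_space ?G ?G ..
  have "\<rho>\<^sup>2 < 1" using \<rho> by (simp add: abs_square_less_1)
  hence s: "0 < ?s" by simp
  have T[measurable]: "?T \<in> borel_measurable (?G \<Otimes>\<^sub>M ?G)" unfolding case_prod_beta by measurable
  have nth[measurable]: "(\<lambda>x::real^1. x $ 1) \<in> borel_measurable borel"
    by (intro borel_measurable_continuous_onI continuous_intros)
  have S: "?S \<in> sets borel"
    by (intro borel_closed closed_Collect_conj closed_Collect_le continuous_intros)
  have [measurable]: "Phi \<in> borel_measurable borel"
    by (intro borel_measurable_continuous_onI continuous_intros)
  have bd: "\<bar>(indicator {..a} (x $ 1) * indicator {..b} (\<rho> * x $ 1 + ?s * z $ 1))\<bar> \<le> (1::real)" for x z :: "real^1"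
    by (simp add: indicator_def)
  have "measure (gauss_pair \<rho>) ?S = measure (distr (?G \<Otimes>\<^sub>M ?G) borel ?T) ?S"
    unfolding gauss_pair_eq[OF \<rho>] noise_pair_def ..
  also have "\<dots> = (LINT p|(?G \<Otimes>\<^sub>M ?G). indicator ?S (?T p))"
    using integral_distr[OF T, of "indicator ?S :: _ \<Rightarrow> real"] S by simp
  also have "\<dots> = (LINT p|(?G \<Otimes>\<^sub>M ?G). indicator {..a} (fst p $ 1) * indicator {..b} (\<rho> * fst p $ 1 + ?s * snd p $ 1))"
    by (intro Bochner_Integration.integral_cong) (auto simp: indicator_def)
  also have "\<dots> = (LINT x|?G. LINT z|?G. indicator {..a} (x $ 1) * indicator {..b} (\<rho> * x $ 1 + ?s * z $ 1))"
    by (subst GG.integral_fst'[symmetric]) (auto intro!: GG.P.integrable_const_bound[where B=1] AE_I2 simp: indicator_def)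
  also have "\<dots> = (LINT x|?G. indicator {..a} (x $ 1) * Phi ((b - \<rho> * x $ 1) / ?s))"
  proof (intro Bochner_Integration.integral_cong refl)
    fix x :: "real^1"
    have "(LINT z|?G. indicator {..b} (\<rho> * x $ 1 + ?s * z $ 1)) = (LINT z|?G. indicator {..(b - \<rho> * x $ 1) / ?s} (z $ 1) :: real)"
      using s by (intro Bochner_Integration.integral_cong) (auto simp: indicator_def field_simps)
    also have "\<dots> = (LINT t|distr ?G borel (\<lambda>z. z $ 1). indicator {..(b - \<rho> * x $ 1) / ?s} t)"
      by (subst integral_distr) auto
    also have "\<dots> = Phi ((b - \<rho> * x $ 1) / ?s)"
      unfolding distr_vec_nth_std_gaussian[OF \<rho>] by (simp add: Phi_eq_cdf cdf_def2)
    finally show "(LINT z|?G. indicator {..a} (x $ 1) * indicator {..b} (\<rho> * x $ 1 + ?s * z $ 1)) = 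
       indicator {..a} (x $ 1) * Phi ((b - \<rho> * x $ 1) / ?s)" by simp
  qed
  also have "\<dots> = (LINT t|distr ?G borel (\<lambda>z. z $ 1). indicator {..a} t * Phi ((b - \<rho> * t) / ?s))"
    by (subst integral_distr) auto
  also have "\<dots> = (LBINT z:{..a}. std_normal_density z * Phi ((b - \<rho> * z) / ?s))"
    unfolding distr_vec_nth_std_gaussian[OF \<rho>] by (subst integral_density) (auto simp: set_lebesgue_integral_def mult_ac)
  finally show ?thesis .
qed

end

text \<open>After reflecting the second coordinate, the event that it lies below the quantile of
  \<open>y\<close> becomes the complement of lying strictly below the quantile of
  \<open>1 - y\<close>. Subtracting within the half-plane of mass \<open>x\<close> gives the
  formula.\<close>

lemma gauss_J_uminus:
  assumes \<rho>: "-1 < \<rho>" "\<rho> < 1" and x: "0 \<le> x" "x \<le> 1"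
  shows "gauss_J x y (- \<rho>) = x - gauss_J x (1 - y) \<rho>"
proof -
  let ?G = "gauss_pair \<rho> :: ((real^1) \<times> (real^1)) measure"
  interpret G: prob_space ?G by (rule prob_space_gauss_pair[OF \<rho>])
  have [simp]: "space ?G = UNIV" using sets_eq_imp_space_eq[OF sets_gauss_pair[OF \<rho>]] by simp
  note [simp] = sets_gauss_pair[OF \<rho>]
  let ?c = "Phi_inv (1 - y)"
  let ?X = "{p :: (real^1) \<times> (real^1). ereal (fst p $ 1) \<le> Phi_inv x}"
  let ?Y = "{p :: (real^1) \<times> (real^1). ereal (snd p $ 1) \<le> ?c}"
  let ?Y' = "{p :: (real^1) \<times> (real^1). ereal (snd p $ 1) < ?c}"
  have m: "(\<lambda>p. (fst p, - snd p)) \<in> borel_measurable ?G" "(\<lambda>p. snd p $ 1) \<in> borel_measurable ?G"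
    by (intro measurable_gauss_pair[OF \<rho>] borel_measurable_continuous_onI continuous_intros)+
  have s: "?X \<in> sets borel" "?Y \<in> sets borel" 
    by (rule sets_ereal_Phi_inv[OF \<rho>])+
  have s': "?Y' \<in> sets borel"
    by (intro borel_open open_Collect_less continuous_intros continuous_on_ereal)
  have ev: "ereal (- t) \<le> Phi_inv y \<longleftrightarrow> \<not> ereal t < ?c" for t
    unfolding Phi_inv_one_minus by (cases "Phi_inv y") auto
  have "gauss_J x y (- \<rho>) = measure (distr ?G borel (\<lambda>p. (fst p, - snd p))) {p. ereal (fst p $ 1) \<le> Phi_inv x \<and> ereal (snd p $ 1) \<le> Phi_inv y}"
    unfolding gauss_J_def distr_reflect_gauss_pair[OF \<rho>] ..
  also have "\<dots> = measure ?G (?X - (?X \<inter> ?Y'))"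
    by (subst measure_distr[OF m(1)])
       (use \<rho> sets_ereal_Phi_inv[of "- \<rho>"] in \<open>auto simp: Collect_conj_eq vimage_def ev intro!: arg_cong[where f="measure ?G"]\<close>)
  also have "\<dots> = measure ?G ?X - measure ?G (?X \<inter> ?Y')"
    using s s' by (intro G.finite_measure_Diff) auto
  also have "measure ?G ?X = x" by (rule gauss_pair_below_Phi_inv[OF \<rho> x])
  \<comment> \<open>The events differ only where the second coordinate equals \<open>?c\<close>: a
    null set if \<open>?c\<close> is finite, and empty if it is infinite.\<close>
  also have "measure ?G (?X \<inter> ?Y') = measure ?G (?X \<inter> ?Y)"
  proof (rule measure_eq_AE)
    have "AE t in std_normal_distribution. ereal t \<noteq> ?c"
      by (subst AE_density, simp, cases ?c) (use AE_lborel_singleton in auto)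
    hence "AE p in ?G. ereal (snd p $ 1) \<noteq> ?c"
      unfolding distr_snd_nth_gauss_pair[OF \<rho>, symmetric, where i="1::1"] by (rule AE_distrD[OF m(2)])
    thus "AE p in ?G. p \<in> ?X \<inter> ?Y' \<longleftrightarrow> p \<in> ?X \<inter> ?Y"
      by eventually_elim auto
  qed (use s s' in auto)
  also have "measure ?G (?X \<inter> ?Y) = gauss_J x (1 - y) \<rho>"
    unfolding gauss_J_def by (simp add: Collect_conj_eq)
  finally show ?thesis .
qed

section \<open>The derivatives of J\<close>

text \<open>\<open>gauss_J1\<close>, \<open>gauss_J11\<close> and \<open>gauss_J12\<close> are \<open>J\<^sub>x\<close>, \<open>J\<^sub>x\<^sub>x\<close> and \<open>J\<^sub>x\<^sub>y\<close>; since \<open>J\<close> is symmetric, \<open>J\<^sub>y\<close> and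
  \<open>J\<^sub>y\<^sub>y\<close> are obtained by exchanging the arguments.\<close>

definition gauss_J1 :: "real \<Rightarrow> real \<Rightarrow> real \<Rightarrow> real" where
  "gauss_J1 \<rho> x y = Phi ((quantile y - \<rho> * quantile x) / sqrt (1 - \<rho>\<^sup>2))"

definition gauss_J11 :: "real \<Rightarrow> real \<Rightarrow> real \<Rightarrow> real" where
  "gauss_J11 \<rho> x y = - (\<rho> / sqrt (1 - \<rho>\<^sup>2)) * 
     std_normal_density ((quantile y - \<rho> * quantile x) / sqrt (1 - \<rho>\<^sup>2)) / std_normal_density (quantile x)"

definition gauss_J12 :: "real \<Rightarrow> real \<Rightarrow> real \<Rightarrow> real" where
  "gauss_J12 \<rho> x y = std_normal_density ((quantile y - \<rho> * quantile x) / sqrt (1 - \<rho>\<^sup>2)) / 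
     (sqrt (1 - \<rho>\<^sup>2) * std_normal_density (quantile y))"

text \<open>Within the radius \<open>d\<close> of uniform continuity \<open>\<eta>\<close> alone
  suffices; beyond it \<open>dist p q \<ge> d\<close>, so the slope
  \<open>2 * \<bar>B\<bar> / d\<close> absorbs the trivial bound. The affine shape is chosen
  because, multiplied by squared increments, it only asks for second and third moments.\<close>

lemma modulus_of_continuity_affine:
  fixes H :: "'a::metric_space \<Rightarrow> real"
  assumes "compact S" "continuous_on S H" "0 < \<eta>"
  shows "\<exists>K\<ge>0. \<forall>p\<in>S. \<forall>q\<in>S. \<bar>H p - H q\<bar> \<le> \<eta> + K * dist p q"
proof -
  obtain d where d: "0 < d" "\<And>p q. p \<in> S \<Longrightarrow> q \<in> S \<Longrightarrow> dist p q < d \<Longrightarrow> dist (H p) (H q) < \<eta>"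
    using compact_uniformly_continuous[OF assms(2,1)] assms(3) unfolding uniformly_continuous_on_def by metis
  have "bounded (H ` S)" using compact_continuous_image[OF assms(2,1)] compact_imp_bounded by blast
  then obtain B where B: "\<And>p. p \<in> S \<Longrightarrow> \<bar>H p\<bar> \<le> B" unfolding bounded_iff by auto
  show ?thesis
  proof (intro exI[of _ "2 * \<bar>B\<bar> / d"] conjI ballI)
    fix p q assume pq: "p \<in> S" "q \<in> S"
    show "\<bar>H p - H q\<bar> \<le> \<eta> + 2 * \<bar>B\<bar> / d * dist p q"
    proof (cases "dist p q < d")
      case True
      have "0 \<le> 2 * \<bar>B\<bar> / d * dist p q" using d by simp
      thus ?thesis using d(2)[OF pq True] by (simp add: dist_real_def)
    next
      case False
      hence "2 * \<bar>B\<bar> / d * d \<le> 2 * \<bar>B\<bar> / d * dist p q" using d by (intro mult_left_mono) auto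
      thus ?thesis using B[OF pq(1)] B[OF pq(2)] d assms(3) by simp
    qed
  qed (use d in simp)
qed

context
  fixes \<rho> :: real assumes \<rho>: "-1 < \<rho>" "\<rho> < 1"
begin

lemma sqrt_one_minus_square_pos: "0 < sqrt (1 - \<rho>\<^sup>2)"
  using \<rho> by (simp add: abs_square_less_1)

text \<open>Both sides are the joint density of the pair, up to the factor \<open>1 / sqrt (1 - \<rho>\<^sup>2)\<close>.\<close>

lemma std_normal_density_exchange:
  "std_normal_density ((b - \<rho> * a) / sqrt (1 - \<rho>\<^sup>2)) * std_normal_density a
   = std_normal_density ((a - \<rho> * b) / sqrt (1 - \<rho>\<^sup>2)) * std_normal_density b"
proof -
  have s: "(sqrt (1 - \<rho>\<^sup>2))\<^sup>2 = 1 - \<rho>\<^sup>2" "0 < 1 - \<rho>\<^sup>2" using \<rho> by (simp_all add: abs_square_less_1 abs_square_le_1)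
  have "((b - \<rho> * a) / sqrt (1 - \<rho>\<^sup>2))\<^sup>2 + a\<^sup>2 = ((a - \<rho> * b) / sqrt (1 - \<rho>\<^sup>2))\<^sup>2 + b\<^sup>2"
    using s(2) unfolding power_divide s(1) by (simp add: field_simps) (simp add: power2_eq_square algebra_simps)
  hence "- ((b - \<rho> * a) / sqrt (1 - \<rho>\<^sup>2))\<^sup>2 / 2 + - a\<^sup>2 / 2 = - ((a - \<rho> * b) / sqrt (1 - \<rho>\<^sup>2))\<^sup>2 / 2 + - b\<^sup>2 / 2"
    by linarith
  thus ?thesis
    unfolding std_normal_density_def by (simp add: exp_add[symmetric])
qed

lemma gauss_J12_commute: "gauss_J12 \<rho> x y = gauss_J12 \<rho> y x"
proof -
  have "w / (s * q) = v / (s * p)" if "w * p = v * q" "0 < s" "0 < p" "0 < q" for w v s p q :: real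
    using that by (simp add: frac_eq_eq)
  from this[OF std_normal_density_exchange[of "quantile y" "quantile x"] sqrt_one_minus_square_pos]
  show ?thesis unfolding gauss_J12_def by simp
qed

text \<open>\<open>A\<close>, \<open>B\<close> and \<open>c\<close> stand for the second moments and
  the mixed moment of the two increments. The mixed derivative is positive, so \<open>c\<close> may
  be raised to its largest value; there the form is minus a positive multiple of the square of
  \<open>a / p - b / q\<close>.\<close>

lemma gauss_J_quadratic_form_nonpos:
  assumes "0 < \<rho>" "0 \<le> A" "0 \<le> B" "c \<le> \<rho> * (sqrt A * sqrt B)"
  shows "gauss_J11 \<rho> x y * A + 2 * gauss_J12 \<rho> x y * c + gauss_J11 \<rho> y x * B \<le> 0"
proof -
  define s p q a b where "s = sqrt (1 - \<rho>\<^sup>2)" and "p = std_normal_density (quantile x)" and "q = std_normal_density (quantile y)"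
    and "a = sqrt A" and "b = sqrt B"
  define w where "w = std_normal_density ((quantile y - \<rho> * quantile x) / s)"
  define v where "v = std_normal_density ((quantile x - \<rho> * quantile y) / s)"
  have pos: "0 < s" "0 < p" "0 < q" "0 < w" "0 \<le> a" "0 \<le> b"
    using sqrt_one_minus_square_pos assms by (simp_all add: s_def p_def q_def w_def a_def b_def)
  have AB: "A = a * a" "B = b * b" using assms by (simp_all add: a_def b_def)
  have "w * p = v * q"
    using std_normal_density_exchange[of "quantile y" "quantile x"] by (simp add: w_def v_def p_def q_def s_def)
  hence v: "v = w * p / q" using pos by (simp add: field_simps)
  have "gauss_J12 \<rho> x y * c \<le> gauss_J12 \<rho> x y * (\<rho> * (a * b))"
    using assms(4) pos by (intro mult_left_mono) (simp_all add: a_def b_def gauss_J12_def w_def s_def less_imp_le)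
  hence "gauss_J11 \<rho> x y * A + 2 * gauss_J12 \<rho> x y * c + gauss_J11 \<rho> y x * B
    \<le> - (\<rho> / s) * w / p * (a * a) + 2 * (w / (s * q)) * (\<rho> * (a * b)) + - (\<rho> / s) * v / q * (b * b)"
    by (simp add: gauss_J11_def gauss_J12_def AB s_def p_def q_def w_def v_def)
  also have "\<dots> = - (\<rho> * w * p / s) * (a / p - b / q)\<^sup>2"
    using pos unfolding v by (simp add: field_simps power2_eq_square)
  also have "\<dots> \<le> 0" using pos assms(1) by (simp add: mult_nonneg_nonneg)
  finally show ?thesis .
qed

text \<open>In quantile coordinates \<open>J\<close> is the probability of a finite quadrant, so the
  derivative is the integrand of its integral formula at the upper limit.\<close>

lemma DERIV_gauss_J_Phi_fst:
  "((\<lambda>a. gauss_J (Phi a) (Phi b) \<rho>) has_real_derivative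
     std_normal_density a * Phi ((b - \<rho> * a) / sqrt (1 - \<rho>\<^sup>2))) (at a)"
proof -
  have eq: "gauss_J (Phi a) (Phi b) \<rho> = (LBINT z:{..a}. std_normal_density z * Phi ((b - \<rho> * z) / sqrt (1 - \<rho>\<^sup>2)))" for a
    using gauss_pair_quadrant[OF \<rho>, of a b] by (simp add: gauss_J_def Phi_inv_inside Phi_bounds)
  have cont: "continuous_on UNIV (\<lambda>z. std_normal_density z * Phi ((b - \<rho> * z) / sqrt (1 - \<rho>\<^sup>2)))"
    using sqrt_one_minus_square_pos by (intro continuous_intros) auto
  have int: "integrable lborel (\<lambda>z. std_normal_density z * Phi ((b - \<rho> * z) / sqrt (1 - \<rho>\<^sup>2)))"
  proof (rule Bochner_Integration.integrable_bound[of _ std_normal_density])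
    show "(\<lambda>z. std_normal_density z * Phi ((b - \<rho> * z) / sqrt (1 - \<rho>\<^sup>2))) \<in> borel_measurable lborel"
      using borel_measurable_continuous_onI[OF cont] by simp
    show "AE z in lborel. norm (std_normal_density z * Phi ((b - \<rho> * z) / sqrt (1 - \<rho>\<^sup>2))) \<le> norm (std_normal_density z)"
      using Phi_bounds by (intro AE_I2) (simp add: abs_mult mult_left_le less_imp_le)
  qed auto
  show ?thesis
    unfolding eq by (rule has_real_derivative_tail_integral[OF cont int])
qed

text \<open>The second partial derivative comes from the first by the symmetry of \<open>J\<close>;
  its joint continuity upgrades the two partial derivatives to a total derivative.\<close>

lemma has_derivative_gauss_J_Phi:
  "((\<lambda>(a, b). gauss_J (Phi a) (Phi b) \<rho>) has_derivative (\<lambda>(u, v).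
     std_normal_density a * Phi ((b - \<rho> * a) / sqrt (1 - \<rho>\<^sup>2)) * u +
     std_normal_density b * Phi ((a - \<rho> * b) / sqrt (1 - \<rho>\<^sup>2)) * v)) (at (a, b))"
proof -
  let ?D = "\<lambda>a b. std_normal_density a * Phi ((b - \<rho> * a) / sqrt (1 - \<rho>\<^sup>2))"
  have "continuous_on UNIV (\<lambda>p. blinfun_mult_right (?D (snd p) (fst p)))"
    using sqrt_one_minus_square_pos
    by (intro bounded_linear.continuous_on[OF bounded_linear_blinfun_mult_right] continuous_intros) auto
  hence c: "continuous (at (a, b)) (\<lambda>(x, y). blinfun_mult_right (?D y x))"
    by (simp add: continuous_on_eq_continuous_at case_prod_unfold)
  have "((\<lambda>(a, b). gauss_J (Phi a) (Phi b) \<rho>) has_derivative (\<lambda>(u, v). ?D a b * u + blinfun_mult_right (?D b a) v))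
     (at (a, b) within UNIV \<times> UNIV)"
  proof (rule has_derivative_partialsI)
    show "((\<lambda>a. gauss_J (Phi a) (Phi b) \<rho>) has_derivative (*) (?D a b)) (at a)"
      using DERIV_gauss_J_Phi_fst by (simp add: has_field_derivative_def)
    show "((\<lambda>b. gauss_J (Phi a) (Phi b) \<rho>) has_derivative blinfun_mult_right (?D b a)) (at b)" for a b
      using DERIV_gauss_J_Phi_fst[of a b] by (simp add: has_field_derivative_def gauss_J_commute[OF \<rho>, of "Phi a"])
  qed (use c in auto)
  thus ?thesis by simp
qed

lemma DERIV_gauss_J:
  assumes x: "(x has_real_derivative x') (at t)" and y: "(y has_real_derivative y') (at t)"
    and 01: "0 < x t" "x t < 1" "0 < y t" "y t < 1"
  shows "((\<lambda>t. gauss_J (x t) (y t) \<rho>) has_real_derivative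
    gauss_J1 \<rho> (x t) (y t) * x' + gauss_J1 \<rho> (y t) (x t) * y') (at t)"
proof -
  have "((\<lambda>t. (quantile (x t), quantile (y t))) has_derivative
     (\<lambda>h. (x' / std_normal_density (quantile (x t)) * h, y' / std_normal_density (quantile (y t)) * h))) (at t)"
    using DERIV_quantile_chain[OF x 01(1,2)] DERIV_quantile_chain[OF y 01(3,4)]
    unfolding has_field_derivative_def by (rule has_derivative_Pair)
  from has_derivative_compose[OF this has_derivative_gauss_J_Phi, unfolded prod.case]
  have D: "((\<lambda>t. gauss_J (Phi (quantile (x t))) (Phi (quantile (y t))) \<rho>) has_real_derivative
    gauss_J1 \<rho> (x t) (y t) * x' + gauss_J1 \<rho> (y t) (x t) * y') (at t)"
    unfolding has_field_derivative_def
    by (rule has_derivative_eq_rhs) (auto simp: gauss_J1_def fun_eq_iff algebra_simps less_imp_neq[OF std_normal_density_pos, symmetric])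
  \<comment> \<open>\<open>Phi (quantile p) = p\<close> is available for \<open>p\<close> strictly
    between 0 and 1 only, which \<open>x\<close> and \<open>y\<close> satisfy near
    \<open>t\<close>.\<close>
  have ev: "\<forall>\<^sub>F t in nhds t. gauss_J (Phi (quantile (x t))) (Phi (quantile (y t))) \<rho> = gauss_J (x t) (y t) \<rho>"
  proof -
    have "(x \<longlongrightarrow> x t) (nhds t)" "(y \<longlongrightarrow> y t) (nhds t)"
      using DERIV_isCont[OF x] DERIV_isCont[OF y] by (simp_all add: isCont_def tendsto_at_iff_tendsto_nhds)
    hence "\<forall>\<^sub>F t in nhds t. 0 < x t" "\<forall>\<^sub>F t in nhds t. x t < 1" "\<forall>\<^sub>F t in nhds t. 0 < y t" "\<forall>\<^sub>F t in nhds t. y t < 1"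
      using 01 by (auto elim: order_tendstoD)
    thus ?thesis by eventually_elim simp
  qed
  show ?thesis
    by (rule DERIV_cong_ev[OF refl ev refl, THEN iffD1, OF D])
qed

lemma DERIV_gauss_J1:
  assumes x: "(x has_real_derivative x') (at t)" and y: "(y has_real_derivative y') (at t)"
    and 01: "0 < x t" "x t < 1" "0 < y t" "y t < 1"
  shows "((\<lambda>t. gauss_J1 \<rho> (x t) (y t)) has_real_derivative
    gauss_J11 \<rho> (x t) (y t) * x' + gauss_J12 \<rho> (x t) (y t) * y') (at t)"
proof -
  define s p q where "s = sqrt (1 - \<rho>\<^sup>2)" and "p = std_normal_density (quantile (x t))" and "q = std_normal_density (quantile (y t))"
  have pos: "0 < s" "0 < p" "0 < q" using sqrt_one_minus_square_pos by (simp_all add: s_def p_def q_def)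
  have "((\<lambda>t. (quantile (y t) - \<rho> * quantile (x t)) / s) has_real_derivative (y' / q - \<rho> * (x' / p)) / s) (at t)"
    unfolding p_def q_def by (intro DERIV_cdivide DERIV_diff DERIV_cmult DERIV_quantile_chain x y 01)
  from DERIV_Phi_chain[OF this] show ?thesis
    unfolding gauss_J1_def gauss_J11_def gauss_J12_def s_def[symmetric] p_def[symmetric] q_def[symmetric]
    by (rule DERIV_cong) (use pos in \<open>simp add: field_simps\<close>)
qed

lemma continuous_on_gauss_J11: "continuous_on ({0<..<1} \<times> {0<..<1}) (\<lambda>p. gauss_J11 \<rho> (fst p) (snd p))"
  and continuous_on_gauss_J12: "continuous_on ({0<..<1} \<times> {0<..<1}) (\<lambda>p. gauss_J12 \<rho> (fst p) (snd p))"
  and continuous_on_gauss_J22: "continuous_on ({0<..<1} \<times> {0<..<1}) (\<lambda>p. gauss_J11 \<rho> (snd p) (fst p))"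
  unfolding gauss_J11_def gauss_J12_def
  using sqrt_one_minus_square_pos
  by (intro continuous_intros; auto simp: less_imp_neq[OF std_normal_density_pos, symmetric])+

lemma gauss_J_Taylor:
  assumes "0 < m" "m < 1" "0 < n" "n < 1" "0 < m + u" "m + u < 1" "0 < n + v" "n + v < 1"
  obtains \<theta> where "0 < \<theta>" "\<theta> < 1"
    "gauss_J (m + u) (n + v) \<rho> = gauss_J m n \<rho> + (gauss_J1 \<rho> m n * u + gauss_J1 \<rho> n m * v) +
       (gauss_J11 \<rho> (m + \<theta> * u) (n + \<theta> * v) * u\<^sup>2 + 2 * gauss_J12 \<rho> (m + \<theta> * u) (n + \<theta> * v) * (u * v)
        + gauss_J11 \<rho> (n + \<theta> * v) (m + \<theta> * u) * v\<^sup>2) / 2"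
proof -
  define x y where "x = (\<lambda>t. m + t * u)" and "y = (\<lambda>t. n + t * v)"
  have D: "(x has_real_derivative u) (at t)" "(y has_real_derivative v) (at t)" for t
    unfolding x_def y_def by (auto intro!: derivative_eq_intros)
  have seg: "0 < c + t * d \<and> c + t * d < 1" if "0 \<le> t" "t \<le> 1" "0 < c" "c < 1" "0 < c + d" "c + d < 1" for c d t :: real
  proof -
    have "c + t * d = (1 - t) *\<^sub>R c + t *\<^sub>R (c + d)" by (simp add: algebra_simps)
    also have "\<dots> \<in> {0<..<1}"
      by (rule convexD[OF convex_real_interval(8)]) (use that in auto)
    finally show ?thesis by simp
  qed
  have 01: "0 < x t" "x t < 1" "0 < y t" "y t < 1" if "0 \<le> t" "t \<le> 1" for t
    using seg[OF that assms(1,2,5,6)] seg[OF that assms(3,4,7,8)] by (auto simp: x_def y_def)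
  \<comment> \<open>Value, first and second derivative of \<open>J\<close> along the segment from
    \<open>(m, n)\<close> to \<open>(m + u, n + v)\<close>; the expansion to order 2 reads only the
    indices 0, 1 and 2, and all later ones repeat the second derivative.\<close>
  define F where "F = (\<lambda>k::nat. \<lambda>t. if k = 0 then gauss_J (x t) (y t) \<rho> 
    else if k = 1 then gauss_J1 \<rho> (x t) (y t) * u + gauss_J1 \<rho> (y t) (x t) * v
    else gauss_J11 \<rho> (x t) (y t) * u\<^sup>2 + 2 * gauss_J12 \<rho> (x t) (y t) * (u * v) + gauss_J11 \<rho> (y t) (x t) * v\<^sup>2)"
  have "\<exists>t>0. t < 1 \<and> F 0 1 = (\<Sum>k<2. F k 0 / fact k * 1 ^ k) + F 2 t / fact 2 * 1 ^ 2"
  proof (rule Maclaurin)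
    show "\<forall>k t. k < 2 \<and> 0 \<le> t \<and> t \<le> 1 \<longrightarrow> DERIV (F k) t :> F (Suc k) t"
    proof (intro allI impI, elim conjE)
      fix k :: nat and t :: real assume t: "0 \<le> t" "t \<le> 1" and "k < 2"
      then consider "k = 0" | "k = 1" by linarith
      thus "DERIV (F k) t :> F (Suc k) t"
      proof cases
        case 1
        thus ?thesis using DERIV_gauss_J[OF D 01[OF t]] by (simp add: F_def)
      next
        case 2
        have "((\<lambda>t. gauss_J1 \<rho> (x t) (y t) * u + gauss_J1 \<rho> (y t) (x t) * v) has_real_derivative
          (gauss_J11 \<rho> (x t) (y t) * u + gauss_J12 \<rho> (x t) (y t) * v) * u + 
          (gauss_J11 \<rho> (y t) (x t) * v + gauss_J12 \<rho> (y t) (x t) * u) * v) (at t)"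
          by (intro DERIV_add DERIV_cmult_right DERIV_gauss_J1 D 01 t)
        also have "(gauss_J11 \<rho> (x t) (y t) * u + gauss_J12 \<rho> (x t) (y t) * v) * u + 
          (gauss_J11 \<rho> (y t) (x t) * v + gauss_J12 \<rho> (y t) (x t) * u) * v = F 2 t"
          by (simp add: F_def gauss_J12_commute[of "y t"] algebra_simps power2_eq_square)
        finally show ?thesis using 2 by (simp add: F_def numeral_2_eq_2)
      qed
    qed
  qed auto
  then obtain \<theta> where "0 < \<theta>" "\<theta> < 1" "F 0 1 = F 0 0 + F 1 0 + F 2 \<theta> / 2"
    by (auto simp: numeral_2_eq_2)
  thus ?thesis by (intro that[of \<theta>]) (simp_all add: F_def x_def y_def)
qed

text \<open>The Lagrange remainder evaluates the second derivatives at an unknown intermediate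
  point. On the compact square they differ from their values at \<open>(m, n)\<close> by an affine
  modulus, and \<open>K\<close> depends on neither the base point nor the increment.\<close>

lemma gauss_J_second_order:
  assumes \<epsilon>: "0 < \<epsilon>" and \<eta>: "0 < \<eta>"
  shows "\<exists>K\<ge>0. \<forall>m\<in>{\<epsilon>..1-\<epsilon>}. \<forall>n\<in>{\<epsilon>..1-\<epsilon>}. \<forall>u v. m + u \<in> {\<epsilon>..1-\<epsilon>} \<longrightarrow> n + v \<in> {\<epsilon>..1-\<epsilon>} \<longrightarrow>
    gauss_J (m + u) (n + v) \<rho> \<le> gauss_J m n \<rho> + (gauss_J1 \<rho> m n * u + gauss_J1 \<rho> n m * v) +
       (gauss_J11 \<rho> m n * u\<^sup>2 + 2 * gauss_J12 \<rho> m n * (u * v) + gauss_J11 \<rho> n m * v\<^sup>2) / 2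
       + (\<eta> + K * (\<bar>u\<bar> + \<bar>v\<bar>)) * (u\<^sup>2 + v\<^sup>2)"
proof -
  let ?I = "{\<epsilon>..1-\<epsilon>}"
  have sub: "?I \<times> ?I \<subseteq> {0<..<1} \<times> {0<..<1}" using \<epsilon> by auto
  have I: "compact (?I \<times> ?I)" by (intro compact_Times) auto
  note mod = modulus_of_continuity_affine[OF I continuous_on_subset[OF _ sub] \<eta>]
  obtain K1 where K1: "0 \<le> K1" "\<And>p q. p \<in> ?I \<times> ?I \<Longrightarrow> q \<in> ?I \<times> ?I \<Longrightarrow> 
      \<bar>gauss_J11 \<rho> (fst p) (snd p) - gauss_J11 \<rho> (fst q) (snd q)\<bar> \<le> \<eta> + K1 * dist p q"
    using mod[OF continuous_on_gauss_J11] by blast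
  obtain K2 where K2: "0 \<le> K2" "\<And>p q. p \<in> ?I \<times> ?I \<Longrightarrow> q \<in> ?I \<times> ?I \<Longrightarrow> 
      \<bar>gauss_J12 \<rho> (fst p) (snd p) - gauss_J12 \<rho> (fst q) (snd q)\<bar> \<le> \<eta> + K2 * dist p q"
    using mod[OF continuous_on_gauss_J12] by blast
  obtain K3 where K3: "0 \<le> K3" "\<And>p q. p \<in> ?I \<times> ?I \<Longrightarrow> q \<in> ?I \<times> ?I \<Longrightarrow> 
      \<bar>gauss_J11 \<rho> (snd p) (fst p) - gauss_J11 \<rho> (snd q) (fst q)\<bar> \<le> \<eta> + K3 * dist p q"
    using mod[OF continuous_on_gauss_J22] by blast
  define K where "K = K1 + K2 + K3"
  show ?thesis
  proof (intro exI[of _ K] conjI ballI allI impI)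
    show "0 \<le> K" using K1 K2 K3 by (simp add: K_def)
    fix m n u v assume mn: "m \<in> ?I" "n \<in> ?I" "m + u \<in> ?I" "n + v \<in> ?I"
    obtain \<theta> where \<theta>: "0 < \<theta>" "\<theta> < 1" and T: "gauss_J (m + u) (n + v) \<rho> = gauss_J m n \<rho> + (gauss_J1 \<rho> m n * u + gauss_J1 \<rho> n m * v) +
       (gauss_J11 \<rho> (m + \<theta> * u) (n + \<theta> * v) * u\<^sup>2 + 2 * gauss_J12 \<rho> (m + \<theta> * u) (n + \<theta> * v) * (u * v)
        + gauss_J11 \<rho> (n + \<theta> * v) (m + \<theta> * u) * v\<^sup>2) / 2"
      by (rule gauss_J_Taylor[of m n u v]) (use mn \<epsilon> in auto)
    let ?p = "(m + \<theta> * u, n + \<theta> * v)" and ?q = "(m, n)"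
    let ?e = "\<eta> + K * (\<bar>u\<bar> + \<bar>v\<bar>)"
    have seg: "c + \<theta> * d \<in> ?I" if "c \<in> ?I" "c + d \<in> ?I" for c d
    proof -
      have "c + \<theta> * d = (1 - \<theta>) *\<^sub>R c + \<theta> *\<^sub>R (c + d)" by (simp add: algebra_simps)
      also have "\<dots> \<in> ?I" by (rule convexD[OF convex_real_interval(5)]) (use that \<theta> in auto)
      finally show ?thesis .
    qed
    have p: "?p \<in> ?I \<times> ?I" "?q \<in> ?I \<times> ?I" using seg mn by auto
    have "dist ?p ?q \<le> \<bar>\<theta> * u\<bar> + \<bar>\<theta> * v\<bar>"
      using sqrt_sum_squares_le_sum_abs by (simp add: dist_Pair_Pair dist_real_def)
    also have "\<dots> \<le> \<bar>u\<bar> + \<bar>v\<bar>" using \<theta> by (intro add_mono) (simp_all add: abs_mult mult_left_le_one_le)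
    finally have d: "dist ?p ?q \<le> \<bar>u\<bar> + \<bar>v\<bar>" .
    have up: "\<eta> + k * dist ?p ?q \<le> ?e" if "k \<le> K" "0 \<le> k" for k
      using that d by (intro add_left_mono mult_mono) auto
    have e: "\<bar>gauss_J11 \<rho> (m + \<theta> * u) (n + \<theta> * v) - gauss_J11 \<rho> m n\<bar> \<le> ?e"
      "\<bar>gauss_J12 \<rho> (m + \<theta> * u) (n + \<theta> * v) - gauss_J12 \<rho> m n\<bar> \<le> ?e"
      "\<bar>gauss_J11 \<rho> (n + \<theta> * v) (m + \<theta> * u) - gauss_J11 \<rho> n m\<bar> \<le> ?e"
      using K1(2)[OF p] up[of K1] K2(2)[OF p] up[of K2] K3(2)[OF p] up[of K3] K1(1) K2(1) K3(1) by (auto simp: K_def)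
    have prod: "d * w \<le> ?e * \<bar>w\<bar>" if "\<bar>d\<bar> \<le> ?e" for d w
      using mult_right_mono[OF that, of "\<bar>w\<bar>"] abs_le_D1[of "d * w"] by (simp add: abs_mult)
    have b: "gauss_J11 \<rho> (m + \<theta> * u) (n + \<theta> * v) * u\<^sup>2 - gauss_J11 \<rho> m n * u\<^sup>2 \<le> ?e * u\<^sup>2"
      "gauss_J12 \<rho> (m + \<theta> * u) (n + \<theta> * v) * (u * v) - gauss_J12 \<rho> m n * (u * v) \<le> ?e * \<bar>u * v\<bar>"
      "gauss_J11 \<rho> (n + \<theta> * v) (m + \<theta> * u) * v\<^sup>2 - gauss_J11 \<rho> n m * v\<^sup>2 \<le> ?e * v\<^sup>2"
      using prod[OF e(1), of "u\<^sup>2"] prod[OF e(2), of "u * v"] prod[OF e(3), of "v\<^sup>2"]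
      by (simp_all only: left_diff_distrib abs_power2)
    \<comment> \<open>The mixed error is absorbed into those of the two squares, doubling them; the
      factor one half of the second order term undoes the doubling.\<close>
    have "2 * \<bar>u * v\<bar> \<le> u\<^sup>2 + v\<^sup>2" using sum_squares_bound[of "\<bar>u\<bar>" "\<bar>v\<bar>"] by (simp add: abs_mult)
    hence "?e * (2 * \<bar>u * v\<bar>) \<le> ?e * (u\<^sup>2 + v\<^sup>2)"
      using up[of 0] \<eta> K1 K2 K3 by (intro mult_left_mono) (auto simp: K_def)
    hence "2 * (?e * \<bar>u * v\<bar>) \<le> ?e * u\<^sup>2 + ?e * v\<^sup>2" "?e * (u\<^sup>2 + v\<^sup>2) = ?e * u\<^sup>2 + ?e * v\<^sup>2"
      by (simp_all only: distrib_left mult.left_commute)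
    moreover have alg: "J + L + (a' + 2 * b' + c') / 2 \<le> J + L + (a + 2 * b + c) / 2 + E"
      if "a' - a \<le> eu" "b' - b \<le> ew" "c' - c \<le> ev" "2 * ew \<le> eu + ev" "E = eu + ev" for J L a a' b b' c c' eu ev ew E :: real
      using that by (simp add: field_simps)
    ultimately show "gauss_J (m + u) (n + v) \<rho> \<le> gauss_J m n \<rho> + (gauss_J1 \<rho> m n * u + gauss_J1 \<rho> n m * v) +
       (gauss_J11 \<rho> m n * u\<^sup>2 + 2 * gauss_J12 \<rho> m n * (u * v) + gauss_J11 \<rho> n m * v\<^sup>2) / 2 + ?e * (u\<^sup>2 + v\<^sup>2)"
      unfolding T mult.assoc[of 2] using b by (intro alg)
  qed
qed

end

section \<open>Gaussian maximal correlation\<close>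

lemma (in prob_space) integral_Cauchy_Schwarz:
  fixes f g :: "'a \<Rightarrow> real"
  assumes f: "integrable M (\<lambda>x. (f x)\<^sup>2)" and g: "integrable M (\<lambda>x. (g x)\<^sup>2)" and fg: "integrable M (\<lambda>x. f x * g x)"
  shows "(\<integral>x. f x * g x \<partial>M)\<^sup>2 \<le> (\<integral>x. (f x)\<^sup>2 \<partial>M) * (\<integral>x. (g x)\<^sup>2 \<partial>M)"
proof -
  define F G b where "F = (\<integral>x. (f x)\<^sup>2 \<partial>M)" and "G = (\<integral>x. (g x)\<^sup>2 \<partial>M)" and "b = (\<integral>x. f x * g x \<partial>M)"
  have pos: "0 \<le> s\<^sup>2 * F - 2 * s * t * b + t\<^sup>2 * G" for s t
  proof -
    have "0 \<le> (\<integral>x. (s * f x - t * g x)\<^sup>2 \<partial>M)" by simp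
    also have "\<dots> = (\<integral>x. s\<^sup>2 * (f x)\<^sup>2 - 2 * s * t * (f x * g x) + t\<^sup>2 * (g x)\<^sup>2 \<partial>M)"
      by (simp add: power2_eq_square algebra_simps)
    also have "\<dots> = s\<^sup>2 * F - 2 * s * t * b + t\<^sup>2 * G"
      unfolding F_def G_def b_def using f g fg by simp
    finally show ?thesis .
  qed
  have "0 \<le> G" "0 \<le> F" unfolding G_def F_def by simp_all
  show ?thesis
  proof (cases "G = 0")
    case True
    have "b = 0"
    proof (rule ccontr)
      assume "b \<noteq> 0"
      \<comment> \<open>For \<open>G = 0\<close> this choice makes the nonnegative form equal to
        \<open>F - (F + 1)\<close>.\<close>
      with pos[of 1 "(F + 1) / (2 * b)"] True show False by simp
    qed
    thus ?thesis unfolding b_def[symmetric] F_def[symmetric] G_def[symmetric] using \<open>0 \<le> F\<close> \<open>0 \<le> G\<close> by simp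
  next
    case False
    with \<open>0 \<le> G\<close> have "0 < G" by simp
    \<comment> \<open>The pair \<open>s = G\<close>, \<open>t = b\<close> has the ratio that
      minimises the form.\<close>
    have "0 \<le> G * (F * G - b\<^sup>2)" using pos[of G b] by (simp add: power2_eq_square algebra_simps)
    hence "b\<^sup>2 \<le> F * G" using \<open>0 < G\<close> by (simp add: zero_le_mult_iff)
    thus ?thesis unfolding F_def G_def b_def .
  qed
qed

text \<open>The norm is at most the dimension times the largest coordinate in modulus, so its powers
  are dominated by one-dimensional absolute moments.\<close>

lemma integrable_norm_power_std_gaussian:
  "integrable std_gaussian (\<lambda>x::real^'n. norm x ^ k)"
proof (rule Bochner_Integration.integrable_bound)
  let ?G = "std_gaussian :: (real^'n) measure"
  let ?N = "real CARD('n)"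
  have nth: "(\<lambda>x::real^'n. x $ i) \<in> borel_measurable ?G" for i
    by (simp add: borel_measurable_continuous_onI continuous_on_component)
  have "integrable std_normal_distribution (\<lambda>t. \<bar>t\<bar> ^ k)"
    using integrable_std_normal_moment_abs[of k] by (subst integrable_density) (auto simp: mult.commute)
  hence "integrable ?G (\<lambda>x. \<bar>x $ i\<bar> ^ k)" for i
    \<comment> \<open>The \<open>0\<close> instantiates the correlation parameter that the marginal
      lemma inherits from its context.\<close>
    using integrable_distr_eq[OF nth[of i], of "\<lambda>t. \<bar>t\<bar> ^ k"] distr_vec_nth_std_gaussian[of 0 i] by simp
  thus "integrable ?G (\<lambda>x. ?N ^ k * (\<Sum>i\<in>UNIV. \<bar>x $ i\<bar> ^ k))" by simp
  show "(\<lambda>x::real^'n. norm x ^ k) \<in> borel_measurable ?G" by measurable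
  show "AE x::real^'n in ?G. norm (norm x ^ k) \<le> norm (?N ^ k * (\<Sum>i\<in>UNIV. \<bar>x $ i\<bar> ^ k))"
  proof (rule AE_I2)
    fix x :: "real^'n"
    let ?M = "Max (range (\<lambda>i. \<bar>x $ i\<bar>))"
    have "?M \<in> range (\<lambda>i. \<bar>x $ i\<bar>)" by (rule Max_in) auto
    then obtain j where j: "?M = \<bar>x $ j\<bar>" by (rule rangeE)
    have "norm x \<le> (\<Sum>i\<in>UNIV. \<bar>x $ i\<bar>)" by (rule norm_le_l1_cart)
    also have "\<dots> \<le> (\<Sum>i\<in>(UNIV::'n set). \<bar>x $ j\<bar>)"
      unfolding j[symmetric] by (intro sum_mono Max_ge) auto
    finally have "norm x \<le> ?N * \<bar>x $ j\<bar>" by simp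
    hence "norm x ^ k \<le> ?N ^ k * \<bar>x $ j\<bar> ^ k"
      using power_mono[of "norm x" "?N * \<bar>x $ j\<bar>" k] by (simp add: power_mult_distrib)
    also have "\<dots> \<le> ?N ^ k * (\<Sum>i\<in>UNIV. \<bar>x $ i\<bar> ^ k)"
      by (intro mult_left_mono member_le_sum) auto
    finally show "norm (norm x ^ k) \<le> norm (?N ^ k * (\<Sum>i\<in>UNIV. \<bar>x $ i\<bar> ^ k))"
      by (simp add: sum_nonneg)
  qed
qed

section \<open>Correlations expressed through Ornstein-Uhlenbeck averages\<close>

lemma measurable_Ornstein_Uhlenbeck:
  fixes f :: "real^'n \<Rightarrow> real"
  assumes [measurable]: "f \<in> borel_measurable borel"
  shows "(\<lambda>x. \<integral>z. f (a *\<^sub>R x + b *\<^sub>R z) \<partial>std_gaussian) \<in> borel_measurable borel"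
proof -
  interpret prob_space "std_gaussian :: (real^'n) measure" by (rule prob_space_std_gaussian)
  show ?thesis by measurable
qed

lemma (in prob_space) abs_integral_le_bound:
  fixes f :: "'a \<Rightarrow> real"
  assumes "\<And>x. \<bar>f x\<bar> \<le> B"
  shows "\<bar>\<integral>x. f x \<partial>M\<bar> \<le> B"
proof -
  have B: "0 \<le> B" using assms[of undefined] by linarith
  have "\<bar>\<integral>x. f x \<partial>M\<bar> \<le> (\<integral>x. \<bar>f x\<bar> \<partial>M)" by (rule integral_abs_bound)
  also have "\<dots> \<le> (\<integral>x. B \<partial>M)"
    by (rule integral_mono') (use assms B in auto)
  finally show ?thesis by (simp add: prob_space)
qed

lemma (in prob_space) integrable_mult_bounded:
  fixes f g :: "'a \<Rightarrow> real"
  assumes "f \<in> borel_measurable M" "g \<in> borel_measurable M"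
    and bd: "\<And>x. \<bar>f x\<bar> \<le> B" "\<And>x. \<bar>g x\<bar> \<le> C"
  shows "integrable M (\<lambda>x. f x * g x)"
proof (rule integrable_const_bound)
  have "\<bar>f x * g x\<bar> \<le> B * C" for x
    unfolding abs_mult using order_trans[OF abs_ge_zero bd(1)] by (intro mult_mono bd) auto
  thus "AE x in M. norm (f x * g x) \<le> B * C" by simp
qed (use assms in simp)

text \<open>Integrating out the noise in the second vector turns the pair expectation into the inner
  product of \<open>f\<close> with an average of \<open>g\<close> at parameter
  \<open>\<rho>\<close>. The common-factor formula distributes the same averaging evenly, at
  parameter \<open>sqrt \<rho>\<close>; the argument below plays the two against each other.\<close>

lemma integral_gauss_pair_eq:
  fixes f g :: "real^'n \<Rightarrow> real"
  assumes \<rho>: "-1 < \<rho>" "\<rho> < 1" and [measurable]: "f \<in> borel_measurable borel" "g \<in> borel_measurable borel"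
    and bd: "\<And>x. \<bar>f x\<bar> \<le> B" "\<And>x. \<bar>g x\<bar> \<le> B"
  shows "(\<integral>p. f (fst p) * g (snd p) \<partial>gauss_pair \<rho>) =
    (\<integral>x. f x * (\<integral>z. g (\<rho> *\<^sub>R x + sqrt (1 - \<rho>\<^sup>2) *\<^sub>R z) \<partial>std_gaussian) \<partial>std_gaussian)"
proof -
  let ?G = "std_gaussian :: (real^'n) measure"
  interpret G: prob_space ?G by (rule prob_space_std_gaussian)
  interpret GG: pair_prob_space ?G ?G ..
  have B: "0 \<le> B" using bd(1)[of 0] by linarith
  have bd2: "\<bar>f x * g y\<bar> \<le> B * B" for x y
    unfolding abs_mult by (intro mult_mono bd) (use B in auto)
  have T: "(\<lambda>(x, z). (x, \<rho> *\<^sub>R x + sqrt (1 - \<rho>\<^sup>2) *\<^sub>R z)) \<in> borel_measurable (?G \<Otimes>\<^sub>M ?G)"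
    unfolding case_prod_beta by measurable
  have mf: "(\<lambda>p::(real^'n) \<times> (real^'n). f (fst p) * g (snd p)) \<in> borel_measurable borel"
    unfolding borel_prod[symmetric] by measurable
  have "(\<integral>p. f (fst p) * g (snd p) \<partial>gauss_pair \<rho>) =
    (\<integral>q. f (fst q) * g (\<rho> *\<^sub>R fst q + sqrt (1 - \<rho>\<^sup>2) *\<^sub>R snd q) \<partial>(?G \<Otimes>\<^sub>M ?G))"
    unfolding gauss_pair_eq[OF \<rho>] noise_pair_def by (subst integral_distr[OF T mf]) (simp add: case_prod_beta)
  also have "\<dots> = (\<integral>x. \<integral>z. f x * g (\<rho> *\<^sub>R x + sqrt (1 - \<rho>\<^sup>2) *\<^sub>R z) \<partial>?G \<partial>?G)"
    by (subst GG.integral_fst'[symmetric])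
       (auto intro!: GG.P.integrable_const_bound[where B="B * B"] bd2)
  finally show ?thesis by simp
qed

text \<open>Taking \<open>g = f\<close> in the common-factor formula shows the autocorrelation as a
  mean square, so it is nonnegative.\<close>

lemma gauss_pair_autocorrelation:
  fixes f :: "real^'n \<Rightarrow> real"
  assumes \<rho>: "0 < \<rho>" "\<rho> < 1" and f: "f \<in> borel_measurable borel" "\<And>x. \<bar>f x\<bar> \<le> B"
  shows "(\<integral>p. f (fst p) * f (snd p) \<partial>gauss_pair \<rho>) =
    (\<integral>w. (\<integral>z. f (sqrt \<rho> *\<^sub>R w + sqrt (1 - \<rho>) *\<^sub>R z) \<partial>std_gaussian)\<^sup>2 \<partial>std_gaussian)"
  using integral_gauss_pair_common_factor[OF \<rho> f(1) f(1) f(2) f(2)] by (simp add: power2_eq_square)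

text \<open>Cauchy-Schwarz for the inner product of \<open>f\<close> with its average at parameter
  \<open>\<rho>\<close>. The mean square of that average is the autocorrelation at
  \<open>\<rho>\<^sup>2\<close>, since \<open>sqrt (\<rho>\<^sup>2) = \<rho>\<close>.\<close>

lemma gauss_pair_autocorrelation_square:
  fixes f :: "real^'n \<Rightarrow> real"
  assumes \<rho>: "0 < \<rho>" "\<rho> < 1" and f[measurable]: "f \<in> borel_measurable borel" and bd: "\<And>x. \<bar>f x\<bar> \<le> B"
  shows "(\<integral>p. f (fst p) * f (snd p) \<partial>gauss_pair \<rho>)\<^sup>2 \<le>
    (\<integral>x. (f x)\<^sup>2 \<partial>std_gaussian) * (\<integral>p. f (fst p) * f (snd p) \<partial>gauss_pair (\<rho>\<^sup>2))"
proof -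
  let ?G = "std_gaussian :: (real^'n) measure"
  interpret G: prob_space ?G by (rule prob_space_std_gaussian)
  define P where "P = (\<lambda>x. \<integral>z. f (\<rho> *\<^sub>R x + sqrt (1 - \<rho>\<^sup>2) *\<^sub>R z) \<partial>?G)"
  have P[measurable]: "P \<in> borel_measurable borel" unfolding P_def by (rule measurable_Ornstein_Uhlenbeck[OF f])
  have B: "0 \<le> B" using bd[of 0] by linarith
  have Pb: "\<bar>P x\<bar> \<le> B" for x unfolding P_def by (rule G.abs_integral_le_bound) (rule bd)
  have \<rho>2: "0 < \<rho>\<^sup>2" "\<rho>\<^sup>2 < 1" using \<rho> by (simp_all add: abs_square_less_1)
  have "(\<integral>p. f (fst p) * f (snd p) \<partial>gauss_pair \<rho>)\<^sup>2 = (\<integral>x. f x * P x \<partial>?G)\<^sup>2"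
    unfolding P_def using \<rho> by (subst integral_gauss_pair_eq[OF _ _ f f bd bd]) auto
  also have "\<dots> \<le> (\<integral>x. (f x)\<^sup>2 \<partial>?G) * (\<integral>x. (P x)\<^sup>2 \<partial>?G)"
  proof (rule G.integral_Cauchy_Schwarz)
    show "integrable ?G (\<lambda>x. (f x)\<^sup>2)" "integrable ?G (\<lambda>x. (P x)\<^sup>2)" "integrable ?G (\<lambda>x. f x * P x)"
      unfolding power2_eq_square by (rule G.integrable_mult_bounded[OF _ _ bd bd] G.integrable_mult_bounded[OF _ _ Pb Pb]
        G.integrable_mult_bounded[OF _ _ bd Pb]; measurable)+
  qed
  also have "(\<integral>x. (P x)\<^sup>2 \<partial>?G) = (\<integral>p. f (fst p) * f (snd p) \<partial>gauss_pair (\<rho>\<^sup>2))"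
    using gauss_pair_autocorrelation[OF \<rho>2 f bd] \<rho> by (simp add: P_def)
  finally show ?thesis .
qed

text \<open>Since \<open>f\<close> is centred, its average is unchanged by subtracting
  \<open>f z\<close> under the integral, and the Lipschitz condition then makes it of order
  \<open>\<rho>\<close>. The size of \<open>C\<close> is immaterial: the later argument takes roots
  of order \<open>2 ^ k\<close>.\<close>

lemma gauss_pair_autocorrelation_linear_bound:
  fixes f :: "real^'n \<Rightarrow> real"
  assumes f[measurable]: "f \<in> borel_measurable borel" and bd: "\<And>x. \<bar>f x\<bar> \<le> B"
    and lip: "\<And>x y. \<bar>f x - f y\<bar> \<le> L * norm (x - y)" and mean: "(\<integral>x. f x \<partial>std_gaussian) = 0"
  shows "\<exists>C\<ge>0. \<forall>\<rho>. 0 < \<rho> \<longrightarrow> \<rho> < 1 \<longrightarrow> (\<integral>p. f (fst p) * f (snd p) \<partial>gauss_pair \<rho>) \<le> C * \<rho>"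
proof -
  let ?G = "std_gaussian :: (real^'n) measure"
  interpret G: prob_space ?G by (rule prob_space_std_gaussian)
  have [simp]: "measure ?G UNIV = 1" using G.prob_space by simp
  define \<mu> where "\<mu> = (\<integral>x. norm x \<partial>?G)"
  have \<mu>: "integrable ?G norm" "0 \<le> \<mu>" using integrable_norm_power_std_gaussian[of 1] by (simp_all add: \<mu>_def)
  have B: "0 \<le> B" using bd[of 0] by linarith
  \<comment> \<open>A unit vector and the origin are at distance 1, so the Lipschitz bound between
    them reads \<open>\<bar>f x - f 0\<bar> \<le> L\<close>.\<close>
  have L: "0 \<le> L" using order_trans[OF abs_ge_zero lip[of "axis undefined 1" 0]] by simp
  have fi: "integrable ?G (\<lambda>z. f (a *\<^sub>R x + b *\<^sub>R z))" for a b x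
    by (rule G.integrable_const_bound[where B=B]) (auto simp: bd)
  have "(\<integral>p. f (fst p) * f (snd p) \<partial>gauss_pair \<rho>) \<le> (B * L * (2 * \<mu>)) * \<rho>" if \<rho>: "0 < \<rho>" "\<rho> < 1" for \<rho>
  proof -
    let ?s = "sqrt (1 - \<rho>\<^sup>2)"
    define P where "P = (\<lambda>x. \<integral>z. f (\<rho> *\<^sub>R x + ?s *\<^sub>R z) \<partial>?G)"
    have P[measurable]: "P \<in> borel_measurable borel" unfolding P_def by (rule measurable_Ornstein_Uhlenbeck[OF f])
    have s: "0 \<le> 1 - ?s" "1 - ?s \<le> \<rho>"
    proof -
      \<comment> \<open>This amounts to \<open>\<rho> * \<rho> \<le> \<rho>\<close>; it makes the
        contraction of the noise, \<open>1 - ?s\<close>, also of order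
        \<open>\<rho>\<close>.\<close>
      have "(1 - \<rho>)\<^sup>2 \<le> 1 - \<rho>\<^sup>2"
        using \<rho> mult_nonneg_nonneg[of \<rho> "1 - \<rho>"] by (simp add: power2_eq_square algebra_simps)
      from real_le_rsqrt[OF this] show "1 - ?s \<le> \<rho>" by simp
      have "?s \<le> 1" using \<rho> by (intro real_le_lsqrt) auto
      thus "0 \<le> 1 - ?s" by simp
    qed
    have Pb: "\<bar>P x\<bar> \<le> L * \<rho> * (norm x + \<mu>)" for x
    proof -
      have "P x = (\<integral>z. f (\<rho> *\<^sub>R x + ?s *\<^sub>R z) \<partial>?G) - (\<integral>z. f z \<partial>?G)" unfolding P_def mean by simp
      also have "\<dots> = (\<integral>z. f (\<rho> *\<^sub>R x + ?s *\<^sub>R z) - f z \<partial>?G)"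
        using fi[of 1 0 0] fi[of \<rho> x ?s] fi[of 0 0 1] by simp
      finally have "\<bar>P x\<bar> \<le> (\<integral>z. \<bar>f (\<rho> *\<^sub>R x + ?s *\<^sub>R z) - f z\<bar> \<partial>?G)"
        using integral_abs_bound by metis
      also have "\<dots> \<le> (\<integral>z. L * \<rho> * (norm x + norm z) \<partial>?G)"
      proof (rule integral_mono)
        show "integrable ?G (\<lambda>z. \<bar>f (\<rho> *\<^sub>R x + ?s *\<^sub>R z) - f z\<bar>)"
          using fi[of \<rho> x ?s] fi[of 0 0 1] by simp
        show "integrable ?G (\<lambda>z. L * \<rho> * (norm x + norm z))" using \<mu> by simp
        fix z
        have "\<bar>f (\<rho> *\<^sub>R x + ?s *\<^sub>R z) - f z\<bar> \<le> L * norm (\<rho> *\<^sub>R x + ?s *\<^sub>R z - z)" by (rule lip)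
        also have "\<rho> *\<^sub>R x + ?s *\<^sub>R z - z = \<rho> *\<^sub>R x - (1 - ?s) *\<^sub>R z" by (simp add: algebra_simps)
        also have "L * norm (\<rho> *\<^sub>R x - (1 - ?s) *\<^sub>R z) \<le> L * (\<rho> * norm x + (1 - ?s) * norm z)"
          using norm_triangle_ineq4[of "\<rho> *\<^sub>R x" "(1 - ?s) *\<^sub>R z"] s \<rho> L by (intro mult_left_mono) simp_all
        also have "\<dots> \<le> L * (\<rho> * norm x + \<rho> * norm z)" using s L by (intro mult_left_mono add_left_mono mult_right_mono) auto
        finally show "\<bar>f (\<rho> *\<^sub>R x + ?s *\<^sub>R z) - f z\<bar> \<le> L * \<rho> * (norm x + norm z)"
          using L by (simp add: algebra_simps)
      qed
      also have "\<dots> = L * \<rho> * (norm x + \<mu>)" using \<mu> by (simp add: \<mu>_def G.prob_space)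
      finally show ?thesis .
    qed
    have "(\<integral>p. f (fst p) * f (snd p) \<partial>gauss_pair \<rho>) = (\<integral>x. f x * P x \<partial>?G)"
      unfolding P_def using \<rho> by (subst integral_gauss_pair_eq[OF _ _ f f bd bd]) auto
    also have "\<dots> \<le> (\<integral>x. B * (L * \<rho> * (norm x + \<mu>)) \<partial>?G)"
    proof (rule integral_mono_AE')
      show "integrable ?G (\<lambda>x. B * (L * \<rho> * (norm x + \<mu>)))" using \<mu> by simp
      show "AE x in ?G. f x * P x \<le> B * (L * \<rho> * (norm x + \<mu>))"
      proof (rule AE_I2)
        fix x
        have "f x * P x \<le> \<bar>f x\<bar> * \<bar>P x\<bar>" by (metis abs_ge_self abs_mult)
        also have "\<dots> \<le> B * (L * \<rho> * (norm x + \<mu>))" by (intro mult_mono bd Pb) (use B in auto)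
        finally show "f x * P x \<le> B * (L * \<rho> * (norm x + \<mu>))" .
      qed
      show "AE x in ?G. 0 \<le> B * (L * \<rho> * (norm x + \<mu>))" using B L \<rho> \<mu> by simp
    qed
    also have "\<dots> = B * (L * \<rho> * (\<mu> + \<mu>))" using \<mu> by (simp add: \<mu>_def G.prob_space)
    finally show ?thesis by (simp add: algebra_simps)
  qed
  thus ?thesis using B L \<mu> by (intro exI[of _ "B * L * (2 * \<mu>)"]) auto
qed

text \<open>Iterating \<open>K \<rho>\<^sup>2 \<le> V K(\<rho>\<^sup>2)\<close> and inserting the linear bound at \<open>\<rho> ^ 2 ^ k\<close> shows that
  the powers of \<open>K \<rho> / (V \<rho>)\<close> stay bounded; this avoids the Hermite expansion.\<close>

lemma gauss_pair_autocorrelation_le: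
  fixes f :: "real^'n \<Rightarrow> real"
  assumes \<rho>: "0 < \<rho>" "\<rho> < 1" and f: "f \<in> borel_measurable borel" and bd: "\<And>x. \<bar>f x\<bar> \<le> B"
    and lip: "\<And>x y. \<bar>f x - f y\<bar> \<le> L * norm (x - y)" and mean: "(\<integral>x. f x \<partial>std_gaussian) = 0"
  shows "(\<integral>p. f (fst p) * f (snd p) \<partial>gauss_pair \<rho>) \<le> \<rho> * (\<integral>x. (f x)\<^sup>2 \<partial>std_gaussian)"
proof -
  define K where "K = (\<lambda>\<rho>. \<integral>p. f (fst p) * f (snd p) \<partial>(gauss_pair \<rho> :: ((real^'n) \<times> (real^'n)) measure))"
  define V where "V = (\<integral>x. (f x)\<^sup>2 \<partial>(std_gaussian :: (real^'n) measure))"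
  have V: "0 \<le> V" unfolding V_def by simp
  obtain C where C: "0 \<le> C" "\<And>\<rho>. 0 < \<rho> \<Longrightarrow> \<rho> < 1 \<Longrightarrow> K \<rho> \<le> C * \<rho>"
    using gauss_pair_autocorrelation_linear_bound[OF f bd lip mean] unfolding K_def by blast
  have K0: "0 \<le> K \<rho>" if "0 < \<rho>" "\<rho> < 1" for \<rho>
    unfolding K_def gauss_pair_autocorrelation[OF that f bd] by simp
  have sq: "(K \<rho>)\<^sup>2 \<le> V * K (\<rho>\<^sup>2)" if "0 < \<rho>" "\<rho> < 1" for \<rho>
    unfolding K_def V_def by (rule gauss_pair_autocorrelation_square[OF that f bd])
  show ?thesis
  proof (cases "V = 0")
    case True
    hence "K \<rho> = 0" using sq[OF \<rho>] by simp
    thus ?thesis using True by (simp add: K_def V_def)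
  next
    case False
    hence V: "0 < V" using V by simp
    have pw: "0 < \<rho> ^ 2 ^ k" "\<rho> ^ 2 ^ k < 1" for k using \<rho> by (simp_all add: power_less_one_iff)
    have iter: "(K \<rho> / V) ^ 2 ^ k \<le> K (\<rho> ^ 2 ^ k) / V" for k
    proof (induction k)
      case (Suc k)
      have "(K \<rho> / V) ^ 2 ^ Suc k = ((K \<rho> / V) ^ 2 ^ k)\<^sup>2" by (simp add: power_mult[symmetric] mult.commute)
      also have "\<dots> \<le> (K (\<rho> ^ 2 ^ k) / V)\<^sup>2" using K0[OF \<rho>] V by (intro power_mono Suc) auto
      also have "\<dots> \<le> K ((\<rho> ^ 2 ^ k)\<^sup>2) / V"
        using sq[OF pw, of k] V by (simp add: power_divide divide_simps power2_eq_square mult_ac)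
      finally show ?case by (simp add: power_mult[symmetric] mult.commute)
    qed simp
    have "(K \<rho> / (V * \<rho>)) ^ 2 ^ k \<le> C / V" for k
    proof -
      have "(K \<rho> / (V * \<rho>)) ^ 2 ^ k = (K \<rho> / V) ^ 2 ^ k / \<rho> ^ 2 ^ k"
        by (simp add: power_divide power_mult_distrib)
      also have "\<dots> \<le> (K (\<rho> ^ 2 ^ k) / V) / \<rho> ^ 2 ^ k"
        using pw(1)[of k] iter[of k] by (intro divide_right_mono) auto
      also have "\<dots> \<le> (C * \<rho> ^ 2 ^ k / V) / \<rho> ^ 2 ^ k"
        using pw(1)[of k] C(2)[OF pw, of k] V by (intro divide_right_mono) auto
      finally show ?thesis using pw(1)[of k] \<rho> by simp
    qed
    moreover have "\<exists>k. C / V < (K \<rho> / (V * \<rho>)) ^ 2 ^ k" if "1 < K \<rho> / (V * \<rho>)"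
    proof -
      obtain m where m: "C / V < (K \<rho> / (V * \<rho>)) ^ m" using real_arch_pow[OF \<open>1 < K \<rho> / (V * \<rho>)\<close>] by blast
      \<comment> \<open>Some power exceeds the bound; since \<open>m < 2 ^ m\<close> and the base is
        above 1, so does a power with exponent of the required form.\<close>
      also have "\<dots> \<le> (K \<rho> / (V * \<rho>)) ^ 2 ^ m"
        using that by (intro power_increasing) (auto intro: less_imp_le less_exp)
      finally show ?thesis by blast
    qed
    ultimately have "K \<rho> / (V * \<rho>) \<le> 1" by (meson not_le)
    hence "K \<rho> \<le> \<rho> * V" using V \<rho> by (simp add: field_simps)
    thus ?thesis by (simp add: K_def V_def)
  qed
qed

text \<open>Given the common factor, the expectation is an inner product of two averages.
  Cauchy-Schwarz bounds it by the two autocorrelations, each at most \<open>\<rho>\<close> times a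
  variance.\<close>

lemma gauss_pair_correlation_le:
  fixes f g :: "real^'n \<Rightarrow> real"
  assumes \<rho>: "0 < \<rho>" "\<rho> < 1" 
    and f: "f \<in> borel_measurable borel" "\<And>x. \<bar>f x\<bar> \<le> B" "\<And>x y. \<bar>f x - f y\<bar> \<le> L * norm (x - y)" "(\<integral>x. f x \<partial>std_gaussian) = 0"
    and g: "g \<in> borel_measurable borel" "\<And>x. \<bar>g x\<bar> \<le> B" "\<And>x y. \<bar>g x - g y\<bar> \<le> L * norm (x - y)" "(\<integral>x. g x \<partial>std_gaussian) = 0"
  shows "(\<integral>p. f (fst p) * g (snd p) \<partial>gauss_pair \<rho>) \<le> 
    \<rho> * (sqrt (\<integral>x. (f x)\<^sup>2 \<partial>std_gaussian) * sqrt (\<integral>x. (g x)\<^sup>2 \<partial>std_gaussian))"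
proof -
  let ?G = "std_gaussian :: (real^'n) measure"
  interpret G: prob_space ?G by (rule prob_space_std_gaussian)
  define P where "P = (\<lambda>f w. \<integral>z. f (sqrt \<rho> *\<^sub>R w + sqrt (1 - \<rho>) *\<^sub>R z) \<partial>?G :: real)"
  have [measurable]: "P f \<in> borel_measurable borel" "P g \<in> borel_measurable borel"
    unfolding P_def using measurable_Ornstein_Uhlenbeck f(1) g(1) by blast+
  have B: "0 \<le> B" using f(2)[of 0] by linarith
  have Pb: "\<bar>P f w\<bar> \<le> B" "\<bar>P g w\<bar> \<le> B" for w
    unfolding P_def by (rule G.abs_integral_le_bound, rule f g)+
  have "(\<integral>p. f (fst p) * g (snd p) \<partial>gauss_pair \<rho>)\<^sup>2 = (\<integral>w. P f w * P g w \<partial>?G)\<^sup>2"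
    unfolding P_def by (subst integral_gauss_pair_common_factor[OF \<rho> f(1) g(1) f(2) g(2)]) simp
  also have "\<dots> \<le> (\<integral>w. (P f w)\<^sup>2 \<partial>?G) * (\<integral>w. (P g w)\<^sup>2 \<partial>?G)"
  proof (rule G.integral_Cauchy_Schwarz)
    show "integrable ?G (\<lambda>w. (P f w)\<^sup>2)" "integrable ?G (\<lambda>w. (P g w)\<^sup>2)" "integrable ?G (\<lambda>w. P f w * P g w)"
      unfolding power2_eq_square by (rule G.integrable_mult_bounded[OF _ _ Pb(1) Pb(1)] G.integrable_mult_bounded[OF _ _ Pb(2) Pb(2)]
        G.integrable_mult_bounded[OF _ _ Pb]; measurable)+
  qed
  also have "\<dots> \<le> (\<rho> * (\<integral>x. (f x)\<^sup>2 \<partial>?G)) * (\<rho> * (\<integral>x. (g x)\<^sup>2 \<partial>?G))"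
    using gauss_pair_autocorrelation_le[OF \<rho> f] gauss_pair_autocorrelation_le[OF \<rho> g] \<rho>
    unfolding gauss_pair_autocorrelation[OF \<rho> f(1,2)] gauss_pair_autocorrelation[OF \<rho> g(1,2)]
    by (intro mult_mono) (auto simp: P_def)
  also have "\<dots> = (\<rho> * (sqrt (\<integral>x. (f x)\<^sup>2 \<partial>?G) * sqrt (\<integral>x. (g x)\<^sup>2 \<partial>?G)))\<^sup>2"
    by (simp add: power_mult_distrib power2_eq_square algebra_simps real_sqrt_mult[symmetric])
  finally show ?thesis
    by (rule power2_le_imp_le) (use \<rho> in simp)
qed

section \<open>Lipschitz functions\<close>

lemma integral_fst_gauss_pair:
  fixes f :: "real^'n \<Rightarrow> real"
  assumes \<rho>: "-1 < \<rho>" "\<rho> < 1" and f: "f \<in> borel_measurable borel"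
  shows "(\<integral>p. f (fst p) \<partial>gauss_pair \<rho>) = (\<integral>x. f x \<partial>std_gaussian)"
    and "(\<integral>p. f (snd p) \<partial>gauss_pair \<rho>) = (\<integral>x. f x \<partial>std_gaussian)"
    and "integrable (gauss_pair \<rho>) (\<lambda>p. f (fst p)) \<longleftrightarrow> integrable std_gaussian f"
    and "integrable (gauss_pair \<rho>) (\<lambda>p. f (snd p)) \<longleftrightarrow> integrable std_gaussian f"
proof -
  have m: "fst \<in> borel_measurable (gauss_pair \<rho> :: ((real^'n) \<times> (real^'n)) measure)" 
     "snd \<in> borel_measurable (gauss_pair \<rho> :: ((real^'n) \<times> (real^'n)) measure)"
    by (intro measurable_gauss_pair[OF \<rho>] borel_measurable_continuous_onI continuous_intros)+
  show "(\<integral>p. f (fst p) \<partial>gauss_pair \<rho>) = (\<integral>x. f x \<partial>std_gaussian)"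
    "(\<integral>p. f (snd p) \<partial>gauss_pair \<rho>) = (\<integral>x. f x \<partial>std_gaussian)"
    using integral_distr[OF m(1) f] integral_distr[OF m(2) f] by (simp_all add: distr_fst_gauss_pair[OF \<rho>] distr_snd_gauss_pair[OF \<rho>])
  show "integrable (gauss_pair \<rho>) (\<lambda>p. f (fst p)) \<longleftrightarrow> integrable std_gaussian f"
    "integrable (gauss_pair \<rho>) (\<lambda>p. f (snd p)) \<longleftrightarrow> integrable std_gaussian f"
    using integrable_distr_eq[OF m(1) f] integrable_distr_eq[OF m(2) f] by (simp_all add: distr_fst_gauss_pair[OF \<rho>] distr_snd_gauss_pair[OF \<rho>])
qed

text \<open>\<open>e *\<^sub>R r\<close> has the law of \<open>c *\<^sub>R p + d *\<^sub>R q\<close>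
  for independent copies \<open>p\<close>, \<open>q\<close>; dividing by \<open>e\<close> reduces
  this to coefficients whose squares sum to 1.\<close>

lemma integral_gauss_pair_semigroup:
  fixes F :: "(real^'n) \<times> (real^'n) \<Rightarrow> real"
  assumes \<rho>: "-1 < \<rho>" "\<rho> < 1" and F: "F \<in> borel_measurable borel" and bd: "\<And>p. \<bar>F p\<bar> \<le> B"
    and e: "e\<^sup>2 = c\<^sup>2 + d\<^sup>2" "0 < e"
  shows "(\<integral>r. F (a + e *\<^sub>R r) \<partial>gauss_pair \<rho>) = (\<integral>p. \<integral>q. F (a + c *\<^sub>R p + d *\<^sub>R q) \<partial>gauss_pair \<rho> \<partial>gauss_pair \<rho>)"
proof -
  let ?G = "gauss_pair \<rho> :: ((real^'n) \<times> (real^'n)) measure"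
  interpret G: prob_space ?G by (rule prob_space_gauss_pair[OF \<rho>])
  interpret GG: pair_prob_space ?G ?G ..
  have [measurable_cong]: "sets ?G = sets borel" by (rule sets_gauss_pair[OF \<rho>])
  note [measurable] = F
  have cd: "(c / e)\<^sup>2 + (d / e)\<^sup>2 = 1" using e(2) by (simp add: power_divide add_divide_distrib[symmetric] e(1)[symmetric])
  let ?T = "\<lambda>(p, q). (c / e) *\<^sub>R p + (d / e) *\<^sub>R q"
  have T: "?T \<in> borel_measurable (?G \<Otimes>\<^sub>M ?G)" unfolding case_prod_beta by measurable
  have [measurable]: "(\<lambda>r. F (a + e *\<^sub>R r)) \<in> borel_measurable borel"
    "(\<lambda>p. F (a + c *\<^sub>R fst p + d *\<^sub>R snd p)) \<in> borel_measurable (?G \<Otimes>\<^sub>M ?G)" by measurable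
  have "(\<integral>r. F (a + e *\<^sub>R r) \<partial>?G) = (\<integral>r. F (a + e *\<^sub>R r) \<partial>distr (?G \<Otimes>\<^sub>M ?G) borel ?T)"
    unfolding gauss_pair_convolution[OF \<rho> cd] ..
  also have "\<dots> = (\<integral>p. F (a + c *\<^sub>R fst p + d *\<^sub>R snd p) \<partial>(?G \<Otimes>\<^sub>M ?G))"
    by (subst integral_distr[OF T]) (use e in \<open>simp_all add: case_prod_beta scaleR_add_right add.assoc\<close>)
  also have "\<dots> = (\<integral>p. \<integral>q. F (a + c *\<^sub>R p + d *\<^sub>R q) \<partial>?G \<partial>?G)"
    by (subst GG.integral_fst'[symmetric]) (auto intro!: GG.P.integrable_const_bound[where B=B] bd)
  finally show ?thesis .
qed

text \<open>The class over which the iteration runs: \<open>L\<close> bounds the increments, and the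
  strip keeps all conditional means in a compact square where the second derivatives of
  \<open>J\<close> are continuous.\<close>

definition lipschitz_band :: "real \<Rightarrow> real \<Rightarrow> (real^'n \<Rightarrow> real) \<Rightarrow> bool" where
  "lipschitz_band L \<epsilon> f \<longleftrightarrow> L-lipschitz_on UNIV f \<and> (\<forall>x. f x \<in> {\<epsilon>..1-\<epsilon>})"

lemma lipschitz_bandD:
  assumes "lipschitz_band L \<epsilon> f"
  shows "0 \<le> L" "\<bar>f x - f y\<bar> \<le> L * norm (x - y)" "f x \<in> {\<epsilon>..1-\<epsilon>}" "continuous_on A f" "f \<in> borel_measurable borel"
proof -
  have "continuous_on UNIV f"
    using assms lipschitz_on_continuous_on unfolding lipschitz_band_def by blast
  thus "continuous_on A f" "f \<in> borel_measurable borel"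
    by (auto intro: continuous_on_subset borel_measurable_continuous_onI)
  show "0 \<le> L" "f x \<in> {\<epsilon>..1-\<epsilon>}" using assms lipschitz_on_nonneg unfolding lipschitz_band_def by blast+
  show "\<bar>f x - f y\<bar> \<le> L * norm (x - y)"
    using lipschitz_onD[of L UNIV f x y] assms unfolding lipschitz_band_def by (simp add: dist_norm)
qed

lemma measurable_shift_scale [measurable]:
  fixes f :: "'a::euclidean_space \<Rightarrow> real"
  assumes [measurable]: "f \<in> borel_measurable borel"
  shows "(\<lambda>z. f (x + r *\<^sub>R z)) \<in> borel_measurable borel"
  by measurable

lemma integrable_shift_scale:
  assumes "lipschitz_band L \<epsilon> f" "0 \<le> \<epsilon>"
  shows "integrable std_gaussian (\<lambda>z. f (x + r *\<^sub>R z))"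
proof -
  interpret prob_space "std_gaussian :: (real^'a) measure" by (rule prob_space_std_gaussian)
  note [measurable] = lipschitz_bandD(5)[OF assms(1)]
  have "\<bar>f z\<bar> \<le> 1" for z using lipschitz_bandD(3)[OF assms(1), of z] assms(2) by auto
  thus ?thesis by (intro integrable_const_bound[where B=1]) auto
qed

text \<open>Both requirements pass to averages of translates with unchanged constants, so a step
  size chosen from \<open>L\<close> and \<open>\<epsilon>\<close> serves every stage of the
  iteration.\<close>

lemma lipschitz_band_Ornstein_Uhlenbeck:
  assumes f: "lipschitz_band L \<epsilon> f" and \<epsilon>: "0 \<le> \<epsilon>"
  shows "lipschitz_band L \<epsilon> (\<lambda>x. \<integral>z. f (x + r *\<^sub>R z) \<partial>std_gaussian)"
  unfolding lipschitz_band_def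
proof (intro conjI allI lipschitz_onI)
  let ?G = "std_gaussian :: (real^'a) measure"
  interpret G: prob_space ?G by (rule prob_space_std_gaussian)
  have [simp]: "measure ?G UNIV = 1" using G.prob_space by simp
  note i = integrable_shift_scale[OF f \<epsilon>]
  show "0 \<le> L" by (rule lipschitz_bandD[OF f])
  fix x y
  have "\<bar>(\<integral>z. f (x + r *\<^sub>R z) \<partial>?G) - (\<integral>z. f (y + r *\<^sub>R z) \<partial>?G)\<bar> = \<bar>\<integral>z. f (x + r *\<^sub>R z) - f (y + r *\<^sub>R z) \<partial>?G\<bar>"
    using i by simp
  also have "\<dots> \<le> L * norm (x - y)"
  proof (rule G.abs_integral_le_bound)
    show "\<bar>f (x + r *\<^sub>R z) - f (y + r *\<^sub>R z)\<bar> \<le> L * norm (x - y)" for z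
      using lipschitz_bandD(2)[OF f, of "x + r *\<^sub>R z" "y + r *\<^sub>R z"] by simp
  qed
  finally show "dist (\<integral>z. f (x + r *\<^sub>R z) \<partial>?G) (\<integral>z. f (y + r *\<^sub>R z) \<partial>?G) \<le> L * dist x y"
    by (simp add: dist_norm)
  have "(\<integral>z. \<epsilon> \<partial>?G) \<le> (\<integral>z. f (x + r *\<^sub>R z) \<partial>?G)" "(\<integral>z. f (x + r *\<^sub>R z) \<partial>?G) \<le> (\<integral>z. 1 - \<epsilon> \<partial>?G)"
    using i lipschitz_bandD(3)[OF f] by (intro integral_mono; simp)+
  thus "(\<integral>z. f (x + r *\<^sub>R z) \<partial>?G) \<in> {\<epsilon>..1-\<epsilon>}" by simp
qed

text \<open>One step of length \<open>r\<close> of the martingales \<open>E[f(X) | .]\<close> and \<open>E[g(Y) | .]\<close>: the first order term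
  vanishes and the second order term is nonpositive because the increments are \<open>\<rho>\<close>-correlated at most.\<close>

lemma gauss_J_one_step:
  assumes \<rho>: "0 < \<rho>" "\<rho> < 1" and \<epsilon>: "0 < \<epsilon>" and \<delta>: "0 < \<delta>" and L: "0 \<le> L"
  shows "\<exists>r0>0. \<forall>r. 0 < r \<longrightarrow> r < r0 \<longrightarrow> (\<forall>f g. lipschitz_band L \<epsilon> f \<longrightarrow> lipschitz_band L \<epsilon> g \<longrightarrow> (\<forall>x y :: real^'n.
    (\<integral>p. gauss_J (f (x + r *\<^sub>R fst p)) (g (y + r *\<^sub>R snd p)) \<rho> \<partial>gauss_pair \<rho>) \<le> 
    gauss_J (\<integral>z. f (x + r *\<^sub>R z) \<partial>std_gaussian) (\<integral>z. g (y + r *\<^sub>R z) \<partial>std_gaussian) \<rho> + \<delta> * r\<^sup>2))"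
proof -
  let ?G = "std_gaussian :: (real^'n) measure"
  let ?M = "gauss_pair \<rho> :: ((real^'n) \<times> (real^'n)) measure"
  interpret G: prob_space ?G by (rule prob_space_std_gaussian)
  have \<rho>1: "-1 < \<rho>" using \<rho> by simp
  interpret M: prob_space ?M by (rule prob_space_gauss_pair[OF \<rho>1 \<rho>(2)])
  have sM: "sets ?M = sets borel" by (rule sets_gauss_pair[OF \<rho>1 \<rho>(2)])
  note sM[measurable_cong]
  have [simp]: "measure ?G UNIV = 1" using G.prob_space by simp
  have [simp]: "space ?M = UNIV" using sets_eq_imp_space_eq[OF sM] by simp
  have [simp]: "measure ?M UNIV = 1" using M.prob_space by simp
  have [measurable]: "fst \<in> borel_measurable ?M" "snd \<in> borel_measurable ?M"
    by (intro measurable_gauss_pair[OF \<rho>1 \<rho>(2)] borel_measurable_continuous_onI continuous_intros)+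
  note marg = integral_fst_gauss_pair[OF \<rho>1 \<rho>(2)]
  define \<mu> where "\<mu> = (\<integral>x. norm x \<partial>?G)"
  have \<mu>: "integrable ?G norm" "0 \<le> \<mu>" using integrable_norm_power_std_gaussian[of 1] by (simp_all add: \<mu>_def)
  \<comment> \<open>The profile of an increment: comparing a value at noise \<open>z\<close> with
    the mean over an independent \<open>z'\<close> costs \<open>L * r * (norm z + norm z')\<close>,
    and integrating over \<open>z'\<close> produces \<open>\<mu>\<close>.\<close>
  define a where "a = (\<lambda>z::real^'n. norm z + \<mu>)"
  have a0: "0 \<le> a z" for z using \<mu> by (simp add: a_def)
  have a_meas[measurable]: "a \<in> borel_measurable borel" unfolding a_def by measurable
  have ai: "integrable ?G (\<lambda>z. (a z)\<^sup>2)" "integrable ?G (\<lambda>z. (a z) ^ 3)"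
  proof -
    have "(\<lambda>z. (a z)\<^sup>2) = (\<lambda>z. norm z ^ 2 + 2 * \<mu> * norm z + \<mu>\<^sup>2)" 
      "(\<lambda>z. (a z)^3) = (\<lambda>z. norm z ^ 3 + 3 * \<mu> * norm z ^ 2 + 3 * \<mu>\<^sup>2 * norm z + \<mu> ^ 3)"
      by (auto simp: a_def power2_eq_square power3_eq_cube algebra_simps)
    moreover have "integrable ?G (\<lambda>z. norm z ^ k)" for k by (rule integrable_norm_power_std_gaussian)
    ultimately show "integrable ?G (\<lambda>z. (a z)\<^sup>2)" "integrable ?G (\<lambda>z. (a z) ^ 3)"
      using \<mu>(1) by simp_all
  qed
  have aiM: "integrable ?M (\<lambda>p. (a (fst p))\<^sup>2)" "integrable ?M (\<lambda>p. (a (snd p))\<^sup>2)"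
    "integrable ?M (\<lambda>p. (a (fst p)) ^ 3)" "integrable ?M (\<lambda>p. (a (snd p)) ^ 3)"
    using ai marg(3,4)[of "\<lambda>z. (a z)\<^sup>2"] marg(3,4)[of "\<lambda>z. (a z) ^ 3"] by simp_all
  define c2 c3 where "c2 = (\<integral>z. (a z)\<^sup>2 \<partial>?G)" and "c3 = (\<integral>z. (a z) ^ 3 \<partial>?G)"
  have c: "0 \<le> c2" "0 \<le> c3" unfolding c2_def c3_def using a0 by simp_all
  \<comment> \<open>Calibrated so that the quadratic part of the remainder is at most half of
    \<open>\<delta> * r\<^sup>2\<close>; the added 1 keeps the denominator positive.\<close>
  define \<eta> where "\<eta> = \<delta> / (2 * (2 * L\<^sup>2 * c2 + 1))"
  have A: "0 \<le> 2 * L\<^sup>2 * c2" using c by simp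
  have \<eta>: "0 < \<eta>" "\<eta> * (2 * L\<^sup>2 * c2) \<le> \<delta> / 2"
  proof -
    have "0 < 2 * L\<^sup>2 * c2 + 1" using A by linarith
    thus "0 < \<eta>" unfolding \<eta>_def using \<delta> by (intro divide_pos_pos mult_pos_pos) simp_all
    have "\<eta> * (2 * L\<^sup>2 * c2) \<le> \<eta> * (2 * L\<^sup>2 * c2 + 1)" using \<open>0 < \<eta>\<close> by simp
    also have "\<dots> = \<delta> / 2" unfolding \<eta>_def using A by (simp add: field_simps)
    finally show "\<eta> * (2 * L\<^sup>2 * c2) \<le> \<delta> / 2" .
  qed
  obtain K where K: "0 \<le> K" "\<And>m n u v. m \<in> {\<epsilon>..1-\<epsilon>} \<Longrightarrow> n \<in> {\<epsilon>..1-\<epsilon>} \<Longrightarrow> m + u \<in> {\<epsilon>..1-\<epsilon>} \<Longrightarrow> n + v \<in> {\<epsilon>..1-\<epsilon>} \<Longrightarrow>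
     gauss_J (m + u) (n + v) \<rho> \<le> gauss_J m n \<rho> + (gauss_J1 \<rho> m n * u + gauss_J1 \<rho> n m * v) +
       (gauss_J11 \<rho> m n * u\<^sup>2 + 2 * gauss_J12 \<rho> m n * (u * v) + gauss_J11 \<rho> n m * v\<^sup>2) / 2
       + (\<eta> + K * (\<bar>u\<bar> + \<bar>v\<bar>)) * (u\<^sup>2 + v\<^sup>2)"
    using gauss_J_second_order[OF \<rho>1 \<rho>(2) \<epsilon> \<eta>(1)] by blast
  \<comment> \<open>The coefficient of the cubic part after integration:
    \<open>2 * K * L ^ 3\<close> times \<open>c3\<close> from each coordinate. Having an extra
    factor \<open>r\<close>, this part fits into the other half once \<open>r < r0\<close>.\<close>
  define D where "D = 4 * K * L ^ 3 * c3"
  have D: "0 \<le> D" using K c L by (simp add: D_def)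
  define r0 where "r0 = \<delta> / (2 * (D + 1))"
  have r0: "0 < r0" using D \<delta> by (simp add: r0_def)
  have rD: "D * r \<le> \<delta> / 2" if "0 < r" "r < r0" for r
  proof -
    have "D * r \<le> (D + 1) * r0" using that D by (intro mult_mono) auto
    also have "\<dots> = \<delta> / 2" using D by (simp add: r0_def field_simps)
    finally show ?thesis .
  qed
  have "(\<integral>p. gauss_J (f (x + r *\<^sub>R fst p)) (g (y + r *\<^sub>R snd p)) \<rho> \<partial>?M) \<le> 
    gauss_J (\<integral>z. f (x + r *\<^sub>R z) \<partial>?G) (\<integral>z. g (y + r *\<^sub>R z) \<partial>?G) \<rho> + \<delta> * r\<^sup>2"
    if r: "0 < r" "r < r0" and f: "lipschitz_band L \<epsilon> f" and g: "lipschitz_band L \<epsilon> g" for r f g and x y :: "real^'n"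
  proof -
    note [measurable] = lipschitz_bandD(5)[OF f] lipschitz_bandD(5)[OF g]
    define m n where "m = (\<integral>z. f (x + r *\<^sub>R z) \<partial>?G)" and "n = (\<integral>z. g (y + r *\<^sub>R z) \<partial>?G)"
    have mn: "m \<in> {\<epsilon>..1-\<epsilon>}" "n \<in> {\<epsilon>..1-\<epsilon>}"
      unfolding m_def n_def using lipschitz_band_Ornstein_Uhlenbeck[OF f] lipschitz_band_Ornstein_Uhlenbeck[OF g] \<epsilon> lipschitz_bandD(3)
      by (metis less_imp_le)+
    define U V where "U = (\<lambda>z. f (x + r *\<^sub>R z) - m)" and "V = (\<lambda>z. g (y + r *\<^sub>R z) - n)"
    have UV_meas[measurable]: "U \<in> borel_measurable borel" "V \<in> borel_measurable borel"
      unfolding U_def V_def by measurable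
    have inc: "\<bar>h (x + r *\<^sub>R z) - (\<integral>z. h (x + r *\<^sub>R z) \<partial>?G)\<bar> \<le> L * r * a z" if h: "lipschitz_band L \<epsilon> h" for h x z
    proof -
      have i: "integrable ?G (\<lambda>z. h (x + r *\<^sub>R z))" using integrable_shift_scale[OF h] \<epsilon> by simp
      have "\<bar>h (x + r *\<^sub>R z) - (\<integral>z. h (x + r *\<^sub>R z) \<partial>?G)\<bar> = \<bar>\<integral>z'. h (x + r *\<^sub>R z) - h (x + r *\<^sub>R z') \<partial>?G\<bar>"
        using i by simp
      also have "\<dots> \<le> (\<integral>z'. \<bar>h (x + r *\<^sub>R z) - h (x + r *\<^sub>R z')\<bar> \<partial>?G)" by (rule integral_abs_bound)
      also have "\<dots> \<le> (\<integral>z'. L * r * (norm z + norm z') \<partial>?G)"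
      proof (rule integral_mono)
        fix z' :: "real^'n"
        have "\<bar>h (x + r *\<^sub>R z) - h (x + r *\<^sub>R z')\<bar> \<le> L * norm ((x + r *\<^sub>R z) - (x + r *\<^sub>R z'))"
          by (rule lipschitz_bandD[OF h])
        also have "(x + r *\<^sub>R z) - (x + r *\<^sub>R z') = r *\<^sub>R (z - z')" by (simp add: algebra_simps)
        also have "L * norm (r *\<^sub>R (z - z')) \<le> L * (r * (norm z + norm z'))"
          using L r norm_triangle_ineq4[of z z'] by (simp add: mult_left_mono)
        finally show "\<bar>h (x + r *\<^sub>R z) - h (x + r *\<^sub>R z')\<bar> \<le> L * r * (norm z + norm z')" by (simp add: mult.assoc)
      qed (use i \<mu> in auto)
      also have "\<dots> = L * r * a z" using \<mu> by (simp add: \<mu>_def a_def)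
      finally show ?thesis .
    qed
    have Ub: "\<bar>U z\<bar> \<le> L * r * a z" and Vb: "\<bar>V z\<bar> \<le> L * r * a z" for z
      unfolding U_def V_def m_def n_def by (rule inc[OF f], rule inc[OF g])
    have mU: "m + U z \<in> {\<epsilon>..1-\<epsilon>}" and nV: "n + V z \<in> {\<epsilon>..1-\<epsilon>}" for z
      using lipschitz_bandD(3)[OF f] lipschitz_bandD(3)[OF g] unfolding U_def V_def by simp_all
    have U1: "\<bar>U z\<bar> \<le> 1" and V1: "\<bar>V z\<bar> \<le> 1" for z
      using mU[of z] nV[of z] mn \<epsilon> by auto
    have UVi: "integrable ?M (\<lambda>p. U (fst p))" "integrable ?M (\<lambda>p. V (snd p))"
      by (rule M.integrable_const_bound[where B=1]; simp add: U1 V1)+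
    have UV2i: "integrable ?M (\<lambda>p. (U (fst p))\<^sup>2)" "integrable ?M (\<lambda>p. (V (snd p))\<^sup>2)" "integrable ?M (\<lambda>p. U (fst p) * V (snd p))"
      unfolding power2_eq_square
      by (rule M.integrable_mult_bounded[OF _ _ U1 U1] M.integrable_mult_bounded[OF _ _ V1 V1] M.integrable_mult_bounded[OF _ _ U1 V1]; simp)+
    have mean: "(\<integral>z. U z \<partial>?G) = 0" "(\<integral>z. V z \<partial>?G) = 0"
      unfolding U_def V_def m_def n_def using integrable_shift_scale[OF f] integrable_shift_scale[OF g] \<epsilon> by simp_all
    have lipUV: "\<bar>U z - U z'\<bar> \<le> (L * r) * norm (z - z')" "\<bar>V z - V z'\<bar> \<le> (L * r) * norm (z - z')" for z z'
    proof -
      have e: "norm ((w + r *\<^sub>R z) - (w + r *\<^sub>R z')) = r * norm (z - z')" for w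
        using r by (simp add: scaleR_diff_right[symmetric])
      show "\<bar>U z - U z'\<bar> \<le> (L * r) * norm (z - z')" "\<bar>V z - V z'\<bar> \<le> (L * r) * norm (z - z')"
        using lipschitz_bandD(2)[OF f, of "x + r *\<^sub>R z" "x + r *\<^sub>R z'"] lipschitz_bandD(2)[OF g, of "y + r *\<^sub>R z" "y + r *\<^sub>R z'"]
        unfolding e U_def V_def by simp_all
    qed
    let ?A = "\<integral>z. (U z)\<^sup>2 \<partial>?G" and ?B = "\<integral>z. (V z)\<^sup>2 \<partial>?G" and ?C = "\<integral>p. U (fst p) * V (snd p) \<partial>?M"
    have corr: "?C \<le> \<rho> * (sqrt ?A * sqrt ?B)"
      by (rule gauss_pair_correlation_le[OF \<rho> UV_meas(1) U1 lipUV(1) mean(1) UV_meas(2) V1 lipUV(2) mean(2)])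
    have quad: "gauss_J11 \<rho> m n * ?A + 2 * gauss_J12 \<rho> m n * ?C + gauss_J11 \<rho> n m * ?B \<le> 0"
      by (rule gauss_J_quadratic_form_nonpos[OF \<rho>1 \<rho>(2) \<rho>(1) _ _ corr]) simp_all
    \<comment> \<open>The Taylor bound with its remainder replaced by a sum of functions of one
      coordinate each. Apart from the product of \<open>U\<close> and \<open>V\<close>, its integral
      is then determined by the marginals.\<close>
    let ?R = "\<lambda>p. gauss_J m n \<rho> + (gauss_J1 \<rho> m n * U (fst p) + gauss_J1 \<rho> n m * V (snd p)) +
       (gauss_J11 \<rho> m n * (U (fst p))\<^sup>2 + 2 * gauss_J12 \<rho> m n * (U (fst p) * V (snd p)) + gauss_J11 \<rho> n m * (V (snd p))\<^sup>2) / 2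
       + (\<eta> * L\<^sup>2 * r\<^sup>2 * ((a (fst p))\<^sup>2 + (a (snd p))\<^sup>2) + 2 * K * L ^ 3 * r ^ 3 * ((a (fst p)) ^ 3 + (a (snd p)) ^ 3))"
    have point: "gauss_J (m + U (fst p)) (n + V (snd p)) \<rho> \<le> ?R p" for p
    proof -
      let ?u = "U (fst p)" and ?v = "V (snd p)" and ?s = "a (fst p)" and ?t = "a (snd p)" and ?l = "L * r"
      have l: "0 \<le> ?l" using L r by simp
      have sq: "?u\<^sup>2 + ?v\<^sup>2 \<le> ?l\<^sup>2 * (?s\<^sup>2 + ?t\<^sup>2)"
        using power_mono[OF Ub abs_ge_zero, of "fst p" 2] power_mono[OF Vb abs_ge_zero, of "snd p" 2]
        by (simp add: power_mult_distrib distrib_left)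
      have "\<bar>?u\<bar> + \<bar>?v\<bar> \<le> ?l * (?s + ?t)" using Ub[of "fst p"] Vb[of "snd p"] by (simp add: distrib_left)
      hence "(\<bar>?u\<bar> + \<bar>?v\<bar>) * (?u\<^sup>2 + ?v\<^sup>2) \<le> (?l * (?s + ?t)) * (?l\<^sup>2 * (?s\<^sup>2 + ?t\<^sup>2))"
        using sq a0 l by (intro mult_mono) auto
      also have "\<dots> = ?l ^ 3 * ((?s + ?t) * (?s\<^sup>2 + ?t\<^sup>2))" by (simp add: power3_eq_cube power2_eq_square algebra_simps)
      also have "\<dots> \<le> ?l ^ 3 * (2 * (?s ^ 3 + ?t ^ 3))"
      proof (intro mult_left_mono)
        \<comment> \<open>The difference of the two sides of the next inequality is exactly this
          product; it separates the mixed cubic terms into pure third powers.\<close>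
        have "0 \<le> (?s + ?t) * (?s - ?t)\<^sup>2" using a0 by (intro mult_nonneg_nonneg add_nonneg_nonneg) auto
        thus "(?s + ?t) * (?s\<^sup>2 + ?t\<^sup>2) \<le> 2 * (?s ^ 3 + ?t ^ 3)"
          by (simp add: power3_eq_cube power2_eq_square algebra_simps)
      qed (use l in simp)
      finally have cub: "(\<bar>?u\<bar> + \<bar>?v\<bar>) * (?u\<^sup>2 + ?v\<^sup>2) \<le> ?l ^ 3 * (2 * (?s ^ 3 + ?t ^ 3))" .
      have "(\<eta> + K * (\<bar>?u\<bar> + \<bar>?v\<bar>)) * (?u\<^sup>2 + ?v\<^sup>2) = \<eta> * (?u\<^sup>2 + ?v\<^sup>2) + K * ((\<bar>?u\<bar> + \<bar>?v\<bar>) * (?u\<^sup>2 + ?v\<^sup>2))"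
        by (simp only: distrib_right mult.assoc)
      also have "\<dots> \<le> \<eta> * (?l\<^sup>2 * (?s\<^sup>2 + ?t\<^sup>2)) + K * (?l ^ 3 * (2 * (?s ^ 3 + ?t ^ 3)))"
        using sq cub \<eta> K by (intro add_mono mult_left_mono) auto
      also have "\<dots> = \<eta> * L\<^sup>2 * r\<^sup>2 * (?s\<^sup>2 + ?t\<^sup>2) + 2 * K * L ^ 3 * r ^ 3 * (?s ^ 3 + ?t ^ 3)"
        by (simp add: power_mult_distrib)
      finally show ?thesis using K(2)[OF mn mU nV, of "fst p" "snd p"] by linarith
    qed
    have Ri: "integrable ?M ?R"
      using UVi UV2i aiM by simp
    have "(\<integral>p. gauss_J (f (x + r *\<^sub>R fst p)) (g (y + r *\<^sub>R snd p)) \<rho> \<partial>?M) = (\<integral>p. gauss_J (m + U (fst p)) (n + V (snd p)) \<rho> \<partial>?M)"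
      by (simp add: U_def V_def)
    also have "\<dots> \<le> (\<integral>p. ?R p \<partial>?M)"
    proof (rule integral_mono[OF _ Ri point])
      show "integrable ?M (\<lambda>p. gauss_J (m + U (fst p)) (n + V (snd p)) \<rho>)"
      proof (rule M.integrable_const_bound[where B=1])
        have 01: "m + U (fst p) \<in> {0..1}" "n + V (snd p) \<in> {0..1}" for p :: "(real^'n) \<times> (real^'n)"
          using mU[of "fst p"] nV[of "snd p"] \<epsilon> by auto
        show "(\<lambda>p. gauss_J (m + U (fst p)) (n + V (snd p)) \<rho>) \<in> borel_measurable ?M"
          by (rule measurable_gauss_J[OF \<rho>1 \<rho>(2) _ _ 01]) measurable
        show "AE p in ?M. norm (gauss_J (m + U (fst p)) (n + V (snd p)) \<rho>) \<le> 1"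
          using gauss_J_bounds[OF \<rho>1 \<rho>(2)] by simp
      qed
    qed
    also have "(\<integral>p. ?R p \<partial>?M) = gauss_J m n \<rho> + (gauss_J11 \<rho> m n * ?A + 2 * gauss_J12 \<rho> m n * ?C + gauss_J11 \<rho> n m * ?B) / 2 +
      (\<eta> * L\<^sup>2 * r\<^sup>2 * (c2 + c2) + 2 * K * L ^ 3 * r ^ 3 * (c3 + c3))"
      using UVi UV2i aiM marg(1)[of U] marg(2)[of V] marg(1)[of "\<lambda>z. (U z)\<^sup>2"] marg(2)[of "\<lambda>z. (V z)\<^sup>2"] mean
        marg(1,2)[of "\<lambda>z. (a z)\<^sup>2"] marg(1,2)[of "\<lambda>z. (a z) ^ 3"]
      by (simp add: c2_def c3_def)
    finally have bound: "(\<integral>p. gauss_J (f (x + r *\<^sub>R fst p)) (g (y + r *\<^sub>R snd p)) \<rho> \<partial>?M) \<le> gauss_J m n \<rho> +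
      (gauss_J11 \<rho> m n * ?A + 2 * gauss_J12 \<rho> m n * ?C + gauss_J11 \<rho> n m * ?B) / 2 +
      (\<eta> * L\<^sup>2 * r\<^sup>2 * (c2 + c2) + 2 * K * L ^ 3 * r ^ 3 * (c3 + c3))" .
    have "\<eta> * L\<^sup>2 * r\<^sup>2 * (c2 + c2) + 2 * K * L ^ 3 * r ^ 3 * (c3 + c3) = (\<eta> * (2 * L\<^sup>2 * c2)) * r\<^sup>2 + (D * r) * r\<^sup>2"
      by (simp add: D_def power3_eq_cube power2_eq_square algebra_simps)
    also have "\<dots> \<le> (\<delta> / 2) * r\<^sup>2 + (\<delta> / 2) * r\<^sup>2"
      using \<eta>(2) rD[OF r] by (intro add_mono mult_right_mono) auto
    finally have tail: "\<eta> * L\<^sup>2 * r\<^sup>2 * (c2 + c2) + 2 * K * L ^ 3 * r ^ 3 * (c3 + c3) \<le> (\<delta> / 2) * r\<^sup>2 + (\<delta> / 2) * r\<^sup>2" .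
    note main = order_trans[OF bound add_left_mono[OF tail]]
    have "w \<le> j + d * s" if "w \<le> j + q / 2 + (d / 2 * s + d / 2 * s)" "q \<le> 0" for w j q d s :: real
      using that by simp
    from this[OF main quad] show ?thesis unfolding m_def n_def .
  qed
  thus ?thesis using r0 by blast
qed

text \<open>Noise of length \<open>sqrt (Suc k) * r\<close> splits into an outer part of length
  \<open>sqrt k * r\<close> and an inner part of length \<open>r\<close>. The inner part is one
  application of \<open>step\<close> and replaces \<open>f\<close> and \<open>g\<close> by their
  averages; the induction hypothesis then treats those, so it must range over the whole
  class.\<close>

lemma gauss_J_iterated_steps:
  fixes f g :: "real^'n \<Rightarrow> real"
  assumes \<rho>: "0 < \<rho>" "\<rho> < 1" and \<epsilon>: "0 < \<epsilon>" and r: "0 < r"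
    and step: "\<And>(f :: real^'n \<Rightarrow> real) (g :: real^'n \<Rightarrow> real) x y. lipschitz_band L \<epsilon> f \<Longrightarrow> lipschitz_band L \<epsilon> g \<Longrightarrow>
      (\<integral>p. gauss_J (f (x + r *\<^sub>R fst p)) (g (y + r *\<^sub>R snd p)) \<rho> \<partial>gauss_pair \<rho>) \<le> 
      gauss_J (\<integral>z. f (x + r *\<^sub>R z) \<partial>std_gaussian) (\<integral>z. g (y + r *\<^sub>R z) \<partial>std_gaussian) \<rho> + e"
    and f: "lipschitz_band L \<epsilon> f" and g: "lipschitz_band L \<epsilon> g"
  shows "(\<integral>p. gauss_J (f (x + (sqrt k * r) *\<^sub>R fst p)) (g (y + (sqrt k * r) *\<^sub>R snd p)) \<rho> \<partial>gauss_pair \<rho>) \<le> 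
      gauss_J (\<integral>z. f (x + (sqrt k * r) *\<^sub>R z) \<partial>std_gaussian) (\<integral>z. g (y + (sqrt k * r) *\<^sub>R z) \<partial>(std_gaussian :: (real^'n) measure)) \<rho> + real k * e"
  using f g
proof (induction k arbitrary: f g)
  let ?G = "std_gaussian :: (real^'n) measure"
  let ?M = "gauss_pair \<rho> :: ((real^'n) \<times> (real^'n)) measure"
  interpret G: prob_space ?G by (rule prob_space_std_gaussian)
  have \<rho>1: "-1 < \<rho>" using \<rho> by simp
  interpret M: prob_space ?M by (rule prob_space_gauss_pair[OF \<rho>1 \<rho>(2)])
  have sM: "sets ?M = sets borel" by (rule sets_gauss_pair[OF \<rho>1 \<rho>(2)])
  note sM[measurable_cong]
  have [simp]: "measure ?G UNIV = 1" using G.prob_space by simp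
  have [simp]: "space ?M = UNIV" using sets_eq_imp_space_eq[OF sM] by simp
  have [simp]: "measure ?M UNIV = 1" using M.prob_space by simp
  {
    case 0
    show ?case by simp
  next
    case (Suc k)
    define c d where "c = sqrt k * r" and "d = sqrt (Suc k) * r"
    have cd: "d\<^sup>2 = c\<^sup>2 + r\<^sup>2" "0 < d" using r by (simp_all add: c_def d_def power_mult_distrib algebra_simps)
    define P where "P = (\<lambda>f (x::real^'n). \<integral>z. f (x + r *\<^sub>R z) \<partial>?G :: real)"
    have P: "lipschitz_band L \<epsilon> (P h)" if "lipschitz_band L \<epsilon> h" for h
      unfolding P_def using lipschitz_band_Ornstein_Uhlenbeck[OF that] \<epsilon> by simp
    have b01: "h x \<in> {0..1}" if "lipschitz_band L \<epsilon> h" for h and x :: "real^'n"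
      using lipschitz_bandD(3)[OF that, of x] \<epsilon> by auto
    have meas: "(\<lambda>p. gauss_J (h1 (fst p)) (h2 (snd p)) \<rho>) \<in> borel_measurable borel"
      if "lipschitz_band L \<epsilon> h1" "lipschitz_band L \<epsilon> h2" for h1 h2 :: "real^'n \<Rightarrow> real"
    proof (rule measurable_gauss_J[OF \<rho>1 \<rho>(2) _ _ b01[OF that(1)] b01[OF that(2)]])
      note [measurable] = lipschitz_bandD(5)[OF that(1)] lipschitz_bandD(5)[OF that(2)]
      show "(\<lambda>p::(real^'n) \<times> (real^'n). h1 (fst p)) \<in> borel_measurable borel" "(\<lambda>p::(real^'n) \<times> (real^'n). h2 (snd p)) \<in> borel_measurable borel"
        unfolding borel_prod[symmetric] by measurable
    qed
    have bd: "\<bar>gauss_J s t \<rho>\<bar> \<le> 1" for s t using gauss_J_bounds[OF \<rho>1 \<rho>(2)] by simp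
    \<comment> \<open>The semigroup identity for a single function, read off from the pair law by
      letting the integrand depend on the first coordinate only; the base point
      \<open>(w, w)\<close> merely fills both slots.\<close>
    have mean: "(\<integral>z. h (w + d *\<^sub>R z) \<partial>?G) = (\<integral>z. P h (w + c *\<^sub>R z) \<partial>?G)" if h: "lipschitz_band L \<epsilon> h" for h w
    proof -
      note [measurable] = lipschitz_bandD(5)[OF h] lipschitz_bandD(5)[OF P[OF h]]
      note marg = integral_fst_gauss_pair(1)[OF \<rho>1 \<rho>(2) measurable_shift_scale]
      have "(\<integral>z. h (w + d *\<^sub>R z) \<partial>?G) = (\<integral>p. h (fst ((w, w) + d *\<^sub>R p)) \<partial>?M)"
        by (simp add: marg)
      also have "\<dots> = (\<integral>p. \<integral>q. h (fst ((w, w) + c *\<^sub>R p + r *\<^sub>R q)) \<partial>?M \<partial>?M)"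
        by (rule integral_gauss_pair_semigroup[OF \<rho>1 \<rho>(2) _ _ cd, where B=1])
           (use b01[OF h] in \<open>auto simp: borel_prod[symmetric]\<close>)
      also have "\<dots> = (\<integral>p. P h (w + c *\<^sub>R fst p) \<partial>?M)"
        by (simp add: P_def marg)
      also have "\<dots> = (\<integral>z. P h (w + c *\<^sub>R z) \<partial>?G)"
        by (simp add: marg)
      finally show ?thesis .
    qed
    have "(\<integral>p. gauss_J (f (x + d *\<^sub>R fst p)) (g (y + d *\<^sub>R snd p)) \<rho> \<partial>?M)
       = (\<integral>p. (\<lambda>p. gauss_J (f (fst p)) (g (snd p)) \<rho>) ((x, y) + d *\<^sub>R p) \<partial>?M)" by simp
    also have "\<dots> = (\<integral>p. \<integral>q. (\<lambda>p. gauss_J (f (fst p)) (g (snd p)) \<rho>) ((x, y) + c *\<^sub>R p + r *\<^sub>R q) \<partial>?M \<partial>?M)"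
      by (rule integral_gauss_pair_semigroup[OF \<rho>1 \<rho>(2) meas[OF Suc.prems] bd cd])
    also have "\<dots> = (\<integral>p. \<integral>q. gauss_J (f ((x + c *\<^sub>R fst p) + r *\<^sub>R fst q)) (g ((y + c *\<^sub>R snd p) + r *\<^sub>R snd q)) \<rho> \<partial>?M \<partial>?M)"
      by simp
    \<comment> \<open>The outer noise \<open>p\<close> is frozen and enters as a shift of the base
      points, which is why \<open>step\<close> is assumed for all \<open>x\<close> and
      \<open>y\<close>.\<close>
    also have "\<dots> \<le> (\<integral>p. gauss_J (P f (x + c *\<^sub>R fst p)) (P g (y + c *\<^sub>R snd p)) \<rho> + e \<partial>?M)"
    proof (rule integral_mono)
      show "(\<integral>q. gauss_J (f ((x + c *\<^sub>R fst p) + r *\<^sub>R fst q)) (g ((y + c *\<^sub>R snd p) + r *\<^sub>R snd q)) \<rho> \<partial>?M)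
        \<le> gauss_J (P f (x + c *\<^sub>R fst p)) (P g (y + c *\<^sub>R snd p)) \<rho> + e" for p
        unfolding P_def by (rule step[OF Suc.prems])
      note [measurable] = meas[OF Suc.prems] meas[OF P[OF Suc.prems(1)] P[OF Suc.prems(2)]]
      have "(\<lambda>p. (\<lambda>p. gauss_J (P f (fst p)) (P g (snd p)) \<rho>) ((x, y) + c *\<^sub>R p)) \<in> borel_measurable ?M"
        by measurable
      hence "integrable ?M (\<lambda>p. gauss_J (P f (x + c *\<^sub>R fst p)) (P g (y + c *\<^sub>R snd p)) \<rho>)"
        using bd by (intro M.integrable_const_bound[where B=1]) auto
      thus "integrable ?M (\<lambda>p. gauss_J (P f (x + c *\<^sub>R fst p)) (P g (y + c *\<^sub>R snd p)) \<rho> + e)"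
        by simp
      have "(\<lambda>p. \<integral>q. (\<lambda>p. gauss_J (f (fst p)) (g (snd p)) \<rho>) ((x, y) + c *\<^sub>R p + r *\<^sub>R q) \<partial>?M) \<in> borel_measurable ?M"
        by measurable
      thus "integrable ?M (\<lambda>p. \<integral>q. gauss_J (f ((x + c *\<^sub>R fst p) + r *\<^sub>R fst q)) (g ((y + c *\<^sub>R snd p) + r *\<^sub>R snd q)) \<rho> \<partial>?M)"
        using M.abs_integral_le_bound[OF bd] by (intro M.integrable_const_bound[where B=1]) auto
    qed
    also have "\<dots> = (\<integral>p. gauss_J (P f (x + c *\<^sub>R fst p)) (P g (y + c *\<^sub>R snd p)) \<rho> \<partial>?M) + e"
    proof -
      note [measurable] = meas[OF P[OF Suc.prems(1)] P[OF Suc.prems(2)]]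
      have "(\<lambda>p. (\<lambda>p. gauss_J (P f (fst p)) (P g (snd p)) \<rho>) ((x, y) + c *\<^sub>R p)) \<in> borel_measurable ?M"
        by measurable
      hence "integrable ?M (\<lambda>p. gauss_J (P f (x + c *\<^sub>R fst p)) (P g (y + c *\<^sub>R snd p)) \<rho>)"
        using bd by (intro M.integrable_const_bound[where B=1]) auto
      thus ?thesis by simp
    qed
    also have "\<dots> \<le> gauss_J (\<integral>z. P f (x + c *\<^sub>R z) \<partial>?G) (\<integral>z. P g (y + c *\<^sub>R z) \<partial>?G) \<rho> + real k * e + e"
      using Suc.IH[OF P[OF Suc.prems(1)] P[OF Suc.prems(2)], folded c_def] by simp
    finally show ?case
      unfolding mean[OF Suc.prems(1), symmetric] mean[OF Suc.prems(2), symmetric] d_def[symmetric]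
      by (simp add: algebra_simps)
  }
qed

lemma gauss_J_le_lipschitz_band:
  fixes f g :: "real^'n \<Rightarrow> real"
  assumes \<rho>: "0 < \<rho>" "\<rho> < 1" and \<epsilon>: "0 < \<epsilon>" and f: "lipschitz_band L \<epsilon> f" and g: "lipschitz_band L \<epsilon> g"
  shows "(\<integral>p. gauss_J (f (fst p)) (g (snd p)) \<rho> \<partial>gauss_pair \<rho>) \<le> gauss_J (\<integral>x. f x \<partial>std_gaussian) (\<integral>x. g x \<partial>std_gaussian) \<rho>"
proof (rule field_le_epsilon)
  fix \<delta> :: real assume "0 < \<delta>"
  obtain r0 where r0: "0 < r0" and
    step: "\<forall>r. 0 < r \<longrightarrow> r < r0 \<longrightarrow> (\<forall>f g. lipschitz_band L \<epsilon> f \<longrightarrow> lipschitz_band L \<epsilon> g \<longrightarrow> (\<forall>x y :: real^'n.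
    (\<integral>p. gauss_J (f (x + r *\<^sub>R fst p)) (g (y + r *\<^sub>R snd p)) \<rho> \<partial>gauss_pair \<rho>) \<le> 
    gauss_J (\<integral>z. f (x + r *\<^sub>R z) \<partial>std_gaussian) (\<integral>z. g (y + r *\<^sub>R z) \<partial>std_gaussian) \<rho> + \<delta> * r\<^sup>2))"
    using gauss_J_one_step[OF \<rho> \<epsilon> \<open>0 < \<delta>\<close> lipschitz_bandD(1)[OF f]] by (elim exE conjE) (rule that)
  obtain N :: nat where N: "1 / r0\<^sup>2 < real N" using reals_Archimedean2 by blast
  \<comment> \<open>\<open>N\<close> steps of this length add up to noise of length 1, and
    \<open>N\<close> errors of size \<open>\<delta> * r\<^sup>2\<close> add up to
    \<open>\<delta>\<close>; the choice of \<open>N\<close> puts \<open>r\<close> below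
    \<open>r0\<close>.\<close>
  define r where "r = 1 / sqrt (real N)"
  have "0 < 1 / r0\<^sup>2" using r0 by simp
  hence N0: "0 < real N" using N by linarith
  have r: "0 < r" "r < r0" "sqrt (real N) * r = 1" "r\<^sup>2 = 1 / real N"
  proof -
    show "0 < r" "sqrt (real N) * r = 1" "r\<^sup>2 = 1 / real N" using N0 by (simp_all add: r_def power_divide)
    have "1 / real N < r0\<^sup>2" using N N0 r0 by (simp add: divide_simps mult.commute)
    hence "r\<^sup>2 < r0\<^sup>2" using \<open>r\<^sup>2 = 1 / real N\<close> by simp
    thus "r < r0" using r0 by (intro power_less_imp_less_base[of r 2 r0]) auto
  qed
  have steps: "real N * (\<delta> * r\<^sup>2) = \<delta>" using N0 by (simp add: r(4))
  show "(\<integral>p. gauss_J (f (fst p)) (g (snd p)) \<rho> \<partial>gauss_pair \<rho>) \<le> gauss_J (\<integral>x. f x \<partial>std_gaussian) (\<integral>x. g x \<partial>std_gaussian) \<rho> + \<delta>"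
    using gauss_J_iterated_steps[OF \<rho> \<epsilon> r(1) step[rule_format, OF r(1,2)] f g, where x=0 and y=0 and k=N]
    unfolding steps r(3) scaleR_one add_0 .
qed

section \<open>Measurable functions\<close>

text \<open>The approximants are the infimal convolutions of \<open>f\<close> with
  \<open>real k * dist\<close>. In the infimum at \<open>x\<close>, far points are excluded by the
  penalty once it exceeds the range of \<open>f\<close>, and near points are harmless by
  continuity.\<close>

lemma lipschitz_minorants:
  fixes f :: "'a::metric_space \<Rightarrow> real"
  assumes cont: "continuous_on UNIV f" and f: "\<And>x. f x \<in> {0..1}"
  shows "\<exists>h. (\<forall>k. (real k)-lipschitz_on UNIV (h k)) \<and> (\<forall>x. (\<lambda>k. h k x) \<longlonglongrightarrow> f x)"
proof -
  define h where "h = (\<lambda>(k::nat) x. INF y. f y + real k * dist x y)"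
  have nn: "0 \<le> f y + real k * dist x y" for k x y using f[of y] by simp
  have bdd: "bdd_below (range (\<lambda>y. f y + real k * dist x y))" for k x
    using nn by (intro bdd_belowI[of _ 0]) auto
  have le: "h k x \<le> f y + real k * dist x y" for k x y
    unfolding h_def by (rule cINF_lower[OF bdd]) simp
  have ge: "c \<le> h k x" if "\<And>y. c \<le> f y + real k * dist x y" for c k x
    unfolding h_def by (rule cINF_greatest) (use that in auto)
  have upper: "h k x \<le> f x" for k x using le[of k x x] by simp
  have lip: "h k x \<le> h k y + real k * dist x y" for k x y
  proof -
    have "h k x - real k * dist x y \<le> h k y"
    proof (rule ge)
      fix z
      have "h k x \<le> f z + real k * dist x z" by (rule le)
      also have "\<dots> \<le> f z + real k * (dist x y + dist y z)"
        by (intro add_left_mono mult_left_mono dist_triangle) simp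
      finally show "h k x - real k * dist x y \<le> f z + real k * dist y z" by (simp add: algebra_simps)
    qed
    thus ?thesis by simp
  qed
  have h_lip: "(real k)-lipschitz_on UNIV (h k)" for k
  proof (rule lipschitz_onI)
    fix x y
    show "dist (h k x) (h k y) \<le> real k * dist x y"
      using lip[of k x y] lip[of k y x] by (simp add: dist_real_def dist_commute abs_le_iff)
  qed simp
  have h_lim: "(\<lambda>k. h k x) \<longlonglongrightarrow> f x" for x
  proof (rule LIMSEQ_I)
    fix e :: real assume e: "0 < e"
    obtain d where d: "0 < d" "\<And>y. dist y x < d \<Longrightarrow> dist (f y) (f x) < e / 2"
      using cont[unfolded continuous_on_iff, rule_format, of x "e / 2"] e by auto
    obtain N :: nat where N: "1 / d < real N" using reals_Archimedean2 by blast
    have "norm (h k x - f x) < e" if k: "N \<le> k" for k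
    proof -
      have "f x - e / 2 \<le> h k x"
      proof (rule ge)
        fix y
        show "f x - e / 2 \<le> f y + real k * dist x y"
        proof (cases "dist y x < d")
          case True
          moreover have "0 \<le> real k * dist x y" by simp
          ultimately show ?thesis using d(2)[of y] e unfolding dist_real_def by linarith
        next
          case False
          \<comment> \<open>With \<open>k\<close> above \<open>1 / d\<close>, leaving the ball of
            radius \<open>d\<close> costs at least 1, hence at least \<open>f x\<close>.\<close>
          have "1 / d * d \<le> real k * dist x y"
            using False N k d(1) by (intro mult_mono) (auto simp: dist_commute)
          hence "1 \<le> real k * dist x y" using d(1) by simp
          moreover have "f x \<le> 1" "0 \<le> f y" using f[of x] f[of y] by auto
          ultimately show ?thesis using e by linarith
        qed
      qed
      thus ?thesis using upper[of k x] e by simp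
    qed
    thus "\<exists>N. \<forall>k\<ge>N. norm (h k x - f x) < e" by blast
  qed
  show ?thesis using h_lip h_lim by blast
qed

lemma gauss_J_tendsto:
  assumes \<rho>: "-1 < \<rho>" "\<rho> < 1" and "x \<longlonglongrightarrow> a" "y \<longlonglongrightarrow> b" and "\<And>k. x k \<in> {0..1}" "\<And>k. y k \<in> {0..1}" "a \<in> {0..1}" "b \<in> {0..1}"
  shows "(\<lambda>k. gauss_J (x k) (y k) \<rho>) \<longlonglongrightarrow> gauss_J a b \<rho>"
proof -
  have "(\<lambda>k. (\<lambda>(x, y). gauss_J x y \<rho>) (x k, y k)) \<longlonglongrightarrow> (\<lambda>(x, y). gauss_J x y \<rho>) (a, b)"
    by (rule continuous_on_tendsto_compose[OF continuous_on_gauss_J[OF \<rho>]]) (use assms in \<open>auto intro: tendsto_Pair\<close>)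
  thus ?thesis by simp
qed

lemma mean_in_unit_interval:
  fixes f :: "real^'n \<Rightarrow> real"
  assumes "f \<in> borel_measurable borel" and f: "\<And>x. f x \<in> {0..1}"
  shows "(\<integral>x. f x \<partial>std_gaussian) \<in> {0..1}" "integrable std_gaussian f"
proof -
  interpret prob_space "std_gaussian :: (real^'n) measure" by (rule prob_space_std_gaussian)
  show "integrable std_gaussian f"
    by (rule integrable_const_bound[where B=1]) (use assms in auto)
  have "0 \<le> (\<integral>x. f x \<partial>std_gaussian)" using f by (intro Bochner_Integration.integral_nonneg) auto
  moreover have "\<bar>\<integral>x. f x \<partial>std_gaussian\<bar> \<le> 1" by (rule abs_integral_le_bound) (use f in auto)
  ultimately show "(\<integral>x. f x \<partial>std_gaussian) \<in> {0..1}" by auto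
qed

section \<open>Passage to the limit in the inequality\<close>

lemma measurable_gauss_J_pair:
  fixes f g :: "real^'n \<Rightarrow> real"
  assumes \<rho>: "-1 < \<rho>" "\<rho> < 1" and [measurable]: "f \<in> borel_measurable borel" "g \<in> borel_measurable borel"
    and 01: "\<And>x. f x \<in> {0..1}" "\<And>x. g x \<in> {0..1}"
  shows "(\<lambda>p. gauss_J (f (fst p)) (g (snd p)) \<rho>) \<in> borel_measurable borel"
    and "integrable (gauss_pair \<rho>) (\<lambda>p. gauss_J (f (fst p)) (g (snd p)) \<rho>)"
proof -
  interpret M: prob_space "gauss_pair \<rho> :: ((real^'n) \<times> (real^'n)) measure" by (rule prob_space_gauss_pair[OF \<rho>])
  show m: "(\<lambda>p. gauss_J (f (fst p)) (g (snd p)) \<rho>) \<in> borel_measurable borel"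
    by (rule measurable_gauss_J[OF \<rho> _ _ 01]) (unfold borel_prod[symmetric], measurable)
  show "integrable (gauss_pair \<rho>) (\<lambda>p. gauss_J (f (fst p)) (g (snd p)) \<rho>)"
    using measurable_gauss_pair[OF \<rho> m] gauss_J_bounds[OF \<rho>]
    by (intro M.integrable_const_bound[where B=1]) auto
qed

text \<open>Dominated convergence on both sides, using that \<open>J\<close> is bounded by 1 and
  continuous on the closed square. Almost everywhere convergence transfers to the pair because each
  coordinate has law \<open>std_gaussian\<close>.\<close>

lemma gauss_J_le_AE_limit:
  fixes f g :: "real^'n \<Rightarrow> real" and f' g' :: "nat \<Rightarrow> real^'n \<Rightarrow> real"
  assumes \<rho>: "-1 < \<rho>" "\<rho> < 1"
    and m: "\<And>k. f' k \<in> borel_measurable borel" "\<And>k. g' k \<in> borel_measurable borel" "f \<in> borel_measurable borel" "g \<in> borel_measurable borel"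
    and 01: "\<And>k x. f' k x \<in> {0..1}" "\<And>k x. g' k x \<in> {0..1}" "\<And>x. f x \<in> {0..1}" "\<And>x. g x \<in> {0..1}"
    and lim: "AE x in std_gaussian. (\<lambda>k. f' k x) \<longlonglongrightarrow> f x" "AE x in std_gaussian. (\<lambda>k. g' k x) \<longlonglongrightarrow> g x"
    and le: "\<And>k. (\<integral>p. gauss_J (f' k (fst p)) (g' k (snd p)) \<rho> \<partial>gauss_pair \<rho>) \<le> gauss_J (\<integral>x. f' k x \<partial>std_gaussian) (\<integral>x. g' k x \<partial>std_gaussian) \<rho>"
  shows "(\<integral>p. gauss_J (f (fst p)) (g (snd p)) \<rho> \<partial>gauss_pair \<rho>) \<le> gauss_J (\<integral>x. f x \<partial>std_gaussian) (\<integral>x. g x \<partial>std_gaussian) \<rho>"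
proof (rule LIMSEQ_le)
  let ?G = "std_gaussian :: (real^'n) measure"
  let ?M = "gauss_pair \<rho> :: ((real^'n) \<times> (real^'n)) measure"
  interpret G: prob_space ?G by (rule prob_space_std_gaussian)
  interpret M: prob_space ?M by (rule prob_space_gauss_pair[OF \<rho>])
  show "\<exists>N. \<forall>k\<ge>N. (\<integral>p. gauss_J (f' k (fst p)) (g' k (snd p)) \<rho> \<partial>?M) \<le> gauss_J (\<integral>x. f' k x \<partial>?G) (\<integral>x. g' k x \<partial>?G) \<rho>"
    using le by blast
  have mean: "(\<lambda>k. \<integral>x. h' k x \<partial>?G) \<longlonglongrightarrow> (\<integral>x. h x \<partial>?G)"
    if "\<And>k. h' k \<in> borel_measurable borel" "h \<in> borel_measurable borel" "\<And>k x. h' k x \<in> {0..1}" "AE x in ?G. (\<lambda>k. h' k x) \<longlonglongrightarrow> h x"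
    for h' :: "nat \<Rightarrow> real^'n \<Rightarrow> real" and h
    by (rule integral_dominated_convergence[where w="\<lambda>_. 1"]) (use that in auto)
  show "(\<lambda>k. gauss_J (\<integral>x. f' k x \<partial>?G) (\<integral>x. g' k x \<partial>?G) \<rho>) \<longlonglongrightarrow> gauss_J (\<integral>x. f x \<partial>?G) (\<integral>x. g x \<partial>?G) \<rho>"
    by (intro gauss_J_tendsto[OF \<rho>] mean mean_in_unit_interval m 01 lim)
  have fs: "fst \<in> borel_measurable ?M" "snd \<in> borel_measurable ?M"
    by (intro measurable_gauss_pair[OF \<rho>] borel_measurable_continuous_onI continuous_intros)+
  have "AE p in ?M. (\<lambda>k. f' k (fst p)) \<longlonglongrightarrow> f (fst p)" "AE p in ?M. (\<lambda>k. g' k (snd p)) \<longlonglongrightarrow> g (snd p)"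
    by (rule AE_distrD[OF fs(1)], simp only: distr_fst_gauss_pair[OF \<rho>] lim)
       (rule AE_distrD[OF fs(2)], simp only: distr_snd_gauss_pair[OF \<rho>] lim)
  hence conv: "AE p in ?M. (\<lambda>k. gauss_J (f' k (fst p)) (g' k (snd p)) \<rho>) \<longlonglongrightarrow> gauss_J (f (fst p)) (g (snd p)) \<rho>"
  proof eventually_elim
    case (elim p)
    show ?case by (intro gauss_J_tendsto[OF \<rho>] 01 elim)
  qed
  show "(\<lambda>k. \<integral>p. gauss_J (f' k (fst p)) (g' k (snd p)) \<rho> \<partial>?M) \<longlonglongrightarrow> (\<integral>p. gauss_J (f (fst p)) (g (snd p)) \<rho> \<partial>?M)"
  proof (rule integral_dominated_convergence[where w="\<lambda>_. 1", OF _ _ _ conv])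
    show "(\<lambda>p. gauss_J (f (fst p)) (g (snd p)) \<rho>) \<in> borel_measurable ?M"
      "(\<lambda>p. gauss_J (f' k (fst p)) (g' k (snd p)) \<rho>) \<in> borel_measurable ?M" for k
      by (intro measurable_gauss_pair[OF \<rho>] measurable_gauss_J_pair(1)[OF \<rho>] m 01)+
    show "AE p in ?M. norm (gauss_J (f' k (fst p)) (g' k (snd p)) \<rho>) \<le> 1" for k
      using gauss_J_bounds[OF \<rho>] by simp
  qed simp
qed

lemma lipschitz_band_clip:
  assumes "(real k)-lipschitz_on UNIV h"
  shows "lipschitz_band (real k) (1 / (real k + 3)) (\<lambda>x. max (1 / (real k + 3)) (min (1 - 1 / (real k + 3)) (h x)))"
  unfolding lipschitz_band_def
proof (intro conjI allI lipschitz_onI)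
  let ?e = "1 / (real k + 3)"
  \<comment> \<open>The offset 3 keeps the cut at most one third, so the strip is nonempty for every
    \<open>k\<close>.\<close>
  have "?e \<le> 1 - ?e" by (simp add: field_simps)
  thus "max ?e (min (1 - ?e) (h x)) \<in> {?e..1 - ?e}" for x by auto
  show "dist (max ?e (min (1 - ?e) (h x))) (max ?e (min (1 - ?e) (h y))) \<le> real k * dist x y" for x y
  proof -
    have "dist (max ?e (min (1 - ?e) (h x))) (max ?e (min (1 - ?e) (h y))) \<le> dist (h x) (h y)"
      unfolding dist_real_def by linarith
    also have "\<dots> \<le> real k * dist x y" using lipschitz_onD[OF assms] by simp
    finally show ?thesis .
  qed
qed simp

text \<open>Along the approximation the Lipschitz constant grows and the strip opens to the full
  interval. The inequality at each stage carries no error term in these constants, so it survives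
  the limit.\<close>

lemma gauss_J_le_continuous:
  fixes f g :: "real^'n \<Rightarrow> real"
  assumes \<rho>: "0 < \<rho>" "\<rho> < 1" and cont: "continuous_on UNIV f" "continuous_on UNIV g"
    and 01: "\<And>x. f x \<in> {0..1}" "\<And>x. g x \<in> {0..1}"
  shows "(\<integral>p. gauss_J (f (fst p)) (g (snd p)) \<rho> \<partial>gauss_pair \<rho>) \<le> gauss_J (\<integral>x. f x \<partial>std_gaussian) (\<integral>x. g x \<partial>std_gaussian) \<rho>"
proof -
  define e where "e = (\<lambda>k::nat. 1 / (real k + 3))"
  define clip where "clip = (\<lambda>(h :: nat \<Rightarrow> real^'n \<Rightarrow> real) k x. max (e k) (min (1 - e k) (h k x)))"
  have e: "0 < e k" for k by (simp add: e_def)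
  have "e \<longlonglongrightarrow> 0"
    unfolding e_def using LIMSEQ_ignore_initial_segment[OF lim_1_over_n, of 3] by (simp add: add.commute)
  hence clip_lim: "(\<lambda>k. clip h k x) \<longlonglongrightarrow> t" if "(\<lambda>k. h k x) \<longlonglongrightarrow> t" "t \<in> {0..1}" for h x t
  proof -
    have "(\<lambda>k. clip h k x) \<longlonglongrightarrow> max 0 (min (1 - 0) t)"
      unfolding clip_def by (intro tendsto_intros that \<open>e \<longlonglongrightarrow> 0\<close>)
    thus ?thesis using that by simp
  qed
  obtain hf where hf: "\<And>k. (real k)-lipschitz_on UNIV (hf k)" "\<And>x. (\<lambda>k. hf k x) \<longlonglongrightarrow> f x"
    using lipschitz_minorants[OF cont(1) 01(1)] by blast
  obtain hg where hg: "\<And>k. (real k)-lipschitz_on UNIV (hg k)" "\<And>x. (\<lambda>k. hg k x) \<longlonglongrightarrow> g x"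
    using lipschitz_minorants[OF cont(2) 01(2)] by blast
  have band: "lipschitz_band (real k) (e k) (clip hf k)" "lipschitz_band (real k) (e k) (clip hg k)" for k
    using lipschitz_band_clip[OF hf(1)] lipschitz_band_clip[OF hg(1)] by (simp_all add: clip_def e_def)
  have "clip hf k x \<in> {e k..1 - e k}" "clip hg k x \<in> {e k..1 - e k}" for k x
    using lipschitz_bandD(3) band by blast+
  moreover have "{e k..1 - e k} \<subseteq> {0..1}" for k using e[of k] by auto
  ultimately have b01: "clip hf k x \<in> {0..1}" "clip hg k x \<in> {0..1}" for k x
    by blast+
  have lim: "AE x in std_gaussian. (\<lambda>k. clip hf k x) \<longlonglongrightarrow> f x" "AE x in std_gaussian. (\<lambda>k. clip hg k x) \<longlonglongrightarrow> g x"
    by (intro AE_I2 clip_lim hf(2) hg(2) 01)+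
  show ?thesis
    by (rule gauss_J_le_AE_limit[where f'="clip hf" and g'="clip hg", OF _ \<rho>(2) _ _ _ _ b01 01 lim gauss_J_le_lipschitz_band[OF \<rho> e band]])
       (use \<rho> in \<open>simp_all add: lipschitz_bandD(5)[OF band(1)] lipschitz_bandD(5)[OF band(2)]
          borel_measurable_continuous_onI[OF cont(1)] borel_measurable_continuous_onI[OF cont(2)]\<close>)
qed

text \<open>A Lebesgue measurable function is a pointwise limit of continuous ones off a negligible
  set. The Gaussian measure has a density, so that set is also null for it, and clipping to the unit
  interval preserves the limit.\<close>

lemma continuous_approximation_AE:
  fixes f :: "real^'n \<Rightarrow> real"
  assumes f: "f \<in> borel_measurable borel" and 01: "\<And>x. f x \<in> {0..1}"
  shows "\<exists>h. (\<forall>k. continuous_on UNIV (h k)) \<and> (\<forall>k x. h k x \<in> {0..1}) \<and>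
    (AE x in std_gaussian. (\<lambda>k. h k x) \<longlonglongrightarrow> f x)"
proof -
  have "f measurable_on UNIV"
    using f by (intro lebesgue_measurable_imp_measurable_on) (simp_all add: measurable_completion)
  then obtain N h where N: "negligible N" and h: "\<And>k::nat. continuous_on UNIV (h k)" "\<And>x. x \<notin> N \<Longrightarrow> (\<lambda>k. h k x) \<longlonglongrightarrow> f x"
    unfolding measurable_on_def by auto
  show ?thesis
  proof (intro exI[of _ "\<lambda>k x. max 0 (min 1 (h k x))"] conjI allI)
    show "continuous_on UNIV (\<lambda>x. max 0 (min 1 (h k x)))" for k
      by (intro continuous_intros h)
    show "max 0 (min 1 (h k x)) \<in> {0..1}" for k x by simp
    obtain N' where N': "N' \<in> null_sets lborel" "N \<subseteq> N'"
      using N unfolding negligible_iff_null_sets null_sets_completion_iff2 by blast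
    have "AE x in lborel. x \<notin> N'" by (rule AE_not_in[OF N'(1)])
    hence "AE x in std_gaussian. x \<notin> N'"
      unfolding std_gaussian_def by (subst AE_density) auto
    thus "AE x in std_gaussian. (\<lambda>k. max 0 (min 1 (h k x))) \<longlonglongrightarrow> f x"
    proof eventually_elim
      case (elim x)
      hence "(\<lambda>k. max 0 (min 1 (h k x))) \<longlonglongrightarrow> max 0 (min 1 (f x))"
        using h(2)[of x] N'(2) by (intro tendsto_intros) auto
      thus ?case using 01[of x] by simp
    qed
  qed
qed

lemma gauss_J_le_measurable:
  fixes f g :: "real^'n \<Rightarrow> real"
  assumes \<rho>: "0 < \<rho>" "\<rho> < 1" and m: "f \<in> borel_measurable borel" "g \<in> borel_measurable borel"
    and 01: "\<And>x. f x \<in> {0..1}" "\<And>x. g x \<in> {0..1}"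
  shows "(\<integral>p. gauss_J (f (fst p)) (g (snd p)) \<rho> \<partial>gauss_pair \<rho>) \<le> gauss_J (\<integral>x. f x \<partial>std_gaussian) (\<integral>x. g x \<partial>std_gaussian) \<rho>"
proof -
  obtain hf where hf: "\<And>k. continuous_on UNIV (hf k)" "\<And>k x. hf k x \<in> {0..1}" "AE x in std_gaussian. (\<lambda>k::nat. hf k x) \<longlonglongrightarrow> f x"
    using continuous_approximation_AE[OF m(1) 01(1)] by blast
  obtain hg where hg: "\<And>k. continuous_on UNIV (hg k)" "\<And>k x. hg k x \<in> {0..1}" "AE x in std_gaussian. (\<lambda>k::nat. hg k x) \<longlonglongrightarrow> g x"
    using continuous_approximation_AE[OF m(2) 01(2)] by blast
  show ?thesis
    by (rule gauss_J_le_AE_limit[where f'=hf and g'=hg, OF _ \<rho>(2) _ _ m hf(2) hg(2) 01 hf(3) hg(3) gauss_J_le_continuous[OF \<rho> hf(1) hg(1) hf(2) hg(2)]])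
       (use \<rho> in \<open>simp_all add: borel_measurable_continuous_onI[OF hf(1)] borel_measurable_continuous_onI[OF hg(1)]\<close>)
qed

lemma gauss_J_ge_measurable:
  fixes f g :: "real^'n \<Rightarrow> real"
  assumes \<rho>: "-1 < \<rho>" "\<rho> < 0" and m[measurable]: "f \<in> borel_measurable borel" "g \<in> borel_measurable borel"
    and 01: "\<And>x. f x \<in> {0..1}" "\<And>x. g x \<in> {0..1}"
  shows "gauss_J (\<integral>x. f x \<partial>std_gaussian) (\<integral>x. g x \<partial>std_gaussian) \<rho> \<le> (\<integral>p. gauss_J (f (fst p)) (g (snd p)) \<rho> \<partial>gauss_pair \<rho>)"
proof -
  let ?G = "std_gaussian :: (real^'n) measure"
  define \<sigma> where "\<sigma> = - \<rho>"
  have \<sigma>: "0 < \<sigma>" "\<sigma> < 1" "-1 < \<sigma>" and \<rho>1: "\<rho> < 1" using \<rho> by (simp_all add: \<sigma>_def)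
  let ?M = "gauss_pair \<sigma> :: ((real^'n) \<times> (real^'n)) measure"
  interpret G: prob_space ?G by (rule prob_space_std_gaussian)
  have [simp]: "measure ?G UNIV = 1" using G.prob_space by simp
  \<comment> \<open>The reflection of the argument comes from passing to correlation
    \<open>\<sigma>\<close>, the complement from \<open>1 - y\<close> in the identity for
    \<open>J\<close> at opposite correlation.\<close>
  define g' where "g' = (\<lambda>x. 1 - g (- x))"
  have m'[measurable]: "g' \<in> borel_measurable borel" unfolding g'_def by measurable
  have range': "g' x \<in> {0..1}" for x using 01(2)[of "- x"] by (simp add: g'_def)
  have T: "(\<lambda>p. (fst p, - snd p)) \<in> borel_measurable ?M"
    by (intro measurable_gauss_pair[OF \<sigma>(3,2)] borel_measurable_continuous_onI continuous_intros)
  have D: "(\<integral>p. F p \<partial>gauss_pair \<rho>) = (\<integral>p. F (fst p, - snd p) \<partial>?M)" if "F \<in> borel_measurable borel" for F :: "_ \<Rightarrow> real"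
    using integral_distr[OF T that] unfolding distr_reflect_gauss_pair[OF \<sigma>(3,2)] by (simp add: \<sigma>_def)
  have J: "gauss_J x y \<rho> = x - gauss_J x (1 - y) \<sigma>" if "x \<in> {0..1}" for x y
    using gauss_J_uminus[OF \<sigma>(3,2), of x y] that by (simp add: \<sigma>_def)
  have "(\<integral>x. g x \<partial>?G) = (\<integral>p. g (snd p) \<partial>gauss_pair \<rho>)"
    using integral_fst_gauss_pair(2)[OF \<rho>(1) \<rho>1 m(2)] by simp
  also have "\<dots> = (\<integral>p. g (- snd p) \<partial>?M)"
    by (subst D) (simp_all add: borel_prod[symmetric])
  also have "\<dots> = (\<integral>x. g (- x) \<partial>?G)"
    by (rule integral_fst_gauss_pair(2)[OF \<sigma>(3,2), where f="\<lambda>x. g (- x)"]) measurable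
  also have "\<dots> = 1 - (\<integral>x. g' x \<partial>?G)"
    using mean_in_unit_interval(2)[of "\<lambda>x. g (- x)"] 01(2) by (simp add: g'_def)
  finally have mean: "(\<integral>x. g' x \<partial>?G) = 1 - (\<integral>x. g x \<partial>?G)" by simp
  have "(\<integral>p. gauss_J (f (fst p)) (g (snd p)) \<rho> \<partial>gauss_pair \<rho>) = (\<integral>p. f (fst p) - gauss_J (f (fst p)) (g' (snd p)) \<sigma> \<partial>?M)"
    by (subst D[OF measurable_gauss_J_pair(1)[OF \<rho>(1) \<rho>1 m 01]]) (simp add: J[OF 01(1)] g'_def)
  also have "\<dots> = (\<integral>x. f x \<partial>?G) - (\<integral>p. gauss_J (f (fst p)) (g' (snd p)) \<sigma> \<partial>?M)"
    using measurable_gauss_J_pair(2)[OF \<sigma>(3,2) m(1) m' 01(1) range'] mean_in_unit_interval(2)[OF m(1) 01(1)]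
      integral_fst_gauss_pair(1,3)[OF \<sigma>(3,2) m(1)] by simp
  \<comment> \<open>The term \<open>E f\<close> is exact, and \<open>J\<close> at correlation
    \<open>\<sigma>\<close> enters with a minus sign, which reverses the inequality.\<close>
  also have "\<dots> \<ge> (\<integral>x. f x \<partial>?G) - gauss_J (\<integral>x. f x \<partial>?G) (\<integral>x. g' x \<partial>?G) \<sigma>"
    using gauss_J_le_measurable[OF \<sigma>(1,2) m(1) m' 01(1) range'] by simp
  finally show ?thesis
    unfolding mean J[OF mean_in_unit_interval(1)[OF m(1) 01(1)]] .
qed

theorem theorem1p2:
  fixes f g :: "real^'n \<Rightarrow> real" and \<rho> :: real
  assumes "f \<in> borel_measurable borel" and "g \<in> borel_measurable borel"
    and "\<And>x. f x \<in> {0..1}" and "\<And>x. g x \<in> {0..1}"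
  shows "(0 < \<rho> \<and> \<rho> < 1 \<longrightarrow>
            (\<integral>p. gauss_J (f (fst p)) (g (snd p)) \<rho> \<partial>gauss_pair \<rho>)
              \<le> gauss_J (\<integral>x. f x \<partial>std_gaussian) (\<integral>x. g x \<partial>std_gaussian) \<rho>)
       \<and> (-1 < \<rho> \<and> \<rho> < 0 \<longrightarrow>
            (\<integral>p. gauss_J (f (fst p)) (g (snd p)) \<rho> \<partial>gauss_pair \<rho>)
              \<ge> gauss_J (\<integral>x. f x \<partial>std_gaussian) (\<integral>x. g x \<partial>std_gaussian) \<rho>)"
  using gauss_J_le_measurable[of \<rho> f g] gauss_J_ge_measurable[of \<rho> f g] assms by blast

end
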